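(* Let $U$ and $U_0$ be two unitary operators in a separable Hilbert space $\mathcal{H}$ such that $U-U_0\in\mathcal{B}_2(\mathcal{H})$, and let $A\in\mathcal{B}_2(\mathcal{H})$ be the corresponding self-adjoint operator such that $U=e^{iA}U_0$. Let $U_s=e^{isA}U_0$, $s\in\mathbb{R}$, and let $p(\cdot)$ be any trigonometric polynomial on $\mathbb{T}$ with complex coefficients. Then there exists a sequence $\{P_n\}$ of finite rank projections in $\mathcal{H}$ such that $$\operatorname{Tr}\Big\{p(U)-p(U_0)-\frac{d}{ds}\Big|_{s=0}p(U_s)\Big\}=\lim_{n\to\infty}\operatorname{Tr}\Big[P_n\Big\{p(U_n)-p(U_{0,n})-\frac{d}{ds}\Big|_{s=0}p(U_{s,n})\Big\}P_n\Big],$$ where $A_n=P_nAP_n$, $U_{0,n}=e^{i\phi}(i-P_nH_0P_n)(i+P_nH_0P_n)^{-1}$, $U_n=e^{iA_n}U_{0,n}$ and $U_{s,n}=e^{isA_n}U_{0,n}$.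
   Context: $\mathcal{B}_2(\mathcal{H})$ denotes the Hilbert-Schmidt class operators on $\mathcal{H}$, and $\operatorname{Tr}$ the trace of a trace class operator. Whenever $U-U_0\in\mathcal{B}_2(\mathcal{H})$, there exists a self-adjoint $A\in\mathcal{B}_2(\mathcal{H})$ with $U=e^{iA}U_0$; this is the operator $A$ meant in the claim. $\mathbb{T}$ is the unit circle; a trigonometric polynomial is a finite sum $p(\lambda)=\sum_r a_r\lambda^r$, $r\in\mathbb{Z}$, $a_r\in\mathbb{C}$, and $p(V)=\sum_r a_rV^r$ for unitary $V$. Derivatives in $s$ are taken in operator norm. Since $\mathcal{H}$ is separable, there is $\phi\in(-\pi,\pi]$ such that $e^{i\phi}+U_0$ is one to one; fix such a $\phi$ and let $H_0=i(I-e^{-i\phi}U_0)(I+e^{-i\phi}U_0)^{-1}$, which is a (possibly unbounded) self-adjoint operator with $U_0=e^{i\phi}(i-H_0)(i+H_0)^{-1}$. Projections are orthogonal projections, and the $P_n$ are understood to have range contained in $\operatorname{Dom}(H_0)$, so that $P_nH_0P_n$ makes sense. *)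

theory Defs
  imports "HOL-Analysis.Analysis"
begin

text \<open>
  Complex Hilbert spaces. The inner product is linear in the first argument. The real structure
  (\<^term>\<open>norm\<close>, \<^term>\<open>inner\<close>, \<^term>\<open>scaleR\<close>) is the one induced by the complex structure, so that
  the library theory of real Banach spaces and of the operator norm applies unchanged.
\<close>

class scaleC =
  fixes scaleC :: "complex \<Rightarrow> 'a \<Rightarrow> 'a"  (infixr "*\<^sub>C" 75)

class chilbert_space = real_inner + banach + scaleC +
  fixes cinner :: "'a \<Rightarrow> 'a \<Rightarrow> complex"
  assumes scaleC_add_right: "c *\<^sub>C (x + y) = c *\<^sub>C x + c *\<^sub>C y"
    and scaleC_add_left: "(c + d) *\<^sub>C x = c *\<^sub>C x + d *\<^sub>C x"
    and scaleC_scaleC: "c *\<^sub>C d *\<^sub>C x = (c * d) *\<^sub>C x"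
    and scaleR_scaleC: "r *\<^sub>R x = complex_of_real r *\<^sub>C x"
    and cinner_commute: "cinner x y = cnj (cinner y x)"
    and cinner_add_left: "cinner (x + y) z = cinner x z + cinner y z"
    and cinner_scaleC_left: "cinner (c *\<^sub>C x) y = c * cinner x y"
    and inner_eq_Re_cinner: "inner x y = Re (cinner x y)"

instantiation complex :: chilbert_space
begin

definition scaleC_complex :: "complex \<Rightarrow> complex \<Rightarrow> complex"
  where "scaleC_complex c x = c * x"

definition cinner_complex :: "complex \<Rightarrow> complex \<Rightarrow> complex"
  where "cinner_complex x y = x * cnj y"

instance
  by standard
    (simp_all add: scaleC_complex_def cinner_complex_def algebra_simps scaleR_conv_of_real
      inner_complex_def)

end

lemma norm_scaleC:
  fixes x :: "'a::chilbert_space"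
  shows "norm (c *\<^sub>C x) = cmod c * norm x"
proof -
  have "cinner (c *\<^sub>C x) (c *\<^sub>C x) = c * (cnj c * cinner x x)"
    by (metis cinner_commute cinner_scaleC_left complex_cnj_mult)
  also have "\<dots> = complex_of_real ((cmod c)\<^sup>2) * cinner x x"
    by (simp only: complex_norm_square mult.assoc)
  finally have "Re (cinner (c *\<^sub>C x) (c *\<^sub>C x)) = (cmod c)\<^sup>2 * Re (cinner x x)"
    by simp
  hence "(norm (c *\<^sub>C x))\<^sup>2 = (cmod c * norm x)\<^sup>2"
    by (simp add: power2_norm_eq_inner inner_eq_Re_cinner power_mult_distrib)
  thus ?thesis
    by simp
qed

lemma bounded_linear_scaleC:
  "bounded_linear (\<lambda>x::'a::chilbert_space. c *\<^sub>C x)"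
proof (rule bounded_linear_intro[where K = "cmod c"])
  fix x y :: 'a and r :: real
  show "c *\<^sub>C (x + y) = c *\<^sub>C x + c *\<^sub>C y"
    by (rule scaleC_add_right)
  show "c *\<^sub>C (r *\<^sub>R x) = r *\<^sub>R (c *\<^sub>C x)"
    by (simp add: scaleR_scaleC scaleC_scaleC mult.commute)
  show "norm (c *\<^sub>C x) \<le> norm x * cmod c"
    by (simp add: norm_scaleC)
qed

text \<open>
  Bounded operators are elements of \<^typ>\<open>'a \<Rightarrow>\<^sub>L 'a\<close> (bounded real-linear maps under the operator
  norm) that are in addition complex-linear, see \<open>clinear_op\<close>.
\<close>

instantiation blinfun :: (real_normed_vector, chilbert_space) scaleC
begin

lift_definition scaleC_blinfun :: "complex \<Rightarrow> 'a \<Rightarrow>\<^sub>L 'b \<Rightarrow> 'a \<Rightarrow>\<^sub>L 'b"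
  is "\<lambda>c T x. c *\<^sub>C T x"
  by (rule bounded_linear_compose[OF bounded_linear_scaleC])

instance ..

end

definition clinear_op :: "('a::chilbert_space \<Rightarrow>\<^sub>L 'a) \<Rightarrow> bool"
  where "clinear_op T \<longleftrightarrow>
    (\<forall>c x. blinfun_apply T (c *\<^sub>C x) = c *\<^sub>C blinfun_apply T x)"

definition self_adjoint_op :: "('a::chilbert_space \<Rightarrow>\<^sub>L 'a) \<Rightarrow> bool"
  where "self_adjoint_op T \<longleftrightarrow> clinear_op T \<and>
    (\<forall>x y. cinner (blinfun_apply T x) y = cinner x (blinfun_apply T y))"

definition positive_op :: "('a::chilbert_space \<Rightarrow>\<^sub>L 'a) \<Rightarrow> bool"
  where "positive_op T \<longleftrightarrow> self_adjoint_op T \<and> (\<forall>x. 0 \<le> Re (cinner (blinfun_apply T x) x))"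

definition unitary_op :: "('a::chilbert_space \<Rightarrow>\<^sub>L 'a) \<Rightarrow> bool"
  where "unitary_op T \<longleftrightarrow> clinear_op T \<and> surj (blinfun_apply T) \<and>
    (\<forall>x y. cinner (blinfun_apply T x) (blinfun_apply T y) = cinner x y)"

definition finite_rank_op :: "('a::chilbert_space \<Rightarrow>\<^sub>L 'a) \<Rightarrow> bool"
  where "finite_rank_op T \<longleftrightarrow> clinear_op T \<and>
    (\<exists>S. finite S \<and> range (blinfun_apply T) \<subseteq> {(\<Sum>v\<in>S. c v *\<^sub>C v) |c. True})"

definition orth_projection :: "('a::chilbert_space \<Rightarrow>\<^sub>L 'a) \<Rightarrow> bool"
  where "orth_projection P \<longleftrightarrow> self_adjoint_op P \<and> P o\<^sub>L P = P"

primrec op_pow :: "('a::chilbert_space \<Rightarrow>\<^sub>L 'a) \<Rightarrow> nat \<Rightarrow> 'a \<Rightarrow>\<^sub>L 'a"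
  where
    "op_pow T 0 = id_blinfun"
  | "op_pow T (Suc n) = T o\<^sub>L op_pow T n"

definition op_inverse :: "('a::chilbert_space \<Rightarrow>\<^sub>L 'a) \<Rightarrow> 'a \<Rightarrow>\<^sub>L 'a"
  where "op_inverse T = (THE S. S o\<^sub>L T = id_blinfun \<and> T o\<^sub>L S = id_blinfun)"

definition op_powi :: "('a::chilbert_space \<Rightarrow>\<^sub>L 'a) \<Rightarrow> int \<Rightarrow> 'a \<Rightarrow>\<^sub>L 'a"
  where "op_powi T r =
    (if 0 \<le> r then op_pow T (nat r) else op_pow (op_inverse T) (nat (- r)))"

text \<open>The class \<^class>\<open>real_normed_algebra_1\<close> required by \<^term>\<open>exp\<close> is not available for
  \<^typ>\<open>'a \<Rightarrow>\<^sub>L 'a\<close>.\<close>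

definition op_exp :: "('a::chilbert_space \<Rightarrow>\<^sub>L 'a) \<Rightarrow> 'a \<Rightarrow>\<^sub>L 'a"
  where "op_exp T = (\<Sum>n. op_pow T n /\<^sub>R fact n)"

text \<open>The trigonometric polynomial with coefficients \<open>a r\<close>, for \<open>r\<close> in a finite set \<open>R\<close>, evaluated
  at an operator.\<close>

definition trig_poly ::
    "int set \<Rightarrow> (int \<Rightarrow> complex) \<Rightarrow> ('a::chilbert_space \<Rightarrow>\<^sub>L 'a) \<Rightarrow> 'a \<Rightarrow>\<^sub>L 'a"
  where "trig_poly R a V = (\<Sum>r\<in>R. a r *\<^sub>C op_powi V r)"

text \<open>An orthonormal set is a basis iff it is maximal, i.e. only \<open>0\<close> is orthogonal to it.\<close>

definition orthonormal_basis :: "'a::chilbert_space set \<Rightarrow> bool"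
  where "orthonormal_basis B \<longleftrightarrow>
    (\<forall>b\<in>B. \<forall>b'\<in>B. cinner b b' = (if b = b' then 1 else 0)) \<and>
    (\<forall>x. (\<forall>b\<in>B. cinner x b = 0) \<longrightarrow> x = 0)"

text \<open>The sums below do not depend on the orthonormal basis, so any one may be used.\<close>

definition hilbert_schmidt :: "('a::chilbert_space \<Rightarrow>\<^sub>L 'a) \<Rightarrow> bool"
  where "hilbert_schmidt T \<longleftrightarrow> clinear_op T \<and>
    (\<exists>B. orthonormal_basis B \<and> (\<lambda>b. (norm (blinfun_apply T b))\<^sup>2) summable_on B)"

text \<open>\<open>is_modulus M T\<close> says that \<open>M\<close> is the positive square root \<open>|T|\<close> of \<open>T\<^sup>* T\<close>: the
  last condition is \<open>M\<^sup>2 = T\<^sup>* T\<close>, tested in the inner product.\<close>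

definition is_modulus :: "('a::chilbert_space \<Rightarrow>\<^sub>L 'a) \<Rightarrow> ('a \<Rightarrow>\<^sub>L 'a) \<Rightarrow> bool"
  where "is_modulus M T \<longleftrightarrow> positive_op M \<and>
    (\<forall>x y. cinner (blinfun_apply (M o\<^sub>L M) x) y = cinner (blinfun_apply T x) (blinfun_apply T y))"

definition trace_class :: "('a::chilbert_space \<Rightarrow>\<^sub>L 'a) \<Rightarrow> bool"
  where "trace_class T \<longleftrightarrow> clinear_op T \<and>
    (\<exists>M B. is_modulus M T \<and> orthonormal_basis B \<and>
      (\<lambda>b. Re (cinner (blinfun_apply M b) b)) summable_on B)"

definition op_trace :: "('a::chilbert_space \<Rightarrow>\<^sub>L 'a) \<Rightarrow> complex"
  where "op_trace T =
    (\<Sum>\<^sub>\<infinity>b\<in>(SOME B. orthonormal_basis B). cinner (blinfun_apply T b) b)"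

text \<open>
  The unbounded operator \<open>H\<^sub>0 = \<i> (I - e\<^bsup>-\<i>\<phi>\<^esup> U\<^sub>0) (I + e\<^bsup>-\<i>\<phi>\<^esup> U\<^sub>0)\<^sup>-\<^sup>1\<close> is given by its domain
  \<open>cayley_dom \<phi> U\<^sub>0\<close> and a function \<open>cayley_H \<phi> U\<^sub>0\<close> that is meaningful on this domain only.
\<close>

definition cayley_dom :: "real \<Rightarrow> ('a::chilbert_space \<Rightarrow>\<^sub>L 'a) \<Rightarrow> 'a set"
  where "cayley_dom \<phi> U0 = range (blinfun_apply (id_blinfun + cis (- \<phi>) *\<^sub>C U0))"

definition cayley_H :: "real \<Rightarrow> ('a::chilbert_space \<Rightarrow>\<^sub>L 'a) \<Rightarrow> 'a \<Rightarrow> 'a"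
  where "cayley_H \<phi> U0 x =
    \<i> *\<^sub>C blinfun_apply (id_blinfun - cis (- \<phi>) *\<^sub>C U0)
           (inv (blinfun_apply (id_blinfun + cis (- \<phi>) *\<^sub>C U0)) x)"

text \<open>\<open>P H P\<close> as a bounded operator; meaningful when \<open>P\<close> is a finite rank projection whose range
  lies in the domain of \<open>H\<close>.\<close>

definition compress :: "('a::chilbert_space \<Rightarrow>\<^sub>L 'a) \<Rightarrow> ('a \<Rightarrow> 'a) \<Rightarrow> 'a \<Rightarrow>\<^sub>L 'a"
  where "compress P H = Blinfun (\<lambda>x. blinfun_apply P (H (blinfun_apply P x)))"

definition cayley_U :: "real \<Rightarrow> ('a::chilbert_space \<Rightarrow>\<^sub>L 'a) \<Rightarrow> 'a \<Rightarrow>\<^sub>L 'a"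
  where "cayley_U \<phi> H =
    cis \<phi> *\<^sub>C ((\<i> *\<^sub>C id_blinfun - H) o\<^sub>L op_inverse (\<i> *\<^sub>C id_blinfun + H))"

text \<open>\<open>U\<^sub>s = e\<^bsup>\<i>sA\<^esup> U\<^sub>0\<close>\<close>

definition exp_path :: "('a::chilbert_space \<Rightarrow>\<^sub>L 'a) \<Rightarrow> ('a \<Rightarrow>\<^sub>L 'a) \<Rightarrow> real \<Rightarrow> 'a \<Rightarrow>\<^sub>L 'a"
  where "exp_path A U0 s = op_exp ((\<i> * complex_of_real s) *\<^sub>C A) o\<^sub>L U0"

end

theory Submission
  imports Defs
begin

text \<open>
  By the telescoping recursion
  \<open>R\<^sub>r\<^sub>+\<^sub>1 = U\<^sub>0 R\<^sub>r + (U - U\<^sub>0) (U\<^sup>r - U\<^sub>0\<^sup>r) + (U - U\<^sub>0 - iAU\<^sub>0) U\<^sub>0\<^sup>r\<close> and the factorisations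
  \<open>U - U\<^sub>0 = A G U\<^sub>0\<close> and \<open>U - U\<^sub>0 - iAU\<^sub>0 = A E A U\<^sub>0\<close> with entire functions \<open>G\<close>, \<open>E\<close> of \<open>A\<close>, the
  first-order Taylor remainder \<open>R\<^sub>r\<close> of \<open>U\<^sup>r\<close> at \<open>U\<^sub>0\<close> is a finite sum of terms \<open>X A Y A Z\<close>;
  negative powers follow by taking adjoints. As \<open>A\<close> is Hilbert-Schmidt, each
  such term is trace class, and its trace depends continuously on bounded \<open>X\<close>, \<open>Y\<close>, \<open>Z\<close> with respect
  to strong convergence of the operators and of their adjoints. It therefore suffices to
  choose \<open>P\<^sub>n \<rightarrow> I\<close> with \<open>U\<^sub>0\<^sub>,\<^sub>n \<rightarrow> U\<^sub>0\<close> in this sense. The projections onto the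
  spans of \<open>x\<^sub>k = (I + W) u\<^sub>k\<close>, \<open>k < n\<close>, with \<open>W = e\<^bsup>-i\<phi>\<^esup>U\<^sub>0\<close> and \<open>u\<^sub>k\<close> dense, do this, because
  the vectors \<open>(i + H\<^sub>0) x\<^sub>k = 2i u\<^sub>k\<close> are dense too.
\<close>

section \<open>Inner products and adjoints\<close>

text \<open>Since H0 is unbounded, the compressions P_n H0 P_n need not be uniformly bounded; it is
  their Cayley transforms that are compared with U0, and only strongly. Strong convergence alone
  says nothing about traces, but next to a Hilbert-Schmidt factor it becomes convergence in
  Hilbert-Schmidt norm. A remainder of second order offers two factors A, one for each side of a
  Cauchy-Schwarz estimate of the pairing of Y A Z e with A X' f, where X' is the adjoint of X. In
  this estimate Z enters through its adjoint, which is why both directions of strong convergence are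
  tracked; for unitary and for self-adjoint operators the second follows from the first. The
  compression A_n = P_n A P_n does not disturb the pattern: its projections are absorbed into the
  neighbouring X, Y, Z, so that A stays fixed while everything around it varies. The definition of
  trace class asks for a modulus, which is built from the binomial series of sqrt(1 - x), absolutely
  convergent up to the boundary x = 1.\<close>

lemma scaleC_one [simp]: "1 *\<^sub>C (x::'a::chilbert_space) = x"
  using scaleR_scaleC[of 1 x] by simp

lemma bounded_bilinear_scaleC: "bounded_bilinear (scaleC :: complex \<Rightarrow> 'a::chilbert_space \<Rightarrow> 'a)"
proof
  fix r :: real and c d :: complex and x y :: 'a
  show "(r *\<^sub>R c) *\<^sub>C x = r *\<^sub>R c *\<^sub>C x"
    by (simp add: scaleR_scaleC scaleC_scaleC scaleC_complex_def)
  show "c *\<^sub>C r *\<^sub>R x = r *\<^sub>R c *\<^sub>C x"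
    by (simp add: scaleR_scaleC scaleC_scaleC mult.commute)
  show "\<exists>K. \<forall>c (x::'a). norm (c *\<^sub>C x) \<le> norm c * norm x * K"
    by (intro exI[of _ 1]) (simp add: norm_scaleC)
qed (simp_all add: scaleC_add_right scaleC_add_left)

interpretation scaleC: bounded_bilinear "scaleC :: complex \<Rightarrow> 'a::chilbert_space \<Rightarrow> 'a"
  by (rule bounded_bilinear_scaleC)

lemmas scaleC_zero [simp] = scaleC.zero_left scaleC.zero_right

lemma scaleC_left_commute: "c *\<^sub>C d *\<^sub>C (x::'a::chilbert_space) = d *\<^sub>C c *\<^sub>C x"
  by (simp add: scaleC_scaleC mult.commute)

lemma cinner_add_right: "cinner x (y + z) = cinner x y + cinner x (z::'a::chilbert_space)"
  by (metis cinner_add_left cinner_commute complex_cnj_add)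

lemma cinner_scaleC_right: "cinner x (c *\<^sub>C y) = cnj c * cinner x (y::'a::chilbert_space)"
  by (metis cinner_commute cinner_scaleC_left complex_cnj_mult)

lemma cinner_self: "cinner x x = complex_of_real ((norm (x::'a::chilbert_space))\<^sup>2)"
proof -
  have "Im (cinner x x) = 0"
    using cinner_commute[of x x] by (simp add: complex_eq_iff)
  then show ?thesis
    by (simp add: complex_eq_iff power2_norm_eq_inner inner_eq_Re_cinner)
qed

text \<open>A unimodular factor \<open>c\<close> turns the pairing into its own modulus, so that the
  real Cauchy-Schwarz inequality for \<open>inner\<close> suffices.\<close>

lemma cinner_Cauchy_Schwarz: "cmod (cinner x y) \<le> norm x * norm (y::'a::chilbert_space)"
proof (cases "cinner x y = 0")
  case False
  define c where "c = cnj (cinner x y) / cmod (cinner x y)"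
  have [simp]: "cmod c = 1"
    using False by (simp add: c_def norm_divide)
  have "cinner (c *\<^sub>C x) y = complex_of_real (cmod (cinner x y))"
    using False complex_norm_square[of "cinner x y"]
    by (simp add: cinner_scaleC_left c_def field_simps power2_eq_square)
  then have "cmod (cinner x y) = inner (c *\<^sub>C x) y"
    by (simp add: inner_eq_Re_cinner)
  also have "\<dots> \<le> norm (c *\<^sub>C x) * norm y"
    by (rule norm_cauchy_schwarz)
  finally show ?thesis
    by (simp add: norm_scaleC)
qed simp

lemma bounded_bilinear_cinner: "bounded_bilinear (cinner :: 'a::chilbert_space \<Rightarrow> 'a \<Rightarrow> complex)"
proof
  fix r :: real and x y :: 'a
  show "cinner (r *\<^sub>R x) y = r *\<^sub>R cinner x y" "cinner x (r *\<^sub>R y) = r *\<^sub>R cinner x y"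
    by (simp_all add: scaleR_scaleC cinner_scaleC_left cinner_scaleC_right scaleC_complex_def)
  show "\<exists>K. \<forall>x y::'a. norm (cinner x y) \<le> norm x * norm y * K"
    by (intro exI[of _ 1]) (simp add: cinner_Cauchy_Schwarz)
qed (simp_all add: cinner_add_left cinner_add_right)

interpretation cinner: bounded_bilinear "cinner :: 'a::chilbert_space \<Rightarrow> 'a \<Rightarrow> complex"
  by (rule bounded_bilinear_cinner)

lemmas cinner_zero [simp] = cinner.zero_left cinner.zero_right
lemmas cinner_simps = cinner_add_left cinner_add_right cinner.diff_left cinner.diff_right
  cinner.minus_left cinner.minus_right cinner_scaleC_left cinner_scaleC_right

lemma cinner_ext:
  fixes x y :: "'a::chilbert_space"
  assumes "\<And>z. cinner x z = cinner y z"
  shows "x = y"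
proof -
  have "cinner (x - y) (x - y) = 0"
    using assms by (simp add: cinner.diff_left)
  then show ?thesis
    by (simp add: cinner_self)
qed

lemma norm_add_square:
  "(norm (x + y))\<^sup>2 = (norm x)\<^sup>2 + 2 * Re (cinner x y) + (norm (y::'a::chilbert_space))\<^sup>2"
  by (simp add: power2_norm_eq_inner inner_simps inner_commute flip: inner_eq_Re_cinner)

lemma norm_diff_square:
  "(norm (x - y))\<^sup>2 = (norm x)\<^sup>2 - 2 * Re (cinner x y) + (norm (y::'a::chilbert_space))\<^sup>2"
  by (simp add: power2_norm_eq_inner inner_simps inner_commute flip: inner_eq_Re_cinner)

lemma Pythagoras:
  fixes x y :: "'a::chilbert_space"
  assumes "cinner x y = 0"
  shows "(norm (x + y))\<^sup>2 = (norm x)\<^sup>2 + (norm y)\<^sup>2"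
  by (simp add: norm_add_square assms)

lemmas blinfun_scaleC_apply [simp] = scaleC_blinfun.rep_eq
lemmas op_simps = blinfun.bilinear_simps scaleC_blinfun.rep_eq

lemma bounded_bilinear_scaleC_blinfun:
  "bounded_bilinear (scaleC :: complex \<Rightarrow> ('a::real_normed_vector \<Rightarrow>\<^sub>L 'b::chilbert_space) \<Rightarrow> _)"
proof
  fix r :: real and c d :: complex and S T :: "'a \<Rightarrow>\<^sub>L 'b"
  show "\<exists>K. \<forall>c (T::'a \<Rightarrow>\<^sub>L 'b). norm (c *\<^sub>C T) \<le> norm c * norm T * K"
    by (intro exI[of _ 1])
      (auto intro!: norm_blinfun_bound mult_left_mono norm_blinfun simp: norm_scaleC mult.assoc)
qed (auto intro!: blinfun_eqI
      simp: op_simps scaleC.add_left scaleC.add_right scaleC.scaleR_left scaleC.scaleR_right)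

interpretation scaleC_blinfun: bounded_bilinear
  "scaleC :: complex \<Rightarrow> ('a::real_normed_vector \<Rightarrow>\<^sub>L 'b::chilbert_space) \<Rightarrow> _"
  by (rule bounded_bilinear_scaleC_blinfun)

lemma norm_scaleC_blinfun_le:
  fixes T :: "'a::real_normed_vector \<Rightarrow>\<^sub>L 'b::chilbert_space"
  shows "norm (c *\<^sub>C T) \<le> cmod c * norm T"
  by (auto intro!: norm_blinfun_bound mult_left_mono norm_blinfun simp: norm_scaleC mult.assoc)

interpretation compose: bounded_bilinear
  "(o\<^sub>L) :: ('b::real_normed_vector \<Rightarrow>\<^sub>L 'c::real_normed_vector) \<Rightarrow> ('a::real_normed_vector \<Rightarrow>\<^sub>L 'b) \<Rightarrow> _"
  by (rule bounded_bilinear_blinfun_compose)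

lemma compose_assoc: "(S o\<^sub>L T) o\<^sub>L V = S o\<^sub>L (T o\<^sub>L V)"
  by (rule blinfun_eqI) simp

lemma compose_id [simp]: "id_blinfun o\<^sub>L T = T" "T o\<^sub>L id_blinfun = T"
  by (auto intro: blinfun_eqI)

lemma norm_compose_le:
  assumes "norm S \<le> a" "norm T \<le> b"
  shows "norm (S o\<^sub>L T) \<le> a * b"
  by (rule order_trans[OF norm_blinfun_compose]) (meson assms mult_mono' norm_ge_zero)

lemma scaleC_compose_left: "(c *\<^sub>C S) o\<^sub>L T = c *\<^sub>C (S o\<^sub>L T)"
  by (rule blinfun_eqI) simp

text \<open>A relation rather than an operation: every adjoint that occurs is exhibited along with
  its operator, and the closure lemmas below build it up through sums, products and limits.\<close>

definition adjoint_pair :: "('a::chilbert_space \<Rightarrow>\<^sub>L 'a) \<Rightarrow> ('a \<Rightarrow>\<^sub>L 'a) \<Rightarrow> bool"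
  where "adjoint_pair T S \<longleftrightarrow> (\<forall>x y. cinner (T x) y = cinner x (S y))"

lemma adjoint_pairD: "adjoint_pair T S \<Longrightarrow> cinner (T x) y = cinner x (S y)"
  by (simp add: adjoint_pair_def)

lemma adjoint_pair_sym: "adjoint_pair T S \<Longrightarrow> adjoint_pair S T"
  unfolding adjoint_pair_def
  by (metis cinner_commute)

text \<open>Both sides agree when tested against every vector, because the scalar leaves the first
  slot unchanged. Complex linearity is therefore available wherever an adjoint is known.\<close>

lemma adjoint_pair_clinear:
  assumes "adjoint_pair T S"
  shows "clinear_op T"
  unfolding clinear_op_def
  by (intro allI, rule cinner_ext) (simp add: adjoint_pairD[OF assms] cinner_scaleC_left)

lemma clinear_opD: "clinear_op T \<Longrightarrow> T (c *\<^sub>C x) = c *\<^sub>C T x"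
  by (simp add: clinear_op_def)

lemma scaleC_compose_right: "clinear_op S \<Longrightarrow> S o\<^sub>L (c *\<^sub>C T) = c *\<^sub>C (S o\<^sub>L T)"
  by (rule blinfun_eqI) (simp add: clinear_op_def)

lemma adjoint_pair_unique: "adjoint_pair T S \<Longrightarrow> adjoint_pair T S' \<Longrightarrow> S = S'"
  by (rule blinfun_eqI, rule cinner_ext) (metis adjoint_pairD adjoint_pair_sym)

lemma self_adjoint_iff: "self_adjoint_op A \<longleftrightarrow> adjoint_pair A A"
  using adjoint_pair_clinear[of A A] by (auto simp: self_adjoint_op_def adjoint_pair_def)

lemma adjoint_pair_0: "adjoint_pair 0 0"
  by (simp add: adjoint_pair_def)

lemma adjoint_pair_id: "adjoint_pair id_blinfun id_blinfun"
  by (simp add: adjoint_pair_def)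

lemma adjoint_pair_add: "adjoint_pair S S' \<Longrightarrow> adjoint_pair T T' \<Longrightarrow> adjoint_pair (S + T) (S' + T')"
  by (simp add: adjoint_pair_def op_simps cinner_simps)

lemma adjoint_pair_diff: "adjoint_pair S S' \<Longrightarrow> adjoint_pair T T' \<Longrightarrow> adjoint_pair (S - T) (S' - T')"
  by (simp add: adjoint_pair_def op_simps cinner_simps)

lemma adjoint_pair_scaleC: "adjoint_pair T T' \<Longrightarrow> adjoint_pair (c *\<^sub>C T) (cnj c *\<^sub>C T')"
  by (simp add: adjoint_pair_def op_simps cinner_simps)

lemma adjoint_pair_scaleR: "adjoint_pair T T' \<Longrightarrow> adjoint_pair (r *\<^sub>R T) (r *\<^sub>R T')"
  by (simp add: adjoint_pair_def op_simps cinner.scaleR_left cinner.scaleR_right)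

lemma adjoint_pair_compose:
  "adjoint_pair S S' \<Longrightarrow> adjoint_pair T T' \<Longrightarrow> adjoint_pair (S o\<^sub>L T) (T' o\<^sub>L S')"
  by (simp add: adjoint_pair_def)

lemma adjoint_pair_sum:
  "(\<And>i. i \<in> I \<Longrightarrow> adjoint_pair (f i) (g i)) \<Longrightarrow> adjoint_pair (\<Sum>i\<in>I. f i) (\<Sum>i\<in>I. g i)"
  by (induction I rule: infinite_finite_induct) (auto intro: adjoint_pair_0 adjoint_pair_add)

lemma adjoint_pair_limit:
  fixes T T' :: "'a::chilbert_space \<Rightarrow>\<^sub>L 'a"
  assumes "\<And>n. adjoint_pair (F n) (F' n)"
    and "\<And>v. (\<lambda>n. F n v) \<longlonglongrightarrow> T v" "\<And>v. (\<lambda>n. F' n v) \<longlonglongrightarrow> T' v"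
  shows "adjoint_pair T T'"
  unfolding adjoint_pair_def
proof (intro allI)
  fix x y
  have "(\<lambda>n. cinner (F n x) y) \<longlonglongrightarrow> cinner (T x) y"
    by (intro cinner.tendsto assms tendsto_const)
  moreover have "(\<lambda>n. cinner x (F' n y)) \<longlonglongrightarrow> cinner x (T' y)"
    by (intro cinner.tendsto assms tendsto_const)
  ultimately show "cinner (T x) y = cinner x (T' y)"
    unfolding adjoint_pairD[OF assms(1)] by (rule LIMSEQ_unique)
qed

text \<open>Testing the pairing at \<open>S y\<close> bounds norm (S y)^2 by norm T * norm (S y) *
  norm y, and one factor cancels. Uniform bounds on a sequence thereby pass to its adjoints.\<close>

lemma norm_adjoint_le:
  assumes "adjoint_pair T S"
  shows "norm S \<le> norm T"
proof (rule norm_blinfun_bound)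
  fix y
  have "(norm (S y))\<^sup>2 = cmod (cinner (T (S y)) y)"
    by (simp add: adjoint_pairD[OF assms] cinner_self del: of_real_power)
  also have "\<dots> \<le> norm (T (S y)) * norm y"
    by (rule cinner_Cauchy_Schwarz)
  also have "\<dots> \<le> norm T * norm (S y) * norm y"
    by (intro mult_right_mono norm_blinfun) simp
  finally have "norm (S y) * norm (S y) \<le> norm (S y) * (norm T * norm y)"
    by (simp add: power2_eq_square mult_ac)
  then show "norm (S y) \<le> norm T * norm y"
    by (cases "norm (S y) = 0") (simp_all add: mult_le_cancel_left)
qed simp

section \<open>Powers, inverses and unitary operators\<close>

lemma op_pow_commute: "op_pow T n o\<^sub>L T = T o\<^sub>L op_pow T n"
  by (induction n) (simp_all add: compose_assoc)

lemma op_pow_add: "op_pow T (m + n) = op_pow T m o\<^sub>L op_pow T n"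
  by (induction m) (simp_all add: compose_assoc)

lemma norm_op_pow_le: "norm T \<le> K \<Longrightarrow> norm (op_pow T n) \<le> K ^ n"
  by (induction n) (auto intro: norm_compose_le norm_blinfun_id_le)

lemma adjoint_pair_pow: "adjoint_pair T T' \<Longrightarrow> adjoint_pair (op_pow T n) (op_pow T' n)"
proof (induction n)
  case (Suc n)
  then show ?case
    using adjoint_pair_compose[of T T' "op_pow T n" "op_pow T' n"]
    by (simp add: op_pow_commute)
qed (simp add: adjoint_pair_id)

lemma op_pow_scaleC: "clinear_op T \<Longrightarrow> op_pow (c *\<^sub>C T) n = c ^ n *\<^sub>C op_pow T n"
  by (induction n)
    (auto intro!: blinfun_eqI simp: clinear_op_def scaleC_scaleC scaleC_compose_left)

lemma op_inverse_eqI: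
  assumes "S o\<^sub>L T = id_blinfun" "T o\<^sub>L S = id_blinfun"
  shows "op_inverse T = S"
  unfolding op_inverse_def
proof (rule the_equality)
  fix S' assume "S' o\<^sub>L T = id_blinfun \<and> T o\<^sub>L S' = id_blinfun"
  then have "(S' o\<^sub>L T) o\<^sub>L S = S"
    by simp
  then show "S' = S"
    unfolding compose_assoc assms by simp
qed (simp add: assms)

text \<open>The lower bound with constant 1 gives injectivity and bounds the inverse by 1 at the
  same time. It holds for unitary operators and for i + K with K self-adjoint.\<close>

lemma op_inverse_exists:
  fixes T :: "'a::chilbert_space \<Rightarrow>\<^sub>L 'a"
  assumes "surj (blinfun_apply T)" and "\<And>x. norm x \<le> norm (blinfun_apply T x)"
  shows "op_inverse T o\<^sub>L T = id_blinfun" "T o\<^sub>L op_inverse T = id_blinfun"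
    "norm (op_inverse T) \<le> 1"
proof -
  have inj: "inj (blinfun_apply T)"
  proof (rule injI)
    fix x y assume "T x = T y"
    then show "x = y"
      using assms(2)[of "x - y"] by (simp add: op_simps)
  qed
  have *: "T (inv (blinfun_apply T) y) = y" for y
    by (rule surj_f_inv_f[OF assms(1)])
  have bl: "bounded_linear (inv (blinfun_apply T))"
  proof (rule bounded_linear_intro[where K = 1])
    fix x y :: 'a and r :: real
    show "inv (blinfun_apply T) (x + y) = inv (blinfun_apply T) x + inv (blinfun_apply T) y"
      by (rule injD[OF inj]) (simp add: op_simps *)
    show "inv (blinfun_apply T) (r *\<^sub>R x) = r *\<^sub>R inv (blinfun_apply T) x"
      by (rule injD[OF inj]) (simp add: op_simps *)
    show "norm (inv (blinfun_apply T) x) \<le> norm x * 1"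
      using assms(2)[of "inv (blinfun_apply T) x"] by (simp add: *)
  qed
  define S where "S = Blinfun (inv (blinfun_apply T))"
  have S: "S y = inv (blinfun_apply T) y" for y
    by (simp add: S_def bounded_linear_Blinfun_apply[OF bl])
  have 1: "S o\<^sub>L T = id_blinfun" "T o\<^sub>L S = id_blinfun"
    by (auto intro!: blinfun_eqI simp: S * inv_f_f[OF inj])
  then have "op_inverse T = S"
    by (rule op_inverse_eqI)
  moreover have "norm S \<le> 1"
    using assms(2)[of "S _"] by (intro norm_blinfun_bound) (auto simp: S *)
  ultimately show "op_inverse T o\<^sub>L T = id_blinfun" "T o\<^sub>L op_inverse T = id_blinfun"
    "norm (op_inverse T) \<le> 1"
    using 1 by simp_all
qed

lemma unitary_op_norm:
  assumes "unitary_op V"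
  shows "norm (V x) = norm x"
proof -
  have "cinner (V x) (V x) = cinner x x"
    using assms by (simp add: unitary_op_def)
  then have "(norm (V x))\<^sup>2 = (norm x)\<^sup>2"
    unfolding cinner_self of_real_eq_iff .
  then show ?thesis
    by simp
qed

lemma unitary_op_inverse:
  assumes "unitary_op V"
  shows "op_inverse V o\<^sub>L V = id_blinfun" "V o\<^sub>L op_inverse V = id_blinfun"
    "norm (op_inverse V) \<le> 1"
  using assms op_inverse_exists[of V] by (auto simp: unitary_op_def unitary_op_norm[OF assms])

lemma unitary_op_inverse_apply:
  assumes "unitary_op V"
  shows "op_inverse V (V x) = x" "V (op_inverse V x) = x"
  using unitary_op_inverse(1,2)[OF assms, THEN arg_cong[of _ _ "\<lambda>T. blinfun_apply T x"]] by simp_all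

lemma unitary_op_adjoint:
  assumes "unitary_op V"
  shows "adjoint_pair V (op_inverse V)"
  unfolding adjoint_pair_def
proof (intro allI)
  fix x y
  have "cinner (V x) (V (op_inverse V y)) = cinner x (op_inverse V y)"
    using assms by (simp add: unitary_op_def)
  then show "cinner (V x) y = cinner x (op_inverse V y)"
    by (simp add: unitary_op_inverse_apply[OF assms])
qed

lemma norm_unitary_le: "unitary_op V \<Longrightarrow> norm V \<le> 1"
  by (rule norm_blinfun_bound) (simp_all add: unitary_op_norm)

lemma unitary_opI:
  assumes "adjoint_pair V W" "V o\<^sub>L W = id_blinfun" "W o\<^sub>L V = id_blinfun"
  shows "unitary_op V" "op_inverse V = W"
proof -
  show "op_inverse V = W"
    by (rule op_inverse_eqI) (fact assms)+
  have VW: "V (W x) = x" "W (V x) = x" for x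
    using assms(2,3)[THEN arg_cong[of _ _ "\<lambda>T. blinfun_apply T x"]] by simp_all
  then have "surj (blinfun_apply V)"
    by (intro surjI[of _ "blinfun_apply W"])
  moreover have "cinner (V x) (V y) = cinner x y" for x y
    by (simp add: adjoint_pairD[OF assms(1)] VW)
  ultimately show "unitary_op V"
    using adjoint_pair_clinear[OF assms(1)] by (simp add: unitary_op_def)
qed

section \<open>Orthonormal systems and Gram-Schmidt projections\<close>

text \<open>Indexed, so that two orthonormal systems can be matched vector by vector, as
  \<open>nuclear_op\<close> requires; distinct indices automatically carry distinct vectors.\<close>

definition orthonormal_family :: "('i \<Rightarrow> 'a::chilbert_space) \<Rightarrow> 'i set \<Rightarrow> bool"
  where "orthonormal_family f I \<longleftrightarrow>
    (\<forall>i\<in>I. \<forall>j\<in>I. cinner (f i) (f j) = (if i = j then 1 else 0))"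

lemma orthonormal_familyD:
  "orthonormal_family f I \<Longrightarrow> i \<in> I \<Longrightarrow> j \<in> I \<Longrightarrow> cinner (f i) (f j) = (if i = j then 1 else 0)"
  by (simp add: orthonormal_family_def)

lemma orthonormal_family_subset: "orthonormal_family f J \<Longrightarrow> I \<subseteq> J \<Longrightarrow> orthonormal_family f I"
  unfolding orthonormal_family_def by blast

lemma orthonormal_basis_iff:
  "orthonormal_basis B \<longleftrightarrow> orthonormal_family (\<lambda>b. b) B \<and> (\<forall>x. (\<forall>b\<in>B. cinner x b = 0) \<longrightarrow> x = 0)"
  by (simp add: orthonormal_basis_def orthonormal_family_def)

lemma orthonormal_basis_family: "orthonormal_basis B \<Longrightarrow> orthonormal_family (\<lambda>b. b) B"
  by (simp add: orthonormal_basis_iff)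

lemma cinner_orthonormal_sum:
  assumes "orthonormal_family f J" "I \<subseteq> J" "finite I" "j \<in> J"
  shows "cinner (\<Sum>i\<in>I. c i *\<^sub>C f i) (f j) = (if j \<in> I then c j else 0)"
proof -
  have "cinner (\<Sum>i\<in>I. c i *\<^sub>C f i) (f j) = (\<Sum>i\<in>I. c i * cinner (f i) (f j))"
    by (simp add: cinner.sum_left cinner_scaleC_left)
  also have "\<dots> = (\<Sum>i\<in>I. if i = j then c i else 0)"
    using assms by (intro sum.cong) (auto simp: orthonormal_family_def subset_iff)
  finally show ?thesis
    using assms(3) by simp
qed

lemma norm_orthonormal_sum:
  assumes "orthonormal_family f I" "finite I"
  shows "(norm (\<Sum>i\<in>I. c i *\<^sub>C f i))\<^sup>2 = (\<Sum>i\<in>I. (cmod (c i))\<^sup>2)"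
proof -
  let ?s = "\<Sum>i\<in>I. c i *\<^sub>C f i"
  have "cinner y ?s = (\<Sum>i\<in>I. cnj (c i) * cinner y (f i))" for y
    by (simp add: cinner.sum_right cinner_scaleC_right)
  from this[of ?s] have "complex_of_real ((norm ?s)\<^sup>2) = (\<Sum>i\<in>I. cnj (c i) * cinner ?s (f i))"
    by (simp only: cinner_self)
  also have "\<dots> = (\<Sum>i\<in>I. complex_of_real ((cmod (c i))\<^sup>2))"
    by (intro sum.cong) (simp_all add: cinner_orthonormal_sum[OF assms(1) subset_refl assms(2)]
          complex_norm_square mult.commute del: of_real_power)
  finally show ?thesis
    by (metis of_real_eq_iff of_real_sum)
qed

lemma Bessel_equality:
  assumes "orthonormal_family f I" "finite I"
  shows "(norm (x - (\<Sum>i\<in>I. cinner x (f i) *\<^sub>C f i)))\<^sup>2 = (norm x)\<^sup>2 - (\<Sum>i\<in>I. (cmod (cinner x (f i)))\<^sup>2)"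
proof -
  let ?s = "\<Sum>i\<in>I. cinner x (f i) *\<^sub>C f i"
  have "cinner (x - ?s) (f i) = 0" if "i \<in> I" for i
    using that by (simp add: cinner.diff_left cinner_orthonormal_sum[OF assms(1) subset_refl assms(2)])
  then have "cinner (x - ?s) ?s = 0"
    by (subst cinner.sum_right) (simp add: cinner_scaleC_right)
  from Pythagoras[OF this] show ?thesis
    by (simp add: norm_orthonormal_sum[OF assms])
qed

lemma Bessel_inequality:
  assumes "orthonormal_family f I" "finite I"
  shows "(\<Sum>i\<in>I. (cmod (cinner x (f i)))\<^sup>2) \<le> (norm x)\<^sup>2"
  using Bessel_equality[OF assms, of x] by (smt (verit) zero_le_power2)

lemma Bessel_summable:
  assumes "orthonormal_family f I"
  shows "(\<lambda>i. (cmod (cinner x (f i)))\<^sup>2) summable_on I"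
  using assms by (intro nonneg_bdd_above_summable_on bdd_aboveI2[where M = "(norm x)\<^sup>2"] Bessel_inequality)
    (auto intro: orthonormal_family_subset)

text \<open>Maximality has to yield density. Partial sums along an increasing chain of finite sets,
  whose masses approach the total Bessel mass, form a Cauchy sequence; the difference between
  \<open>x\<close> and their limit is orthogonal to \<open>B\<close> and so vanishes.\<close>

lemma orthonormal_basis_approx:
  fixes x :: "'a::chilbert_space"
  assumes B: "orthonormal_basis B" and "\<epsilon> > 0"
  obtains F where "finite F" "F \<subseteq> B" "norm (x - (\<Sum>b\<in>F. cinner x b *\<^sub>C b)) < \<epsilon>"
proof -
  note onf = orthonormal_basis_family[OF B]
  define g where "g b = (cmod (cinner x b))\<^sup>2" for b
  have g: "g summable_on B"
    unfolding g_def by (rule Bessel_summable[OF onf])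
  define d where "d = infsum g B"
  have "\<exists>F. finite F \<and> F \<subseteq> B \<and> dist (sum g F) d \<le> 1 / real (Suc n)" for n
    unfolding d_def by (rule infsum_finite_approximation[OF g]) simp
  then obtain F where F: "\<And>n. finite (F n)" "\<And>n. F n \<subseteq> B" "\<And>n. dist (sum g (F n)) d \<le> 1 / real (Suc n)"
    by metis
  \<comment> \<open>The sets \<open>F n\<close> need not be nested; their unions are, and by
    nonnegativity they approximate the total mass at least as well.\<close>
  define G where "G n = (\<Union>k\<le>n. F k)" for n
  have G: "finite (G n)" "G n \<subseteq> B" for n
    using F by (auto simp: G_def)
  have G_mono: "G m \<subseteq> G n" if "m \<le> n" for m n
    using that by (force simp: G_def)
  have le_d: "sum g H \<le> d" if "finite H" "H \<subseteq> B" for H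
    unfolding d_def by (rule finite_sum_le_infsum[OF g that]) (simp add: g_def)
  have G_ge: "d - 1 / real (Suc n) \<le> sum g (G n)" for n
  proof -
    have "sum g (F n) \<le> sum g (G n)"
      by (rule sum_mono2[OF G(1)]) (auto simp: G_def g_def)
    then show ?thesis
      using F(3)[of n] by (simp add: dist_real_def)
  qed
  define s where "s n = (\<Sum>b\<in>G n. cinner x b *\<^sub>C b)" for n
  have s_diff: "(norm (s m - s n))\<^sup>2 \<le> 1 / real (Suc n)" if "n \<le> m" for m n
  proof -
    have "s m - s n = (\<Sum>b\<in>G m - G n. cinner x b *\<^sub>C b)"
      unfolding s_def by (rule sum_diff[symmetric]) (use G G_mono[OF that] in auto)
    then have "(norm (s m - s n))\<^sup>2 = sum g (G m - G n)"
      unfolding g_def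
      using norm_orthonormal_sum[OF orthonormal_family_subset[OF onf], of "G m - G n" "cinner x"] G
      by auto
    also have "\<dots> = sum g (G m) - sum g (G n)"
      by (rule sum_diff) (use G G_mono[OF that] in auto)
    finally show ?thesis
      using le_d[OF G, of m] G_ge[of n] by simp
  qed
  have "Cauchy s"
  proof (rule CauchyI')
    fix e :: real assume "e > 0"
    then have "e\<^sup>2 > 0" by simp
    from reals_Archimedean[OF this] obtain N where N: "1 / real (Suc N) < e\<^sup>2"
      by (auto simp: inverse_eq_divide)
    have "dist (s m) (s n) < e" if "m \<ge> N" "n > m" for m n
    proof -
      have "1 / real (Suc m) \<le> 1 / real (Suc N)"
        using that by (intro divide_left_mono) auto
      then have "(norm (s n - s m))\<^sup>2 < e\<^sup>2"
        using s_diff[of m n] that N by linarith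
      then show ?thesis
        using \<open>e > 0\<close> by (metis dist_norm norm_minus_commute order_less_imp_le power2_less_imp_less)
    qed
    then show "\<exists>M. \<forall>m\<ge>M. \<forall>n>m. dist (s m) (s n) < e"
      by blast
  qed
  then obtain y where y: "s \<longlonglongrightarrow> y"
    using Cauchy_convergent_iff convergent_def by blast
  have "cinner (x - y) b = 0" if "b \<in> B" for b
  proof -
    have "(cmod (cinner (x - s n) b))\<^sup>2 \<le> 1 / real (Suc n)" for n
    proof (cases "b \<in> G n")
      case True
      then show ?thesis
        using that cinner_orthonormal_sum[OF onf G(2) G(1) that, where c = "cinner x"]
        by (simp add: s_def cinner.diff_left)
    next
      case False
      \<comment> \<open>Adjoining \<open>b\<close> to \<open>G n\<close> cannot exceed the total
        mass \<open>d\<close>, so the coefficient at \<open>b\<close> is bounded by the mass still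
        missing.\<close>
      then have "sum g (G n) + g b \<le> d"
        using le_d[of "insert b (G n)"] G that by simp
      then have "g b \<le> 1 / real (Suc n)"
        using G_ge[of n] by linarith
      then show ?thesis
        using False cinner_orthonormal_sum[OF onf G(2) G(1) that, where c = "cinner x"]
        by (simp add: s_def cinner.diff_left g_def)
    qed
    moreover have "(\<lambda>n. (cmod (cinner (x - s n) b))\<^sup>2) \<longlonglongrightarrow> (cmod (cinner (x - y) b))\<^sup>2"
      by (intro tendsto_intros cinner.tendsto y)
    moreover have "(\<lambda>n. 1 / real (Suc n)) \<longlonglongrightarrow> 0"
      using LIMSEQ_inverse_real_of_nat by (simp add: inverse_eq_divide)
    ultimately have "(cmod (cinner (x - y) b))\<^sup>2 \<le> 0"
      by (intro LIMSEQ_le) auto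
    then show ?thesis
      by simp
  qed
  then have "x = y"
    using B unfolding orthonormal_basis_def by (metis eq_iff_diff_eq_0)
  then have "(\<lambda>n. norm (x - s n)) \<longlonglongrightarrow> norm (x - x)"
    using y by (intro tendsto_intros) auto
  then have "\<forall>\<^sub>F n in sequentially. norm (x - s n) < \<epsilon>"
    using assms(2) by (intro order_tendstoD) auto
  then obtain n where "norm (x - s n) < \<epsilon>"
    by (auto simp: eventually_sequentially)
  then show ?thesis
    using G by (intro that[of "G n"]) (auto simp: s_def)
qed

lemma Parseval:
  assumes B: "orthonormal_basis B"
  shows "((\<lambda>b. (cmod (cinner x b))\<^sup>2) has_sum (norm x)\<^sup>2) B"
proof -
  let ?g = "\<lambda>b. (cmod (cinner x b))\<^sup>2"
  note onf = orthonormal_basis_family[OF B]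
  have g: "?g summable_on B"
    by (rule Bessel_summable[OF onf])
  have "infsum ?g B \<le> (norm x)\<^sup>2"
    by (rule infsum_le_finite_sums[OF g]) (auto intro: Bessel_inequality orthonormal_family_subset[OF onf])
  moreover have "(norm x)\<^sup>2 \<le> infsum ?g B"
  proof (rule field_le_epsilon)
    fix e :: real assume "e > 0"
    then obtain F where F: "finite F" "F \<subseteq> B" "norm (x - (\<Sum>b\<in>F. cinner x b *\<^sub>C b)) < sqrt e"
      using orthonormal_basis_approx[OF B, of "sqrt e" x] by auto
    have "(norm (x - (\<Sum>b\<in>F. cinner x b *\<^sub>C b)))\<^sup>2 < (sqrt e)\<^sup>2"
      using F by (intro power_strict_mono) auto
    moreover have "sum ?g F \<le> infsum ?g B"
      by (rule finite_sum_le_infsum[OF g F(1,2)]) simp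
    ultimately show "(norm x)\<^sup>2 \<le> infsum ?g B + e"
      using Bessel_equality[OF orthonormal_family_subset[OF onf F(2)] F(1), of x] \<open>e > 0\<close> by simp
  qed
  ultimately show ?thesis
    using g by (simp add: has_sum_iff)
qed

text \<open>Zorn's lemma: a nonzero vector orthogonal to a maximal orthonormal set could be
  normalised and added. The empty \<open>E\<close> yields \<open>trace_basis\<close>, a prescribed
  \<open>E\<close> a basis adapted to the modulus of an operator.\<close>

lemma orthonormal_basis_extend:
  fixes E :: "'a::chilbert_space set"
  assumes "orthonormal_family (\<lambda>b. b) E"
  obtains B where "orthonormal_basis B" "E \<subseteq> B"
proof -
  let ?A = "{B. E \<subseteq> B \<and> orthonormal_family (\<lambda>b. b) B}"
  have "\<exists>M\<in>?A. \<forall>X\<in>?A. M \<subseteq> X \<longrightarrow> X = M"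
  proof (rule subset_Zorn_nonempty)
    show "?A \<noteq> {}"
      using assms by auto
    fix C assume C: "C \<noteq> {}" "subset.chain ?A C"
    have "orthonormal_family (\<lambda>b. b) (\<Union>C)"
      unfolding orthonormal_family_def
    proof (intro ballI)
      fix b b' assume "b \<in> \<Union>C" "b' \<in> \<Union>C"
      then obtain X Y where XY: "X \<in> C" "b \<in> X" "Y \<in> C" "b' \<in> Y"
        by blast
      then have "X \<subseteq> Y \<or> Y \<subseteq> X"
        using C(2) unfolding subset.chain_def by blast
      then obtain Z where "Z \<in> C" "b \<in> Z" "b' \<in> Z"
        using XY by blast
      moreover have "orthonormal_family (\<lambda>b. b) Z"
        using \<open>Z \<in> C\<close> C by (auto simp: subset.chain_def)
      ultimately show "cinner b b' = (if b = b' then 1 else 0)"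
        by (simp add: orthonormal_family_def)
    qed
    moreover have "E \<subseteq> \<Union>C"
      using C unfolding subset.chain_def by blast
    ultimately show "\<Union>C \<in> ?A"
      by simp
  qed
  then obtain M where M: "E \<subseteq> M" "orthonormal_family (\<lambda>b. b) M"
    and max: "\<And>X. E \<subseteq> X \<Longrightarrow> orthonormal_family (\<lambda>b. b) X \<Longrightarrow> M \<subseteq> X \<Longrightarrow> X = M"
    by auto
  have "x = 0" if x: "\<forall>b\<in>M. cinner x b = 0" for x
  proof (rule ccontr)
    assume "x \<noteq> 0"
    have 1: "cinner (sgn x) b = 0" "cinner b (sgn x) = 0" if "b \<in> M" for b
      using x that cinner_commute[of b x]
      by (simp_all add: sgn_div_norm cinner.scaleR_left cinner.scaleR_right)
    have 2: "cinner (sgn x) (sgn x) = 1"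
      using \<open>x \<noteq> 0\<close> by (simp add: cinner_self norm_sgn)
    have "orthonormal_family (\<lambda>b. b) (insert (sgn x) M)"
      using M(2) 1 2 unfolding orthonormal_family_def by fastforce
    then have "sgn x \<in> M"
      using max[of "insert (sgn x) M"] M(1) by blast
    then show False
      using 1 2 by fastforce
  qed
  then show ?thesis
    using M that by (auto simp: orthonormal_basis_iff)
qed

section \<open>Orthogonal projections and rank-one extensions\<close>

lemma orth_projection_iff: "orth_projection P \<longleftrightarrow> adjoint_pair P P \<and> P o\<^sub>L P = P"
  by (simp add: orth_projection_def self_adjoint_iff)

lemma orth_projection_idem: "orth_projection P \<Longrightarrow> P (P x) = P x"
  unfolding orth_projection_iff by (metis blinfun_apply_blinfun_compose)

lemma orth_projection_complement: "orth_projection P \<Longrightarrow> orth_projection (id_blinfun - P)"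
  by (auto simp: orth_projection_iff compose.diff_left compose.diff_right
      intro: adjoint_pair_diff adjoint_pair_id)

lemma orth_projection_norm_apply:
  assumes "orth_projection P"
  shows "norm (P x) \<le> norm x"
proof -
  have "cinner (P x) (P x) = cinner (P x) x"
    using assms unfolding orth_projection_iff by (metis adjoint_pairD orth_projection_idem[OF assms])
  then have "(norm (P x))\<^sup>2 = cmod (cinner (P x) x)"
    by (metis cinner_self norm_of_real abs_of_nonneg zero_le_power2)
  also have "\<dots> \<le> norm (P x) * norm x"
    by (rule cinner_Cauchy_Schwarz)
  finally have "norm (P x) * norm (P x) \<le> norm (P x) * norm x"
    by (simp add: power2_eq_square)
  then show ?thesis
    by (cases "norm (P x) = 0") (simp_all add: mult_le_cancel_left)
qed

lemma orth_projection_norm: "orth_projection P \<Longrightarrow> norm P \<le> 1"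
  by (rule norm_blinfun_bound) (simp_all add: orth_projection_norm_apply)

lift_definition line_projection :: "'a::chilbert_space \<Rightarrow> 'a \<Rightarrow>\<^sub>L 'a"
  is "\<lambda>e v. cinner v e *\<^sub>C e"
  by (rule bounded_linear_compose[OF scaleC.bounded_linear_left cinner.bounded_linear_left])

text \<open>\<open>P e = 0\<close> removes both cross terms of the square. The case
  \<open>e = 0\<close> covers a Gram-Schmidt step whose vector brings nothing new.\<close>

lemma orth_projection_add_line:
  assumes P: "orth_projection P" and "P e = 0" and "norm e = 1 \<or> e = 0"
  shows "orth_projection (P + line_projection e)"
proof -
  have "adjoint_pair (line_projection e) (line_projection e)"
    unfolding adjoint_pair_def line_projection.rep_eq
    by (metis cinner_commute cinner_scaleC_left cinner_scaleC_right mult.commute)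
  moreover have "cinner (P v) e = 0" for v
    using P assms(2) adjoint_pairD[of P P v e] by (simp add: orth_projection_iff)
  moreover have "clinear_op P"
    using P unfolding orth_projection_iff by (auto intro: adjoint_pair_clinear)
  moreover have "cinner e e *\<^sub>C e = e"
    using assms(3) by (auto simp: cinner_self)
  ultimately show ?thesis
    using P assms(2)
    by (auto intro!: blinfun_eqI adjoint_pair_add simp: orth_projection_iff line_projection.rep_eq
        op_simps orth_projection_idem[OF P] cinner_simps clinear_opD
        simp flip: scaleC_scaleC)
qed

lemma finite_rank_add_line:
  assumes "finite_rank_op P"
  shows "finite_rank_op (P + line_projection e)"
proof -
  obtain S where S: "finite S" "range (blinfun_apply P) \<subseteq> {(\<Sum>v\<in>S. c v *\<^sub>C v) |c. True}"
    using assms by (auto simp: finite_rank_op_def)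
  have "(P + line_projection e) x \<in> {(\<Sum>v\<in>insert e S. c v *\<^sub>C v) |c. True}" for x
  proof -
    obtain c where c: "P x = (\<Sum>v\<in>S. c v *\<^sub>C v)"
      using S(2) by blast
    \<comment> \<open>\<open>e\<close> may already belong to \<open>S\<close>, so its coefficient is
      added to the old one instead of replacing it.\<close>
    define c' where "c' v = (if v \<in> S then c v else 0) + (if v = e then cinner x e else 0)" for v
    have "(\<Sum>v\<in>insert e S. c' v *\<^sub>C v) =
        (\<Sum>v\<in>insert e S. (if v \<in> S then c v else 0) *\<^sub>C v)
        + (\<Sum>v\<in>insert e S. (if v = e then cinner x e else 0) *\<^sub>C v)"
      by (simp add: c'_def scaleC.add_left sum.distrib del: sum.insert_if)
    also have "(\<Sum>v\<in>insert e S. (if v \<in> S then c v else 0) *\<^sub>C v) = (\<Sum>v\<in>S. c v *\<^sub>C v)"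
      using S(1) by (intro sum.mono_neutral_cong_right) auto
    also have "(\<Sum>v\<in>insert e S. (if v = e then cinner x e else 0) *\<^sub>C v)
        = (\<Sum>v\<in>{e}. cinner x e *\<^sub>C v)"
      using S(1) by (intro sum.mono_neutral_cong_right) auto
    finally have "(P + line_projection e) x = (\<Sum>v\<in>insert e S. c' v *\<^sub>C v)"
      by (simp add: c op_simps line_projection.rep_eq)
    then show ?thesis
      by blast
  qed
  moreover have "clinear_op (P + line_projection e)"
    using assms by (simp add: finite_rank_op_def clinear_op_def op_simps line_projection.rep_eq
        cinner_scaleC_left scaleC_add_right scaleC_scaleC)
  ultimately show ?thesis
    unfolding finite_rank_op_def using S(1) by (intro conjI exI[of _ "insert e S"]) auto
qed

section \<open>Gram-Schmidt projections as a recursion\<close>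

text \<open>Vectors lying in the span of their predecessors contribute the residual vector \<open>sgn 0 = 0\<close>.\<close>

primrec gs_proj :: "(nat \<Rightarrow> 'a::chilbert_space) \<Rightarrow> nat \<Rightarrow> 'a \<Rightarrow>\<^sub>L 'a"
  where
    "gs_proj x 0 = 0"
  | "gs_proj x (Suc n) = gs_proj x n + line_projection (sgn (x n - gs_proj x n (x n)))"

definition gs_vec :: "(nat \<Rightarrow> 'a::chilbert_space) \<Rightarrow> nat \<Rightarrow> 'a"
  where "gs_vec x n = sgn (x n - gs_proj x n (x n))"

lemma gs_proj_Suc: "gs_proj x (Suc n) = gs_proj x n + line_projection (gs_vec x n)"
  by (simp add: gs_vec_def)

lemma gs_proj_orth:
  "orth_projection (gs_proj x n)" and gs_proj_gs_vec: "gs_proj x n (gs_vec x n) = 0"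
proof -
  have *: "gs_proj x n (gs_vec x n) = 0" if "orth_projection (gs_proj x n)" for n
    using orth_projection_idem[OF that] by (simp add: gs_vec_def sgn_div_norm op_simps)
  show "orth_projection (gs_proj x n)"
  proof (induction n)
    case 0
    then show ?case
      by (simp add: orth_projection_iff adjoint_pair_0)
  next
    case (Suc n)
    then show ?case
      unfolding gs_proj_Suc by (intro orth_projection_add_line *) (auto simp: gs_vec_def norm_sgn)
  qed
  then show "gs_proj x n (gs_vec x n) = 0"
    by (rule *)
qed

lemma gs_proj_adjoint: "adjoint_pair (gs_proj x n) (gs_proj x n)"
  using gs_proj_orth[of x n] by (simp add: orth_projection_iff)

lemma gs_proj_finite_rank: "finite_rank_op (gs_proj x n)"
proof (induction n)
  case 0
  show ?case
    by (auto simp: finite_rank_op_def clinear_op_def intro!: exI[of _ "{}"])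
next
  case (Suc n)
  then show ?case
    unfolding gs_proj_Suc by (rule finite_rank_add_line)
qed

text \<open>\<open>D\<close> is an arbitrary complex subspace. It will be the domain of H0, so that
  the compression makes sense, and the range of a modulus, so that basis vectors have
  preimages.\<close>

lemma gs_range:
  assumes "\<And>k. x k \<in> D" "0 \<in> D" "\<And>u v. u \<in> D \<Longrightarrow> v \<in> D \<Longrightarrow> u + v \<in> D" "\<And>c u. u \<in> D \<Longrightarrow> c *\<^sub>C u \<in> D"
  shows "gs_proj x n v \<in> D" "gs_vec x n \<in> D"
proof -
  have minus: "u - v \<in> D" if "u \<in> D" "v \<in> D" for u v
    using assms(3)[OF that(1) assms(4)[OF that(2), of "-1"]] by (simp add: scaleC.minus_left)
  have *: "gs_vec x n \<in> D" if "\<And>v. gs_proj x n v \<in> D" for n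
    unfolding gs_vec_def sgn_div_norm scaleR_scaleC by (intro assms minus that)
  show "gs_proj x n v \<in> D" for v
  proof (induction n arbitrary: v)
    case (Suc n)
    then show ?case
      unfolding gs_proj_Suc plus_blinfun.rep_eq line_projection.rep_eq
      by (intro assms *)
  qed (simp add: assms)
  then show "gs_vec x n \<in> D"
    by (rule *)
qed

lemma gs_proj_Suc_orth:
  assumes "gs_proj x n v = v"
  shows "gs_proj x (Suc n) v = v"
proof -
  have "cinner v (gs_vec x n) = 0"
    using adjoint_pairD[OF gs_proj_adjoint, of x n v "gs_vec x n"] assms by (simp add: gs_proj_gs_vec)
  then show ?thesis
    unfolding gs_proj_Suc by (simp add: op_simps line_projection.rep_eq assms)
qed

lemma gs_proj_fix_mono: "gs_proj x m v = v \<Longrightarrow> m \<le> n \<Longrightarrow> gs_proj x n v = v"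
  by (rotate_tac, induction n rule: dec_induct) (auto intro: gs_proj_Suc_orth simp del: gs_proj.simps)

text \<open>The line added at stage \<open>k\<close> carries the residual \<open>r\<close> of
  \<open>x k\<close>, and \<open>x k\<close> and \<open>r\<close> have the same component along it,
  so the new projection restores \<open>x k\<close> in full; later stages keep what is
  fixed.\<close>

lemma gs_proj_fix:
  assumes "k < n"
  shows "gs_proj x n (x k) = x k"
proof (rule gs_proj_fix_mono)
  define r where "r = x k - gs_proj x k (x k)"
  have "cinner (gs_proj x k (x k)) (gs_vec x k) = 0"
    using adjoint_pairD[OF gs_proj_adjoint, of x k "x k" "gs_vec x k"] by (simp add: gs_proj_gs_vec)
  then have "cinner (x k) (gs_vec x k) = cinner r (gs_vec x k)"
    by (simp add: r_def cinner_simps)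
  moreover have "cinner r (sgn r) *\<^sub>C sgn r = r"
    by (cases "r = 0") (simp_all add: sgn_div_norm cinner_scaleC_right cinner_self scaleR_scaleC
        scaleC_scaleC power2_eq_square field_simps)
  ultimately show "gs_proj x (Suc k) (x k) = x k"
    unfolding gs_proj_Suc by (simp add: op_simps line_projection.rep_eq gs_vec_def flip: r_def)
      (simp add: r_def)
qed (use assms in simp)

lemma gs_proj_gs_vec_fix:
  assumes "k < n"
  shows "gs_proj x n (gs_vec x k) = gs_vec x k"
proof (rule gs_proj_fix_mono)
  have "norm (gs_vec x k) = 1 \<or> gs_vec x k = 0"
    by (auto simp: gs_vec_def norm_sgn)
  then show "gs_proj x (Suc k) (gs_vec x k) = gs_vec x k"
    unfolding gs_proj_Suc by (auto simp: op_simps line_projection.rep_eq gs_proj_gs_vec cinner_self)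
qed (use assms in simp)

definition gs_set :: "(nat \<Rightarrow> 'a::chilbert_space) \<Rightarrow> 'a set"
  where "gs_set x = range (gs_vec x) - {0}"

text \<open>For \<open>i < j\<close> the projection of stage \<open>j\<close> fixes the earlier
  vector and kills the later one, so its self-adjointness makes the pairing zero.\<close>

lemma gs_set_orthonormal: "orthonormal_family (\<lambda>b. b) (gs_set x)"
proof -
  have 1: "cinner (gs_vec x i) (gs_vec x j) = 0" if "i < j" for i j
    using adjoint_pairD[OF gs_proj_adjoint, of x j "gs_vec x i" "gs_vec x j"] that
    by (simp add: gs_proj_gs_vec gs_proj_gs_vec_fix)
  have 2: "cinner (gs_vec x i) (gs_vec x j) = 0" if "i \<noteq> j" for i j
  proof (cases "i < j")
    case False
    then have "cinner (gs_vec x j) (gs_vec x i) = 0"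
      using that by (intro 1) auto
    then show ?thesis
      by (metis cinner_commute complex_cnj_zero)
  qed (rule 1)
  have 3: "cinner (gs_vec x i) (gs_vec x i) = 1" if "gs_vec x i \<noteq> 0" for i
    using that by (auto simp: cinner_self gs_vec_def norm_sgn split: if_splits)
  show ?thesis
    unfolding orthonormal_family_def
  proof (intro ballI)
    fix b b' assume b: "b \<in> gs_set x" "b' \<in> gs_set x"
    then obtain i j where ij: "b = gs_vec x i" "b' = gs_vec x j" "b \<noteq> 0"
      by (auto simp: gs_set_def)
    show "cinner b b' = (if b = b' then 1 else 0)"
      using 2[of i j] 3[of i] ij by (cases "i = j") auto
  qed
qed

text \<open>Orthogonality to the Gram-Schmidt vectors makes every projection annihilate
  \<open>v\<close>; it remains to move the projection that fixes \<open>x k\<close> across the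
  pairing.\<close>

lemma gs_set_orthogonal:
  assumes "\<And>e. e \<in> gs_set x \<Longrightarrow> cinner v e = 0"
  shows "cinner v (x k) = 0"
proof -
  have "cinner v (gs_vec x i) = 0" for i
    using assms[of "gs_vec x i"] by (cases "gs_vec x i = 0") (auto simp: gs_set_def)
  then have "gs_proj x n v = 0" for n
    by (induction n) (simp_all add: op_simps line_projection.rep_eq gs_proj_Suc del: gs_proj.simps(2))
  then have "cinner v (gs_proj x (Suc k) (x k)) = 0"
    by (simp add: adjoint_pairD[OF gs_proj_adjoint, symmetric] del: gs_proj.simps(2))
  then show ?thesis
    by (simp only: gs_proj_fix[OF lessI])
qed

lemma gs_proj_tendsto:
  fixes x :: "nat \<Rightarrow> 'a::chilbert_space"
  assumes total: "\<And>v. (\<And>k. cinner v (x k) = 0) \<Longrightarrow> v = 0"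
  shows "(\<lambda>n. gs_proj x n v) \<longlonglongrightarrow> v"
proof (rule metric_LIMSEQ_I)
  fix \<epsilon> :: real assume "\<epsilon> > 0"
  have "orthonormal_basis (gs_set x)"
    unfolding orthonormal_basis_iff using gs_set_orthonormal gs_set_orthogonal total by metis
  then obtain F where F: "finite F" "F \<subseteq> gs_set x" "norm (v - (\<Sum>b\<in>F. cinner v b *\<^sub>C b)) < \<epsilon>"
    using orthonormal_basis_approx \<open>\<epsilon> > 0\<close> by metis
  let ?s = "\<Sum>b\<in>F. cinner v b *\<^sub>C b"
  have "\<forall>b\<in>F. \<exists>i. b = gs_vec x i"
    using F(2) by (auto simp: gs_set_def)
  then obtain ix where ix: "\<And>b. b \<in> F \<Longrightarrow> b = gs_vec x (ix b)"
    by metis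
  obtain N where N: "\<And>b. b \<in> F \<Longrightarrow> ix b < N"
    using F(1) by (metis finite_imageI finite_nat_set_iff_bounded imageI)
  have "dist (gs_proj x n v) v < \<epsilon>" if "n \<ge> N" for n
  proof -
    have "gs_proj x n b = b" if "b \<in> F" for b
      using gs_proj_gs_vec_fix[of "ix b" n x] ix[OF that] N[OF that] \<open>n \<ge> N\<close> by simp
    then have "gs_proj x n ?s = ?s"
      unfolding blinfun.sum_right clinear_opD[OF adjoint_pair_clinear[OF gs_proj_adjoint]]
      by (intro sum.cong) simp_all
    \<comment> \<open>The finite sum is fixed by the projection, so only the remainder
      \<open>v - ?s\<close> is seen, and the complementary projection does not enlarge it.\<close>
    then have "v - gs_proj x n v = (id_blinfun - gs_proj x n) (v - ?s)"
      by (simp add: minus_blinfun.rep_eq blinfun.diff_right)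
    also have "norm \<dots> \<le> norm (v - ?s)"
      by (intro orth_projection_norm_apply orth_projection_complement gs_proj_orth)
    finally show ?thesis
      using F(3) by (simp add: dist_norm norm_minus_commute)
  qed
  then show "\<exists>N. \<forall>n\<ge>N. dist (gs_proj x n v) v < \<epsilon>"
    by blast
qed

section \<open>Trace continuity of Hilbert-Schmidt sandwiches\<close>

text \<open>Bounded convergence in the strong-star topology. The bound \<open>K\<close> makes it
  stable under products; the adjoints are there because a factor to the right of \<open>A\<close> is
  estimated through its adjoint on the left.\<close>

definition strong_star :: "(nat \<Rightarrow> 'a::chilbert_space \<Rightarrow>\<^sub>L 'a) \<Rightarrow> ('a \<Rightarrow>\<^sub>L 'a) \<Rightarrow> bool"
  where "strong_star F X \<longleftrightarrow> (\<exists>F' X' K. (\<forall>n. adjoint_pair (F n) (F' n) \<and> norm (F n) \<le> K) \<and>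
    adjoint_pair X X' \<and> (\<forall>v. (\<lambda>n. F n v) \<longlonglongrightarrow> X v) \<and> (\<forall>v. (\<lambda>n. F' n v) \<longlonglongrightarrow> X' v))"

lemma strong_starI:
  assumes "\<And>n. adjoint_pair (F n) (F' n)" "\<And>n. norm (F n) \<le> K"
    "adjoint_pair X X'" "\<And>v. (\<lambda>n. F n v) \<longlonglongrightarrow> X v" "\<And>v. (\<lambda>n. F' n v) \<longlonglongrightarrow> X' v"
  shows "strong_star F X"
  using assms unfolding strong_star_def by blast

lemma strong_starE:
  assumes "strong_star F X"
  obtains F' X' K where "\<And>n. adjoint_pair (F n) (F' n)" "\<And>n. norm (F n) \<le> K"
    "\<And>n. norm (F' n) \<le> K" "adjoint_pair X X'"
    "\<And>v. (\<lambda>n. F n v) \<longlonglongrightarrow> X v" "\<And>v. (\<lambda>n. F' n v) \<longlonglongrightarrow> X' v"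
proof -
  obtain F' X' K where *: "\<forall>n. adjoint_pair (F n) (F' n) \<and> norm (F n) \<le> K"
    "adjoint_pair X X'" "\<forall>v. (\<lambda>n. F n v) \<longlonglongrightarrow> X v" "\<forall>v. (\<lambda>n. F' n v) \<longlonglongrightarrow> X' v"
    using assms unfolding strong_star_def by (elim exE conjE)
  show ?thesis
  proof (rule that[of F' K X'])
    show "norm (F' n) \<le> K" for n
      using * norm_adjoint_le[of "F n" "F' n"] by (meson order_trans)
  qed (use * in simp_all)
qed

lemma strong_star_adjointE:
  assumes "strong_star F X"
  obtains F' X' where "\<And>n. adjoint_pair (F n) (F' n)" "adjoint_pair X X'" "strong_star F' X'"
proof -
  obtain F' X' K where F: "\<And>n. adjoint_pair (F n) (F' n)" "\<And>n. norm (F n) \<le> K"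
    "\<And>n. norm (F' n) \<le> K" "adjoint_pair X X'"
    "\<And>v. (\<lambda>n. F n v) \<longlonglongrightarrow> X v" "\<And>v. (\<lambda>n. F' n v) \<longlonglongrightarrow> X' v"
    by (rule strong_starE[OF assms]) (rule that)
  then have "strong_star F' X'"
    by (intro strong_starI[where F' = F and X' = X and K = K]) (auto intro: adjoint_pair_sym)
  then show ?thesis
    using F that by blast
qed

text \<open>The common bound \<open>K\<close> forces the image of the error \<open>v n - u\<close>
  to zero; this is how strong limits are multiplied.\<close>

lemma tendsto_blinfun_strong:
  fixes F :: "nat \<Rightarrow> 'a::real_normed_vector \<Rightarrow>\<^sub>L 'b::real_normed_vector"
  assumes "\<And>n. norm (F n) \<le> K" "(\<lambda>n. F n u) \<longlonglongrightarrow> w" "v \<longlonglongrightarrow> u"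
  shows "(\<lambda>n. F n (v n)) \<longlonglongrightarrow> w"
proof -
  have "(\<lambda>n. F n (v n - u)) \<longlonglongrightarrow> 0"
  proof (rule Lim_null_comparison)
    show "\<forall>\<^sub>F n in sequentially. norm (F n (v n - u)) \<le> K * norm (v n - u)"
      by (intro always_eventually allI order_trans[OF norm_blinfun] mult_right_mono assms) simp
    show "(\<lambda>n. K * norm (v n - u)) \<longlonglongrightarrow> 0"
      using assms(3) by (intro tendsto_mult_right_zero tendsto_norm_zero) (simp add: LIM_zero_iff)
  qed
  from tendsto_add[OF this assms(2)] show ?thesis
    by (simp add: op_simps)
qed

lemma strong_star_const: "adjoint_pair X X' \<Longrightarrow> strong_star (\<lambda>_. X) X"
  by (rule strong_starI[of _ "\<lambda>_. X'" "norm X" X X']) auto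

lemma strong_star_compose:
  assumes "strong_star F X" "strong_star G Y"
  shows "strong_star (\<lambda>n. F n o\<^sub>L G n) (X o\<^sub>L Y)"
proof -
  obtain F' X' K where F: "\<And>n. adjoint_pair (F n) (F' n)" "\<And>n. norm (F n) \<le> K"
    "\<And>n. norm (F' n) \<le> K" "adjoint_pair X X'"
    "\<And>v. (\<lambda>n. F n v) \<longlonglongrightarrow> X v" "\<And>v. (\<lambda>n. F' n v) \<longlonglongrightarrow> X' v"
    by (rule strong_starE[OF assms(1)]) (rule that)
  obtain G' Y' L where G: "\<And>n. adjoint_pair (G n) (G' n)" "\<And>n. norm (G n) \<le> L"
    "\<And>n. norm (G' n) \<le> L" "adjoint_pair Y Y'"
    "\<And>v. (\<lambda>n. G n v) \<longlonglongrightarrow> Y v" "\<And>v. (\<lambda>n. G' n v) \<longlonglongrightarrow> Y' v"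
    by (rule strong_starE[OF assms(2)]) (rule that)
  show ?thesis
  proof (rule strong_starI)
    show "adjoint_pair (F n o\<^sub>L G n) (G' n o\<^sub>L F' n)" for n
      by (intro adjoint_pair_compose F G)
    show "norm (F n o\<^sub>L G n) \<le> K * L" for n
      by (intro norm_compose_le F G)
    show "adjoint_pair (X o\<^sub>L Y) (Y' o\<^sub>L X')"
      by (intro adjoint_pair_compose F G)
    show "(\<lambda>n. (F n o\<^sub>L G n) v) \<longlonglongrightarrow> (X o\<^sub>L Y) v" for v
      using tendsto_blinfun_strong[OF F(2) F(5) G(5)] by simp
    show "(\<lambda>n. (G' n o\<^sub>L F' n) v) \<longlonglongrightarrow> (Y' o\<^sub>L X') v" for v
      using tendsto_blinfun_strong[OF G(3) G(6) F(6)] by simp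
  qed
qed

lemma strong_star_add:
  assumes "strong_star F X" "strong_star G Y"
  shows "strong_star (\<lambda>n. F n + G n) (X + Y)"
proof -
  obtain F' X' K where F: "\<And>n. adjoint_pair (F n) (F' n)" "\<And>n. norm (F n) \<le> K"
    "\<And>n. norm (F' n) \<le> K" "adjoint_pair X X'"
    "\<And>v. (\<lambda>n. F n v) \<longlonglongrightarrow> X v" "\<And>v. (\<lambda>n. F' n v) \<longlonglongrightarrow> X' v"
    by (rule strong_starE[OF assms(1)]) (rule that)
  obtain G' Y' L where G: "\<And>n. adjoint_pair (G n) (G' n)" "\<And>n. norm (G n) \<le> L"
    "\<And>n. norm (G' n) \<le> L" "adjoint_pair Y Y'"
    "\<And>v. (\<lambda>n. G n v) \<longlonglongrightarrow> Y v" "\<And>v. (\<lambda>n. G' n v) \<longlonglongrightarrow> Y' v"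
    by (rule strong_starE[OF assms(2)]) (rule that)
  show ?thesis
    by (rule strong_starI[where F' = "\<lambda>n. F' n + G' n" and K = "K + L" and X' = "X' + Y'"])
      (auto intro!: adjoint_pair_add F G tendsto_intros norm_triangle_mono simp: op_simps)
qed

lemma strong_star_scaleC:
  assumes "strong_star F X"
  shows "strong_star (\<lambda>n. c *\<^sub>C F n) (c *\<^sub>C X)"
proof -
  obtain F' X' K where F: "\<And>n. adjoint_pair (F n) (F' n)" "\<And>n. norm (F n) \<le> K"
    "\<And>n. norm (F' n) \<le> K" "adjoint_pair X X'"
    "\<And>v. (\<lambda>n. F n v) \<longlonglongrightarrow> X v" "\<And>v. (\<lambda>n. F' n v) \<longlonglongrightarrow> X' v"
    by (rule strong_starE[OF assms]) (rule that)
  show ?thesis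
    by (rule strong_starI[where F' = "\<lambda>n. cnj c *\<^sub>C F' n" and K = "cmod c * K" and X' = "cnj c *\<^sub>C X'"])
      (auto intro!: adjoint_pair_scaleC F scaleC.tendsto tendsto_const
        order_trans[OF norm_scaleC_blinfun_le] mult_left_mono)
qed

lemma strong_star_id: "strong_star (\<lambda>_. id_blinfun) id_blinfun"
  by (rule strong_star_const[OF adjoint_pair_id])

lemma strong_star_pow: "strong_star F X \<Longrightarrow> strong_star (\<lambda>n. op_pow (F n) k) (op_pow X k)"
  by (induction k) (auto intro: strong_star_id strong_star_compose)

section \<open>Square-summable families and Cauchy-Schwarz estimates\<close>

lemma infsum_pairing:
  fixes p q :: "'i \<Rightarrow> 'a::chilbert_space"
  assumes p: "(\<lambda>i. (norm (p i))\<^sup>2) summable_on I" and q: "(\<lambda>i. (norm (q i))\<^sup>2) summable_on I"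
  shows "(\<lambda>i. cmod (cinner (p i) (q i))) summable_on I"
    and "cmod (\<Sum>\<^sub>\<infinity>i\<in>I. cinner (p i) (q i)) \<le>
      sqrt (\<Sum>\<^sub>\<infinity>i\<in>I. (norm (p i))\<^sup>2) * sqrt (\<Sum>\<^sub>\<infinity>i\<in>I. (norm (q i))\<^sup>2)" (is "_ \<le> ?C")
proof -
  have fin: "(\<Sum>i\<in>F. cmod (cinner (p i) (q i))) \<le> ?C" if "finite F" "F \<subseteq> I" for F
  proof -
    have "(\<Sum>i\<in>F. cmod (cinner (p i) (q i))) \<le> (\<Sum>i\<in>F. \<bar>norm (p i)\<bar> * \<bar>norm (q i)\<bar>)"
      by (intro sum_mono) (simp add: cinner_Cauchy_Schwarz)
    also have "\<dots> \<le> L2_set (\<lambda>i. norm (p i)) F * L2_set (\<lambda>i. norm (q i)) F"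
      by (rule L2_set_mult_ineq)
    also have "\<dots> \<le> ?C"
      unfolding L2_set_def
      by (intro mult_mono real_sqrt_le_mono finite_sum_le_infsum p q that)
        (auto intro!: sum_nonneg infsum_nonneg)
    finally show ?thesis .
  qed
  show abs: "(\<lambda>i. cmod (cinner (p i) (q i))) summable_on I"
    using fin by (intro nonneg_bdd_above_summable_on bdd_aboveI2[where M = ?C]) auto
  have "cmod (\<Sum>\<^sub>\<infinity>i\<in>I. cinner (p i) (q i)) \<le> (\<Sum>\<^sub>\<infinity>i\<in>I. cmod (cinner (p i) (q i)))"
    by (rule norm_infsum_bound[OF abs])
  also have "\<dots> \<le> ?C"
    by (rule infsum_le_finite_sums[OF abs fin])
  finally show "cmod (\<Sum>\<^sub>\<infinity>i\<in>I. cinner (p i) (q i)) \<le> ?C" .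
qed

lemma summable_on_blinfun_square:
  fixes D :: "'a::real_normed_vector \<Rightarrow>\<^sub>L 'b::real_normed_vector"
  assumes v: "(\<lambda>i. (norm (v i))\<^sup>2) summable_on I" and K: "norm D \<le> K"
  shows "(\<lambda>i. (norm (D (v i)))\<^sup>2) summable_on I"
    "(\<Sum>\<^sub>\<infinity>i\<in>I. (norm (D (v i)))\<^sup>2) \<le> K\<^sup>2 * (\<Sum>\<^sub>\<infinity>i\<in>I. (norm (v i))\<^sup>2)"
proof -
  have le: "(norm (D (v i)))\<^sup>2 \<le> K\<^sup>2 * (norm (v i))\<^sup>2" for i
    unfolding power_mult_distrib[symmetric]
    by (intro power_mono order_trans[OF norm_blinfun] mult_right_mono K) simp_all
  have s: "(\<lambda>i. K\<^sup>2 * (norm (v i))\<^sup>2) summable_on I"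
    by (intro summable_on_cmult_right v)
  show 1: "(\<lambda>i. (norm (D (v i)))\<^sup>2) summable_on I"
    by (rule summable_on_comparison_test[OF s le]) simp
  show "(\<Sum>\<^sub>\<infinity>i\<in>I. (norm (D (v i)))\<^sup>2) \<le> K\<^sup>2 * (\<Sum>\<^sub>\<infinity>i\<in>I. (norm (v i))\<^sup>2)"
    using infsum_mono[OF 1 s le] by (simp add: infsum_cmult_right')
qed

text \<open>Strong convergence becomes Hilbert-Schmidt convergence on a fixed square-summable
  family: finitely many indices are handled pointwise, and the tail is at most K^2 times the tail of
  the family, uniformly in \<open>n\<close>.\<close>

lemma infsum_square_strong_null:
  fixes D :: "nat \<Rightarrow> 'a::real_normed_vector \<Rightarrow>\<^sub>L 'b::real_normed_vector"
  assumes v: "(\<lambda>i. (norm (v i))\<^sup>2) summable_on I" and K: "\<And>n. norm (D n) \<le> K"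
    and D: "\<And>u. (\<lambda>n. D n u) \<longlonglongrightarrow> 0"
  shows "(\<lambda>n. \<Sum>\<^sub>\<infinity>i\<in>I. (norm (D n (v i)))\<^sup>2) \<longlonglongrightarrow> 0"
proof (rule order_tendstoI)
  fix \<epsilon> :: real assume "\<epsilon> < 0"
  then have "\<epsilon> < (\<Sum>\<^sub>\<infinity>i\<in>I. (norm (D n (v i)))\<^sup>2)" for n
    by (rule less_le_trans) (simp add: infsum_nonneg)
  then show "\<forall>\<^sub>F n in sequentially. \<epsilon> < (\<Sum>\<^sub>\<infinity>i\<in>I. (norm (D n (v i)))\<^sup>2)"
    by simp
next
  fix \<epsilon> :: real assume "\<epsilon> > 0"
  let ?w = "\<lambda>i. (norm (v i))\<^sup>2"
  \<comment> \<open>The \<open>+ 1\<close> keeps the denominator positive when \<open>K = 0\<close>;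
    the choice leaves half of the tolerance to the tail.\<close>
  define \<delta> where "\<delta> = \<epsilon> / (2 * (K\<^sup>2 + 1))"
  have pos: "K\<^sup>2 + 1 > 0"
    by (simp add: add_nonneg_pos)
  have "\<delta> > 0"
    unfolding \<delta>_def using \<open>\<epsilon> > 0\<close> pos by simp
  have "K\<^sup>2 * \<delta> \<le> \<epsilon> / 2"
    using pos \<open>\<epsilon> > 0\<close> by (simp add: \<delta>_def field_simps)
  obtain F where F: "finite F" "F \<subseteq> I" "dist (sum ?w F) (infsum ?w I) \<le> \<delta>"
    using infsum_finite_approximation[OF v \<open>\<delta> > 0\<close>] by blast
  have split: "infsum f I = sum f F + infsum f (I - F)" if "f summable_on I" for f :: "_ \<Rightarrow> real"
  proof -
    have "infsum f (F \<union> (I - F)) = infsum f F + infsum f (I - F)"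
      using F that by (intro infsum_Un_disjoint) (auto intro: summable_on_subset_banach)
    moreover have "F \<union> (I - F) = I"
      using F by blast
    ultimately show ?thesis
      using F by simp
  qed
  have tail: "infsum ?w (I - F) \<le> \<delta>"
    using split[OF v] F(3) by (simp add: dist_real_def)
  have "(\<lambda>n. \<Sum>i\<in>F. (norm (D n (v i)))\<^sup>2) \<longlonglongrightarrow> (\<Sum>i\<in>F. (norm (0::'b))\<^sup>2)"
    by (intro tendsto_intros D)
  then have "\<forall>\<^sub>F n in sequentially. (\<Sum>i\<in>F. (norm (D n (v i)))\<^sup>2) < \<epsilon> / 2"
    using \<open>\<epsilon> > 0\<close> by (intro order_tendstoD) auto
  then show "\<forall>\<^sub>F n in sequentially. (\<Sum>\<^sub>\<infinity>i\<in>I. (norm (D n (v i)))\<^sup>2) < \<epsilon>"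
  proof eventually_elim
    case (elim n)
    have vF: "?w summable_on (I - F)"
      using v by (rule summable_on_subset_banach) auto
    have "(\<Sum>\<^sub>\<infinity>i\<in>I - F. (norm (D n (v i)))\<^sup>2) \<le> K\<^sup>2 * infsum ?w (I - F)"
      by (rule summable_on_blinfun_square[OF vF K])
    also have "\<dots> \<le> K\<^sup>2 * \<delta>"
      by (intro mult_left_mono tail) simp
    finally show ?case
      using split[OF summable_on_blinfun_square(1)[OF v K]] elim \<open>K\<^sup>2 * \<delta> \<le> \<epsilon> / 2\<close> by simp
  qed
qed

lemma has_sum_finite_sum:
  fixes g :: "'i \<Rightarrow> 'b \<Rightarrow> 'c::topological_comm_monoid_add"
  assumes "finite F" "\<And>i. i \<in> F \<Longrightarrow> (g i has_sum s i) B"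
  shows "((\<lambda>b. \<Sum>i\<in>F. g i b) has_sum (\<Sum>i\<in>F. s i)) B"
  using assms by (induction F rule: finite_induct) (auto intro: has_sum_add)

section \<open>Nuclear operators, the trace, and sandwiches with a Hilbert-Schmidt operator\<close>

text \<open>Trace class operators, characterised without reference to the modulus: the matrix elements
  along any two orthonormal families are summable.\<close>

definition nuclear_op :: "('a::chilbert_space \<Rightarrow>\<^sub>L 'a) \<Rightarrow> bool"
  where "nuclear_op T \<longleftrightarrow> (\<forall>E f. orthonormal_family (\<lambda>b. b) E \<longrightarrow> orthonormal_family f E \<longrightarrow>
    (\<lambda>b. cmod (cinner (T b) (f b))) summable_on E)"

lemma nuclear_op_add:
  fixes S T :: "'a::chilbert_space \<Rightarrow>\<^sub>L 'a"
  assumes "nuclear_op S" "nuclear_op T"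
  shows "nuclear_op (S + T)"
  unfolding nuclear_op_def
proof (intro allI impI)
  fix E :: "'a set" and f :: "'a \<Rightarrow> 'a"
  assume *: "orthonormal_family (\<lambda>b. b) E" "orthonormal_family f E"
  have "(\<lambda>b. cinner (S b) (f b)) summable_on E" "(\<lambda>b. cinner (T b) (f b)) summable_on E"
    using assms * by (auto simp: nuclear_op_def intro: abs_summable_summable)
  then show "(\<lambda>b. cmod (cinner ((S + T) b) (f b))) summable_on E"
    unfolding summable_on_iff_abs_summable_on_complex[symmetric]
    by (simp add: op_simps cinner_simps summable_on_add)
qed

definition trace_basis :: "'a::chilbert_space set"
  where "trace_basis = (SOME B. orthonormal_basis B)"

lemma trace_basis: "orthonormal_basis trace_basis"
proof -
  have "orthonormal_family (\<lambda>b. b) ({} :: 'a set)"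
    by (simp add: orthonormal_family_def)
  then obtain B :: "'a set" where "orthonormal_basis B"
    by (rule orthonormal_basis_extend)
  then show ?thesis
    unfolding trace_basis_def by (rule someI[of orthonormal_basis])
qed

lemma op_trace_eq: "op_trace T = (\<Sum>\<^sub>\<infinity>b\<in>trace_basis. cinner (T b) b)"
  by (simp add: op_trace_def trace_basis_def)

lemma nuclear_op_trace_summable: "nuclear_op T \<Longrightarrow> (\<lambda>b. cinner (T b) b) summable_on trace_basis"
  using orthonormal_basis_family[OF trace_basis] unfolding nuclear_op_def
  by (blast intro: abs_summable_summable)

lemma op_trace_add: "nuclear_op S \<Longrightarrow> nuclear_op T \<Longrightarrow> op_trace (S + T) = op_trace S + op_trace T"
  unfolding op_trace_eq plus_blinfun.rep_eq cinner_add_left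
  by (intro infsum_add nuclear_op_trace_summable)

text \<open>\<open>B\<close> is the basis that witnesses the Hilbert-Schmidt property and may differ
  from \<open>trace_basis\<close>; \<open>orthonormal_square_sum\<close> compares the two.\<close>

locale hilbert_schmidt_self_adjoint =
  fixes A :: "'a::chilbert_space \<Rightarrow>\<^sub>L 'a" and B :: "'a set"
  assumes adj: "adjoint_pair A A" and basis: "orthonormal_basis B"
    and square_summable: "(\<lambda>b. (norm (A b))\<^sup>2) summable_on B"
begin

text \<open>Parseval expands each norm along \<open>B\<close>; moving \<open>A\<close> and
  \<open>W\<close> across the pairing and applying Bessel in \<open>i\<close> gives the bound. Here
  a factor to the right of \<open>A\<close> turns into its adjoint \<open>W'\<close> on the
  left.\<close>

lemma orthonormal_square_sum:
  assumes W: "adjoint_pair W W'" and f: "orthonormal_family f I"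
  shows "(\<lambda>i. (norm (A (W (f i))))\<^sup>2) summable_on I"
    "(\<Sum>\<^sub>\<infinity>i\<in>I. (norm (A (W (f i))))\<^sup>2) \<le> (\<Sum>\<^sub>\<infinity>b\<in>B. (norm (W' (A b)))\<^sup>2)" (is "_ \<le> ?C")
proof -
  have fin: "(\<Sum>i\<in>F. (norm (A (W (f i))))\<^sup>2) \<le> ?C" if F: "finite F" "F \<subseteq> I" for F
  proof (rule has_sum_mono)
    show "((\<lambda>b. \<Sum>i\<in>F. (cmod (cinner (A (W (f i))) b))\<^sup>2) has_sum (\<Sum>i\<in>F. (norm (A (W (f i))))\<^sup>2)) B"
      by (intro has_sum_finite_sum F Parseval basis)
    show "((\<lambda>b. (norm (W' (A b)))\<^sup>2) has_sum ?C) B"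
      by (intro has_sum_infsum summable_on_blinfun_square(1)[OF square_summable order_refl])
    fix b
    have "cmod (cinner (A (W (f i))) b) = cmod (cinner (W' (A b)) (f i))" for i
      by (subst adjoint_pairD[OF adj], subst adjoint_pairD[OF W], subst cinner_commute) simp
    then show "(\<Sum>i\<in>F. (cmod (cinner (A (W (f i))) b))\<^sup>2) \<le> (norm (W' (A b)))\<^sup>2"
      using Bessel_inequality[OF orthonormal_family_subset[OF f F(2)] F(1)] by simp
  qed
  show 1: "(\<lambda>i. (norm (A (W (f i))))\<^sup>2) summable_on I"
    using fin by (intro nonneg_bdd_above_summable_on bdd_aboveI2[where M = ?C]) auto
  show "(\<Sum>\<^sub>\<infinity>i\<in>I. (norm (A (W (f i))))\<^sup>2) \<le> ?C"
    by (rule infsum_le_finite_sums[OF 1 fin])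
qed

text \<open>Moving X and one A to the second slot pairs Y A Z e with A X' f, where Cauchy-Schwarz
  applies. The first bound keeps Y inside the sum, for errors in Y that vanish only strongly; the
  second extracts the norm of Y and brings both outer factors to the left of A.\<close>

lemma
  assumes X: "adjoint_pair X X'" and Y: "norm Y \<le> K" and Z: "adjoint_pair Z Z'"
    and E: "orthonormal_family e I" and f: "orthonormal_family f I"
  shows sandwich_summable: "(\<lambda>i. cmod (cinner ((X o\<^sub>L A o\<^sub>L Y o\<^sub>L A o\<^sub>L Z) (e i)) (f i))) summable_on I"
    and sandwich_bound: "cmod (\<Sum>\<^sub>\<infinity>i\<in>I. cinner ((X o\<^sub>L A o\<^sub>L Y o\<^sub>L A o\<^sub>L Z) (e i)) (f i)) \<le>
      sqrt (\<Sum>\<^sub>\<infinity>i\<in>I. (norm (Y (A (Z (e i)))))\<^sup>2) * sqrt (\<Sum>\<^sub>\<infinity>b\<in>B. (norm (X (A b)))\<^sup>2)"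
    and sandwich_bound': "cmod (\<Sum>\<^sub>\<infinity>i\<in>I. cinner ((X o\<^sub>L A o\<^sub>L Y o\<^sub>L A o\<^sub>L Z) (e i)) (f i)) \<le>
      K * sqrt (\<Sum>\<^sub>\<infinity>b\<in>B. (norm (Z' (A b)))\<^sup>2) * sqrt (\<Sum>\<^sub>\<infinity>b\<in>B. (norm (X (A b)))\<^sup>2)"
proof -
  have eq: "cinner ((X o\<^sub>L A o\<^sub>L Y o\<^sub>L A o\<^sub>L Z) u) v = cinner (Y (A (Z u))) (A (X' v))" for u v
    by (simp add: adjoint_pairD[OF X] adjoint_pairD[OF adj])
  note Zs = orthonormal_square_sum[OF Z E]
  note YZs = summable_on_blinfun_square[OF Zs(1) Y]
  note Xs = orthonormal_square_sum[OF adjoint_pair_sym[OF X] f]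
  show "(\<lambda>i. cmod (cinner ((X o\<^sub>L A o\<^sub>L Y o\<^sub>L A o\<^sub>L Z) (e i)) (f i))) summable_on I"
    unfolding eq by (rule infsum_pairing(1)[OF YZs(1) Xs(1)])
  have "cmod (\<Sum>\<^sub>\<infinity>i\<in>I. cinner ((X o\<^sub>L A o\<^sub>L Y o\<^sub>L A o\<^sub>L Z) (e i)) (f i)) \<le>
      sqrt (\<Sum>\<^sub>\<infinity>i\<in>I. (norm (Y (A (Z (e i)))))\<^sup>2) * sqrt (\<Sum>\<^sub>\<infinity>i\<in>I. (norm (A (X' (f i))))\<^sup>2)"
    unfolding eq by (rule infsum_pairing(2)[OF YZs(1) Xs(1)])
  also have "\<dots> \<le> sqrt (\<Sum>\<^sub>\<infinity>i\<in>I. (norm (Y (A (Z (e i)))))\<^sup>2) * sqrt (\<Sum>\<^sub>\<infinity>b\<in>B. (norm (X (A b)))\<^sup>2)"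
    by (intro mult_left_mono real_sqrt_le_mono Xs) (auto intro!: infsum_nonneg)
  finally show 1: "cmod (\<Sum>\<^sub>\<infinity>i\<in>I. cinner ((X o\<^sub>L A o\<^sub>L Y o\<^sub>L A o\<^sub>L Z) (e i)) (f i)) \<le> \<dots>" .
  have "0 \<le> K"
    by (rule order_trans[OF norm_ge_zero Y])
  have "(\<Sum>\<^sub>\<infinity>i\<in>I. (norm (Y (A (Z (e i)))))\<^sup>2) \<le> K\<^sup>2 * (\<Sum>\<^sub>\<infinity>b\<in>B. (norm (Z' (A b)))\<^sup>2)"
    using YZs(2) mult_left_mono[OF Zs(2), of "K\<^sup>2"] by simp
  then have "sqrt (\<Sum>\<^sub>\<infinity>i\<in>I. (norm (Y (A (Z (e i)))))\<^sup>2) \<le> sqrt (K\<^sup>2 * (\<Sum>\<^sub>\<infinity>b\<in>B. (norm (Z' (A b)))\<^sup>2))"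
    by (rule real_sqrt_le_mono)
  also have "\<dots> = K * sqrt (\<Sum>\<^sub>\<infinity>b\<in>B. (norm (Z' (A b)))\<^sup>2)"
    using \<open>0 \<le> K\<close> by (simp add: real_sqrt_mult)
  finally show "cmod (\<Sum>\<^sub>\<infinity>i\<in>I. cinner ((X o\<^sub>L A o\<^sub>L Y o\<^sub>L A o\<^sub>L Z) (e i)) (f i)) \<le>
      K * sqrt (\<Sum>\<^sub>\<infinity>b\<in>B. (norm (Z' (A b)))\<^sup>2) * sqrt (\<Sum>\<^sub>\<infinity>b\<in>B. (norm (X (A b)))\<^sup>2)"
    by (intro order_trans[OF 1] mult_right_mono) (auto intro!: infsum_nonneg)
qed

lemma sandwich_nuclear:
  assumes "adjoint_pair X X'" "adjoint_pair Z Z'"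
  shows "nuclear_op (X o\<^sub>L A o\<^sub>L Y o\<^sub>L A o\<^sub>L Z)"
  unfolding nuclear_op_def
  by (intro allI impI sandwich_summable[OF assms(1) order_refl assms(2)])

lemma left_null:
  fixes D :: "nat \<Rightarrow> 'a \<Rightarrow>\<^sub>L 'a"
  assumes "\<And>n. norm (D n) \<le> K" "\<And>u. (\<lambda>n. D n u) \<longlonglongrightarrow> 0"
  shows "(\<lambda>n. sqrt (\<Sum>\<^sub>\<infinity>b\<in>B. (norm (D n (A b)))\<^sup>2)) \<longlonglongrightarrow> 0"
  using tendsto_real_sqrt[OF infsum_square_strong_null[OF square_summable assms]] by simp

lemma left_bounded:
  fixes D :: "'a \<Rightarrow>\<^sub>L 'a"
  assumes "norm D \<le> K"
  shows "sqrt (\<Sum>\<^sub>\<infinity>b\<in>B. (norm (D (A b)))\<^sup>2) \<le> K * sqrt (\<Sum>\<^sub>\<infinity>b\<in>B. (norm (A b))\<^sup>2)"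
proof -
  have "0 \<le> K"
    by (rule order_trans[OF norm_ge_zero assms])
  then show ?thesis
    using real_sqrt_le_mono[OF summable_on_blinfun_square(2)[OF square_summable assms]]
    by (simp add: real_sqrt_mult)
qed

text \<open>The three factors are exchanged one at a time. The error in \<open>G\<close> is placed
  between the limits \<open>X\<close> and \<open>Z\<close>: then the vectors A Z b form one fixed
  square-summable family, on which strong convergence of \<open>G\<close> suffices.\<close>

lemma sandwich_trace_tendsto:
  assumes "strong_star F X" "strong_star G Y" "strong_star H Z"
  shows "(\<lambda>n. op_trace (F n o\<^sub>L A o\<^sub>L G n o\<^sub>L A o\<^sub>L H n)) \<longlonglongrightarrow> op_trace (X o\<^sub>L A o\<^sub>L Y o\<^sub>L A o\<^sub>L Z)"
proof -
  obtain F' X' K where F: "\<And>n. adjoint_pair (F n) (F' n)" "\<And>n. norm (F n) \<le> K"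
    "\<And>n. norm (F' n) \<le> K" "adjoint_pair X X'"
    "\<And>v. (\<lambda>n. F n v) \<longlonglongrightarrow> X v" "\<And>v. (\<lambda>n. F' n v) \<longlonglongrightarrow> X' v"
    by (rule strong_starE[OF assms(1)]) (rule that)
  obtain G' Y' L where G: "\<And>n. adjoint_pair (G n) (G' n)" "\<And>n. norm (G n) \<le> L"
    "\<And>n. norm (G' n) \<le> L" "adjoint_pair Y Y'"
    "\<And>v. (\<lambda>n. G n v) \<longlonglongrightarrow> Y v" "\<And>v. (\<lambda>n. G' n v) \<longlonglongrightarrow> Y' v"
    by (rule strong_starE[OF assms(2)]) (rule that)
  obtain H' Z' M where H: "\<And>n. adjoint_pair (H n) (H' n)" "\<And>n. norm (H n) \<le> M"
    "\<And>n. norm (H' n) \<le> M" "adjoint_pair Z Z'"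
    "\<And>v. (\<lambda>n. H n v) \<longlonglongrightarrow> Z v" "\<And>v. (\<lambda>n. H' n v) \<longlonglongrightarrow> Z' v"
    by (rule strong_starE[OF assms(3)]) (rule that)
  define a where "a = sqrt (\<Sum>\<^sub>\<infinity>b\<in>B. (norm (A b))\<^sup>2)"
  have [simp]: "a \<ge> 0"
    by (simp add: a_def infsum_nonneg)
  have nn: "0 \<le> K" "0 \<le> L" "0 \<le> M"
    by (rule order_trans[OF norm_ge_zero F(2)], rule order_trans[OF norm_ge_zero G(2)],
      rule order_trans[OF norm_ge_zero H(2)])
  note onf = orthonormal_basis_family[OF trace_basis]
  let ?T = "\<lambda>X Y Z. X o\<^sub>L A o\<^sub>L Y o\<^sub>L A o\<^sub>L Z"
  have FX: "adjoint_pair (F n - X) (F' n - X')" "norm (F n - X) \<le> K + norm X" for n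
    by (intro adjoint_pair_diff F, intro order_trans[OF norm_triangle_ineq4] add_mono F) simp
  have HZ: "adjoint_pair (H n - Z) (H' n - Z')" "norm (H' n - Z') \<le> M + norm Z'" for n
    by (intro adjoint_pair_diff H, intro order_trans[OF norm_triangle_ineq4] add_mono H) simp
  have GY: "norm (G n - Y) \<le> L + norm Y" for n
    by (intro order_trans[OF norm_triangle_ineq4] add_mono G) simp
  \<comment> \<open>\<open>u\<close>, \<open>v\<close>, \<open>w\<close> bound the errors on the
    left, on the right and in the middle; the right error is measured through the adjoints
    \<open>H' n - Z'\<close>, and \<open>a\<close> is the Hilbert-Schmidt norm of
    \<open>A\<close>.\<close>
  define u where "u n = L * (M * a) * sqrt (\<Sum>\<^sub>\<infinity>b\<in>B. (norm ((F n - X) (A b)))\<^sup>2)" for n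
  define v where "v n = L * sqrt (\<Sum>\<^sub>\<infinity>b\<in>B. (norm ((H' n - Z') (A b)))\<^sup>2) * (norm X * a)" for n
  define w where "w n = sqrt (\<Sum>\<^sub>\<infinity>b\<in>trace_basis. (norm ((G n - Y) (A (Z b))))\<^sup>2) * (norm X * a)" for n
  have 1: "cmod (op_trace (?T (F n - X) (G n) (H n))) \<le> u n" for n
    unfolding op_trace_eq u_def a_def
    by (intro order_trans[OF sandwich_bound'[OF FX(1) G(2) H(1) onf onf]] mult_right_mono mult_left_mono
        left_bounded H) (auto intro!: infsum_nonneg nn)
  have 2: "cmod (op_trace (?T X (G n) (H n - Z))) \<le> v n" for n
    unfolding op_trace_eq v_def a_def
    by (intro order_trans[OF sandwich_bound'[OF F(4) G(2) HZ(1) onf onf]] mult_left_mono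
        left_bounded) (auto intro!: infsum_nonneg nn mult_nonneg_nonneg)
  have 3: "cmod (op_trace (?T X (G n - Y) Z)) \<le> w n" for n
    unfolding op_trace_eq w_def a_def
    by (intro order_trans[OF sandwich_bound[OF F(4) GY H(4) onf onf]] mult_left_mono
        left_bounded) (auto intro!: infsum_nonneg nn)
  have split: "?T (F n) (G n) (H n) =
      ?T X Y Z + (?T (F n - X) (G n) (H n) + (?T X (G n) (H n - Z) + ?T X (G n - Y) Z))" for n
    unfolding compose.diff_left compose.diff_right by simp
  have nuc: "nuclear_op (?T X Y Z)" "nuclear_op (?T (F n - X) (G n) (H n))"
      "nuclear_op (?T X (G n) (H n - Z))" "nuclear_op (?T X (G n - Y) Z)" for n
    by (rule sandwich_nuclear[OF F(4) H(4)] sandwich_nuclear[OF FX(1) H(1)]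
        sandwich_nuclear[OF F(4) HZ(1)])+
  have le: "norm (op_trace (?T (F n) (G n) (H n)) - op_trace (?T X Y Z)) \<le> u n + (v n + w n)" for n
  proof -
    have "op_trace (?T (F n) (G n) (H n)) - op_trace (?T X Y Z) = op_trace (?T (F n - X) (G n) (H n))
        + (op_trace (?T X (G n) (H n - Z)) + op_trace (?T X (G n - Y) Z))"
      unfolding split
        op_trace_add[OF nuc(1) nuclear_op_add[OF nuc(2) nuclear_op_add[OF nuc(3,4)]]]
        op_trace_add[OF nuc(2) nuclear_op_add[OF nuc(3,4)]] op_trace_add[OF nuc(3,4)]
      by (rule add_diff_cancel_left')
    also have "norm \<dots> \<le> u n + (v n + w n)"
      by (intro norm_triangle_mono 1 2 3)
    finally show ?thesis .
  qed
  have uvw: "(\<lambda>n. u n + (v n + w n)) \<longlonglongrightarrow> 0"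
  proof -
    have null: "(\<lambda>n. (F n - X) x) \<longlonglongrightarrow> 0" "(\<lambda>n. (H' n - Z') x) \<longlonglongrightarrow> 0"
      "(\<lambda>n. (G n - Y) x) \<longlonglongrightarrow> 0" for x
      unfolding minus_blinfun.rep_eq by (rule LIM_zero, rule F G H)+
    have "u \<longlonglongrightarrow> 0"
      unfolding u_def by (intro tendsto_mult_right_zero left_null[OF FX(2) null(1)])
    moreover have "v \<longlonglongrightarrow> 0"
      unfolding v_def by (intro tendsto_mult_left_zero tendsto_mult_right_zero left_null[OF HZ(2) null(2)])
    moreover have "w \<longlonglongrightarrow> 0"
    proof -
      have "(\<lambda>n. \<Sum>\<^sub>\<infinity>b\<in>trace_basis. (norm ((G n - Y) (A (Z b))))\<^sup>2) \<longlonglongrightarrow> 0"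
        by (rule infsum_square_strong_null[OF orthonormal_square_sum(1)[OF H(4) onf] GY null(3)])
      from tendsto_real_sqrt[OF this] show ?thesis
        unfolding w_def by (intro tendsto_mult_left_zero) simp
    qed
    ultimately show ?thesis
      by (auto intro: tendsto_add_zero)
  qed
  show ?thesis
    by (rule LIM_zero_cancel, rule Lim_null_comparison[OF _ uvw]) (simp add: le)
qed

text \<open>Records a sequence together with its limit, so that an identity used for the
  approximants is matched by the same identity in the limit. Closure under multiplication, scalars
  and adjoints is derived from the two rules.\<close>

inductive sandwich :: "(nat \<Rightarrow> 'a \<Rightarrow>\<^sub>L 'a) \<Rightarrow> ('a \<Rightarrow>\<^sub>L 'a) \<Rightarrow> bool"
  where
    base: "strong_star F X \<Longrightarrow> strong_star G Y \<Longrightarrow> strong_star H Z \<Longrightarrow>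
      sandwich (\<lambda>n. F n o\<^sub>L A o\<^sub>L G n o\<^sub>L A o\<^sub>L H n) (X o\<^sub>L A o\<^sub>L Y o\<^sub>L A o\<^sub>L Z)"
  | add: "sandwich F S \<Longrightarrow> sandwich G T \<Longrightarrow> sandwich (\<lambda>n. F n + G n) (S + T)"

lemma sandwich_trace:
  assumes "sandwich F T"
  shows "(\<forall>n. nuclear_op (F n)) \<and> nuclear_op T \<and> (\<lambda>n. op_trace (F n)) \<longlonglongrightarrow> op_trace T"
  using assms
proof induction
  case (base F X G Y H Z)
  have "nuclear_op (F n o\<^sub>L A o\<^sub>L G n o\<^sub>L A o\<^sub>L H n)" for n
    by (rule strong_starE[OF base(1)], rule strong_starE[OF base(3)], rule sandwich_nuclear)
  moreover have "nuclear_op (X o\<^sub>L A o\<^sub>L Y o\<^sub>L A o\<^sub>L Z)"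
    by (rule strong_starE[OF base(1)], rule strong_starE[OF base(3)], rule sandwich_nuclear)
  ultimately show ?case
    using sandwich_trace_tendsto[OF base] by blast
next
  case (add F S G T)
  then show ?case
    by (auto intro: nuclear_op_add intro!: tendsto_add simp: op_trace_add)
qed

text \<open>Since \<open>A\<close> is self-adjoint, the adjoint of X A Y A Z is again of this shape
  with the outer factors exchanged. This serves negative powers, and it supplies the adjoint that
  \<open>nuclear_trace_class\<close> asks for.\<close>

lemma sandwich_adjoint:
  assumes "sandwich F T"
  shows "\<exists>F' T'. (\<forall>n. adjoint_pair (F n) (F' n)) \<and> adjoint_pair T T' \<and> sandwich F' T'"
  using assms
proof induction
  case (base F X G Y H Z)
  obtain F' X' where F: "\<And>n. adjoint_pair (F n) (F' n)" "adjoint_pair X X'" "strong_star F' X'"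
    by (rule strong_star_adjointE[OF base(1)]) (rule that)
  obtain G' Y' where G: "\<And>n. adjoint_pair (G n) (G' n)" "adjoint_pair Y Y'" "strong_star G' Y'"
    by (rule strong_star_adjointE[OF base(2)]) (rule that)
  obtain H' Z' where H: "\<And>n. adjoint_pair (H n) (H' n)" "adjoint_pair Z Z'" "strong_star H' Z'"
    by (rule strong_star_adjointE[OF base(3)]) (rule that)
  have "adjoint_pair (X o\<^sub>L A o\<^sub>L Y o\<^sub>L A o\<^sub>L Z) (Z' o\<^sub>L A o\<^sub>L Y' o\<^sub>L A o\<^sub>L X')"
    if "adjoint_pair X X'" "adjoint_pair Y Y'" "adjoint_pair Z Z'" for X X' Y Y' Z Z'
    using adjoint_pair_compose[OF adjoint_pair_compose[OF adjoint_pair_compose[OF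
          adjoint_pair_compose[OF that(1) adj] that(2)] adj] that(3)]
    by (simp add: compose_assoc)
  note * = this
  have "sandwich (\<lambda>n. H' n o\<^sub>L A o\<^sub>L G' n o\<^sub>L A o\<^sub>L F' n) (Z' o\<^sub>L A o\<^sub>L Y' o\<^sub>L A o\<^sub>L X')"
    by (intro sandwich.base F G H)
  then show ?case
    using *[OF F(1) G(1) H(1)] *[OF F(2) G(2) H(2)]
    by (intro exI[of _ "\<lambda>n. H' n o\<^sub>L A o\<^sub>L G' n o\<^sub>L A o\<^sub>L F' n"]
        exI[of _ "Z' o\<^sub>L A o\<^sub>L Y' o\<^sub>L A o\<^sub>L X'"]) simp
next
  case (add F S G T)
  obtain F' S' where F: "\<And>n. adjoint_pair (F n) (F' n)" "adjoint_pair S S'" "sandwich F' S'"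
    using add.IH(1) by blast
  obtain G' T' where G: "\<And>n. adjoint_pair (G n) (G' n)" "adjoint_pair T T'" "sandwich G' T'"
    using add.IH(2) by blast
  show ?case
    using adjoint_pair_add[OF F(1) G(1)] adjoint_pair_add[OF F(2) G(2)] sandwich.add[OF F(3) G(3)]
    by (intro exI[of _ "\<lambda>n. F' n + G' n"] exI[of _ "S' + T'"]) simp
qed

lemma sandwich_left:
  assumes "sandwich F T" "strong_star V W"
  shows "sandwich (\<lambda>n. V n o\<^sub>L F n) (W o\<^sub>L T)"
  using assms(1)
proof induction
  case (base F X G Y H Z)
  from sandwich.base[OF strong_star_compose[OF assms(2) base(1)] base(2,3)]
  show ?case
    by (simp add: compose_assoc)
next
  case (add F S G T)
  from sandwich.add[OF add.IH] show ?case
    by (simp add: compose.add_right)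
qed

lemma sandwich_right:
  assumes "sandwich F T" "strong_star V W"
  shows "sandwich (\<lambda>n. F n o\<^sub>L V n) (T o\<^sub>L W)"
  using assms(1)
proof induction
  case (base F X G Y H Z)
  from sandwich.base[OF base(1,2) strong_star_compose[OF base(3) assms(2)]]
  show ?case
    by (simp add: compose_assoc)
next
  case (add F S G T)
  from sandwich.add[OF add.IH] show ?case
    by (simp add: compose.add_left)
qed

lemma sandwich_0: "sandwich (\<lambda>_. 0) 0"
  using sandwich.base[OF strong_star_const[OF adjoint_pair_0] strong_star_id strong_star_id] by simp

lemma sandwich_scaleC:
  assumes "sandwich F T"
  shows "sandwich (\<lambda>n. c *\<^sub>C F n) (c *\<^sub>C T)"
  using sandwich_left[OF assms strong_star_scaleC[OF strong_star_id]]
  by (simp add: scaleC_compose_left)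

lemma sandwich_sum:
  assumes "\<And>i. i \<in> I \<Longrightarrow> sandwich (F i) (T i)"
  shows "sandwich (\<lambda>n. \<Sum>i\<in>I. F i n) (\<Sum>i\<in>I. T i)"
  using assms by (induction I rule: infinite_finite_induct) (auto intro: sandwich_0 sandwich.add)

end

section \<open>Power series of operators, moduli and trace class operators\<close>

text \<open>A common calculus for the Taylor tails of the exponential and for the series of the
  square root.\<close>

definition op_series :: "(nat \<Rightarrow> complex) \<Rightarrow> ('a::chilbert_space \<Rightarrow>\<^sub>L 'a) \<Rightarrow> 'a \<Rightarrow>\<^sub>L 'a"
  where "op_series c T = (\<Sum>k. c k *\<^sub>C op_pow T k)"

lemma scaleC_blinfun_one: "1 *\<^sub>C T = (T :: 'a::real_normed_vector \<Rightarrow>\<^sub>L 'b::chilbert_space)"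
  by (rule blinfun_eqI) simp

lemma scaleC_blinfun_assoc:
  "c *\<^sub>C d *\<^sub>C T = (c * d) *\<^sub>C (T :: 'a::real_normed_vector \<Rightarrow>\<^sub>L 'b::chilbert_space)"
  by (rule blinfun_eqI) (simp add: scaleC_scaleC)

lemma norm_op_series_term:
  "norm T \<le> K \<Longrightarrow> norm (c k *\<^sub>C op_pow T k) \<le> cmod (c k) * K ^ k"
  by (intro order_trans[OF norm_scaleC_blinfun_le] mult_left_mono norm_op_pow_le) auto

context
  fixes c :: "nat \<Rightarrow> complex" and K :: real
  assumes c: "summable (\<lambda>k. cmod (c k) * K ^ k)"
begin

lemma op_series_summable_norm: "norm T \<le> K \<Longrightarrow> summable (\<lambda>k. norm (c k *\<^sub>C op_pow T k))"
  by (rule summable_comparison_test'[OF c]) (simp add: norm_op_series_term)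

lemma op_series_sums: "norm T \<le> K \<Longrightarrow> (\<lambda>k. c k *\<^sub>C op_pow T k) sums op_series c T"
  unfolding op_series_def by (intro summable_sums summable_norm_cancel[OF op_series_summable_norm])

lemma norm_op_series: "norm T \<le> K \<Longrightarrow> norm (op_series c T) \<le> (\<Sum>k. cmod (c k) * K ^ k)"
  unfolding op_series_def
  by (rule order_trans[OF summable_norm[OF op_series_summable_norm]])
    (auto intro: suminf_le norm_op_series_term op_series_summable_norm c)

lemma op_series_apply_sums: "norm T \<le> K \<Longrightarrow> (\<lambda>k. c k *\<^sub>C op_pow T k v) sums op_series c T v"
  using bounded_linear.sums[OF blinfun.bounded_linear_left op_series_sums, of T v] by simp

lemma op_series_limit: "norm T \<le> K \<Longrightarrow> (\<lambda>n. (\<Sum>k<n. c k *\<^sub>C op_pow T k) v) \<longlonglongrightarrow> op_series c T v"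
  using op_series_apply_sums[of T v] by (simp add: sums_def blinfun.sum_left)

end

lemma adjoint_pair_op_series:
  assumes "summable (\<lambda>k. cmod (c k) * K ^ k)" "norm T \<le> K" "adjoint_pair T T'"
  shows "adjoint_pair (op_series c T) (op_series (\<lambda>k. cnj (c k)) T')"
proof (rule adjoint_pair_limit)
  show "adjoint_pair (\<Sum>k<n. c k *\<^sub>C op_pow T k) (\<Sum>k<n. cnj (c k) *\<^sub>C op_pow T' k)" for n
    by (intro adjoint_pair_sum adjoint_pair_scaleC adjoint_pair_pow assms)
  show "(\<lambda>n. (\<Sum>k<n. c k *\<^sub>C op_pow T k) v) \<longlonglongrightarrow> op_series c T v" for v
    by (rule op_series_limit[OF assms(1,2)])
  have "norm T' \<le> K"
    using norm_adjoint_le[OF assms(3)] assms(2) by simp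
  then show "(\<lambda>n. (\<Sum>k<n. cnj (c k) *\<^sub>C op_pow T' k) v) \<longlonglongrightarrow> op_series (\<lambda>k. cnj (c k)) T' v" for v
    using assms(1) by (intro op_series_limit) auto
qed

lemma clinear_op_pow: "clinear_op T \<Longrightarrow> clinear_op (op_pow T k)"
  by (induction k) (simp_all add: clinear_op_def)

text \<open>Splitting off the constant term exposes a factor \<open>T\<close>, on either side
  because a power series commutes with its argument; this is how factors \<open>A\<close> are
  extracted from the exponential.\<close>

lemma op_series_shift:
  assumes c: "summable (\<lambda>k. cmod (c k) * K ^ k)" and K: "norm T \<le> K" "K > 0" and T: "clinear_op T"
  shows "op_series c T = c 0 *\<^sub>C id_blinfun + (T o\<^sub>L op_series (\<lambda>k. c (Suc k)) T)"
    "op_series c T = c 0 *\<^sub>C id_blinfun + (op_series (\<lambda>k. c (Suc k)) T o\<^sub>L T)"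
proof -
  have "summable (\<lambda>k. cmod (c (Suc k)) * K ^ Suc k)"
    using c by (subst (asm) summable_Suc_iff[symmetric])
  then have "summable (\<lambda>k. K * (cmod (c (Suc k)) * K ^ k))"
    by (simp add: mult_ac)
  then have c': "summable (\<lambda>k. cmod (c (Suc k)) * K ^ k)"
    using K(2) by (subst (asm) summable_cmult_iff) auto
  note sums' = op_series_sums[OF c' K(1)]
  have sums: "(\<lambda>k. c (Suc k) *\<^sub>C op_pow T (Suc k)) sums (op_series c T - c 0 *\<^sub>C id_blinfun)"
    using op_series_sums[OF c K(1)] by (subst sums_Suc_iff) simp
  have "(\<lambda>k. T o\<^sub>L (c (Suc k) *\<^sub>C op_pow T k)) sums (T o\<^sub>L op_series (\<lambda>k. c (Suc k)) T)"
    by (rule bounded_linear.sums[OF compose.bounded_linear_right sums'])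
  then have "(\<lambda>k. c (Suc k) *\<^sub>C op_pow T (Suc k)) sums (T o\<^sub>L op_series (\<lambda>k. c (Suc k)) T)"
    by (simp add: scaleC_compose_right[OF T])
  from sums_unique2[OF sums this]
  show "op_series c T = c 0 *\<^sub>C id_blinfun + (T o\<^sub>L op_series (\<lambda>k. c (Suc k)) T)"
    by (simp add: algebra_simps)
  have "(\<lambda>k. (c (Suc k) *\<^sub>C op_pow T k) o\<^sub>L T) sums (op_series (\<lambda>k. c (Suc k)) T o\<^sub>L T)"
    by (rule bounded_linear.sums[OF compose.bounded_linear_left sums'])
  then have "(\<lambda>k. c (Suc k) *\<^sub>C op_pow T (Suc k)) sums (op_series (\<lambda>k. c (Suc k)) T o\<^sub>L T)"
    by (simp add: scaleC_compose_left op_pow_commute)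
  from sums_unique2[OF sums this]
  show "op_series c T = c 0 *\<^sub>C id_blinfun + (op_series (\<lambda>k. c (Suc k)) T o\<^sub>L T)"
    by (simp add: algebra_simps)
qed

text \<open>The library version of the Cauchy product needs a normed algebra, which \<^typ>\<open>'a \<Rightarrow>\<^sub>L 'a\<close> is not;
  the error term is dominated by that of the scalar series of norms.\<close>

lemma op_series_mult:
  assumes c: "summable (\<lambda>k. cmod (c k) * K ^ k)" and d: "summable (\<lambda>k. cmod (d k) * K ^ k)"
    and K: "norm T \<le> K" and T: "clinear_op T"
  shows "op_series c T o\<^sub>L op_series d T = op_series (\<lambda>m. \<Sum>i\<le>m. c i * d (m - i)) T"
proof -
  have "K \<ge> 0"
    by (rule order_trans[OF norm_ge_zero K])
  define a b where "a k = cmod (c k) * K ^ k" and "b k = cmod (d k) * K ^ k" for k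
  \<comment> \<open>Products of partial sums run over the square \<open>?S n\<close>, partial Cauchy
    products over the triangle \<open>?D n\<close>; the difference lives on the remaining corner,
    whose scalar majorant tends to zero.\<close>
  let ?S = "\<lambda>n::nat. {..<n} \<times> {..<n}" and ?D = "\<lambda>n::nat. {(i, j). i + j < n}"
  have D: "?D n \<subseteq> ?S n" for n
    by auto
  let ?f = "\<lambda>(i, j). (c i * d j) *\<^sub>C op_pow T (i + j)" and ?r = "\<lambda>(i, j). a i * b j"
  let ?P = "\<lambda>n. (\<Sum>k<n. c k *\<^sub>C op_pow T k) o\<^sub>L (\<Sum>k<n. d k *\<^sub>C op_pow T k)"
    and ?Q = "\<lambda>n. \<Sum>m<n. (\<Sum>i\<le>m. c i * d (m - i)) *\<^sub>C op_pow T m"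
  have "(\<lambda>n. (\<Sum>k<n. a k) * (\<Sum>k<n. b k) - (\<Sum>k<n. \<Sum>i\<le>k. a i * b (k - i)))
      \<longlonglongrightarrow> (\<Sum>k. a k) * (\<Sum>k. b k) - (\<Sum>k. a k) * (\<Sum>k. b k)"
    using c d Cauchy_product_sums[of a b] \<open>K \<ge> 0\<close>
    by (intro tendsto_intros summable_LIMSEQ) (auto simp: a_def b_def sums_def)
  moreover have "(\<Sum>k<n. a k) * (\<Sum>k<n. b k) - (\<Sum>k<n. \<Sum>i\<le>k. a i * b (k - i)) = sum ?r (?S n - ?D n)" for n
  proof -
    have "(\<Sum>k<n. a k) * (\<Sum>k<n. b k) = sum ?r (?S n)"
      by (simp add: sum_product sum.cartesian_product)
    moreover have "(\<Sum>k<n. \<Sum>i\<le>k. a i * b (k - i)) = sum ?r (?D n)"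
      by (rule sum.triangle_reindex[symmetric])
    ultimately show ?thesis
      using sum_diff[OF _ D[of n], of ?r] by simp
  qed
  ultimately have lim: "(\<lambda>n. sum ?r (?S n - ?D n)) \<longlonglongrightarrow> 0"
    by simp
  have PQ: "?P n - ?Q n = sum ?f (?S n - ?D n)" for n
  proof -
    have "?P n = (\<Sum>j<n. \<Sum>i<n. (c i * d j) *\<^sub>C op_pow T (i + j))"
      by (simp add: compose.sum_left compose.sum_right scaleC_compose_left
          scaleC_compose_right[OF clinear_op_pow[OF T]] op_pow_add scaleC_blinfun_assoc)
    also have "\<dots> = (\<Sum>i<n. \<Sum>j<n. (c i * d j) *\<^sub>C op_pow T (i + j))"
      by (rule sum.swap)
    finally have "?P n = sum ?f (?S n)"
      by (simp add: sum.cartesian_product)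
    moreover have "?Q n = (\<Sum>k<n. \<Sum>i\<le>k. (c i * d (k - i)) *\<^sub>C op_pow T (i + (k - i)))"
      by (simp add: scaleC_blinfun.sum_left)
    moreover have "\<dots> = sum ?f (?D n)"
      by (rule sum.triangle_reindex[symmetric])
    ultimately show ?thesis
      using sum_diff[OF _ D[of n], of ?f] by simp
  qed
  have "norm (?P n - ?Q n) \<le> sum ?r (?S n - ?D n)" for n
    unfolding PQ
  proof (rule sum_norm_le)
    fix x :: "nat \<times> nat"
    obtain i j where x: "x = (i, j)"
      by (cases x)
    have "norm ((c i * d j) *\<^sub>C op_pow T (i + j)) \<le> cmod (c i * d j) * K ^ (i + j)"
      by (intro order_trans[OF norm_scaleC_blinfun_le] mult_left_mono norm_op_pow_le K) simp
    then show "norm (?f x) \<le> ?r x"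
      by (simp add: x a_def b_def norm_mult power_add mult_ac)
  qed
  then have "(\<lambda>n. ?P n - ?Q n) \<longlonglongrightarrow> 0"
    by (intro Lim_null_comparison[OF _ lim]) simp
  moreover have "?P \<longlonglongrightarrow> (op_series c T o\<^sub>L op_series d T)"
    using op_series_sums[OF c K] op_series_sums[OF d K]
    by (intro compose.tendsto) (simp_all add: sums_def)
  ultimately have "(\<lambda>n. ?P n - (?P n - ?Q n)) \<longlonglongrightarrow> (op_series c T o\<^sub>L op_series d T) - 0"
    by (intro tendsto_diff)
  then have "(\<lambda>m. (\<Sum>i\<le>m. c i * d (m - i)) *\<^sub>C op_pow T m) sums (op_series c T o\<^sub>L op_series d T)"
    by (simp add: sums_def)
  then show ?thesis
    unfolding op_series_def[of "\<lambda>m. \<Sum>i\<le>m. c i * d (m - i)"] by (rule sums_unique)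
qed

text \<open>Each term converges strongly and is dominated by a multiple of the summable majorant, so
  Tannery's theorem allows the limit inside the series.\<close>

lemma strong_star_op_series:
  assumes F: "strong_star F X" and K: "\<And>n. norm (F n) \<le> K" "norm X \<le> K"
    and c: "summable (\<lambda>k. cmod (c k) * K ^ k)"
  shows "strong_star (\<lambda>n. op_series c (F n)) (op_series c X)"
proof -
  \<comment> \<open>Stated for arbitrary coefficients and operators, because the adjoints need it
    again with conjugated coefficients.\<close>
  have lim: "(\<lambda>n. op_series c (F n) v) \<longlonglongrightarrow> op_series c X v"
    if F: "strong_star F X" and K: "\<And>n. norm (F n) \<le> K" "norm X \<le> K"
      and c: "summable (\<lambda>k. cmod (c k) * K ^ k)" for c F X v
  proof -
    let ?t = "\<lambda>k n. c k *\<^sub>C op_pow (F n) k v - c k *\<^sub>C op_pow X k v"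
    let ?M = "\<lambda>k. 2 * norm v * (cmod (c k) * K ^ k)"
    have M: "summable ?M"
      by (intro summable_mult c)
    have t_le: "norm (?t k n) \<le> ?M k" for k n
    proof -
      have "norm (c k *\<^sub>C op_pow Y k v) \<le> norm v * (cmod (c k) * K ^ k)" if "norm Y \<le> K" for Y
        using order_trans[OF norm_blinfun mult_right_mono[OF norm_op_series_term[OF that]], of v c k]
        by (simp add: mult_ac)
      from add_mono[OF this[OF K(1)[of n]] this[OF K(2)]] show ?thesis
        by (intro order_trans[OF norm_triangle_ineq4]) (simp add: mult_ac)
    qed
    have "(\<lambda>n. norm (?t k n)) \<longlonglongrightarrow> 0" for k
    proof -
      obtain F' X' L where "\<And>n. adjoint_pair (op_pow (F n) k) (F' n)" "\<And>n. norm (op_pow (F n) k) \<le> L"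
        "\<And>n. norm (F' n) \<le> L" "adjoint_pair (op_pow X k) X'"
        and *: "\<And>v. (\<lambda>n. op_pow (F n) k v) \<longlonglongrightarrow> op_pow X k v" "\<And>v. (\<lambda>n. F' n v) \<longlonglongrightarrow> X' v"
        by (rule strong_starE[OF strong_star_pow[OF F]]) (rule that)
      show ?thesis
        by (intro tendsto_norm_zero LIM_zero scaleC.tendsto tendsto_const *)
    qed
    moreover have "\<forall>\<^sub>F (k, n) in sequentially \<times>\<^sub>F sequentially. norm (norm (?t k n)) \<le> ?M k"
      by (rule always_eventually) (use t_le in auto)
    ultimately have "(\<lambda>n. \<Sum>k. norm (?t k n)) \<longlonglongrightarrow> (\<Sum>k. 0::real)"
      by (rule tannerys_theorem[THEN conjunct2, THEN conjunct2, OF _ _ M]) simp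
    then have 1: "(\<lambda>n. \<Sum>k. norm (?t k n)) \<longlonglongrightarrow> 0"
      by simp
    have "norm (op_series c (F n) v - op_series c X v) \<le> (\<Sum>k. norm (?t k n))" for n
    proof -
      have s: "summable (\<lambda>k. norm (?t k n))"
        by (rule summable_comparison_test'[OF M]) (simp add: t_le)
      have "(\<lambda>k. ?t k n) sums (op_series c (F n) v - op_series c X v)"
        by (intro sums_diff op_series_apply_sums[OF c] K)
      then show ?thesis
        using summable_norm[OF s] by (simp add: sums_iff)
    qed
    then show ?thesis
      by (intro LIM_zero_cancel[OF Lim_null_comparison[OF _ 1]]) simp
  qed
  obtain F' X' where F': "\<And>n. adjoint_pair (F n) (F' n)" "adjoint_pair X X'" "strong_star F' X'"
    by (rule strong_star_adjointE[OF F]) (rule that)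
  have K': "norm (F' n) \<le> K" "norm X' \<le> K" for n
    using order_trans[OF norm_adjoint_le[OF F'(1)] K(1)] order_trans[OF norm_adjoint_le[OF F'(2)] K(2)]
    by auto
  show ?thesis
  proof (rule strong_starI)
    show "adjoint_pair (op_series c (F n)) (op_series (\<lambda>k. cnj (c k)) (F' n))" for n
      by (intro adjoint_pair_op_series[OF c] K F')
    show "adjoint_pair (op_series c X) (op_series (\<lambda>k. cnj (c k)) X')"
      by (intro adjoint_pair_op_series[OF c] K F')
    show "norm (op_series c (F n)) \<le> (\<Sum>k. cmod (c k) * K ^ k)" for n
      by (intro norm_op_series[OF c] K)
    show "(\<lambda>n. op_series c (F n) v) \<longlonglongrightarrow> op_series c X v" for v
      by (rule lim[OF F K c])
    show "(\<lambda>n. op_series (\<lambda>k. cnj (c k)) (F' n) v) \<longlonglongrightarrow> op_series (\<lambda>k. cnj (c k)) X' v" for v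
      by (rule lim[OF F'(3) K']) (simp add: c)
  qed
qed

section \<open>Taylor tails of the exponential\<close>

lemma summable_exp_coeff: "summable (\<lambda>k. cmod (z ^ (k + m) / fact (k + m)) * K ^ k)"
proof -
  have "summable (\<lambda>k. norm (1 * z) ^ m * (inverse (fact k) * (cmod z * \<bar>K\<bar>) ^ k))"
    using summable_exp[of "cmod z * \<bar>K\<bar>"] by (intro summable_mult)
  then show ?thesis
  proof (rule summable_comparison_test'[where N = 0])
    fix k
    have "inverse (fact (k + m)) \<le> (inverse (fact k) :: real)"
      by (intro le_imp_inverse_le fact_mono) simp_all
    then have "cmod z ^ (k + m) * \<bar>K\<bar> ^ k * inverse (fact (k + m))
        \<le> cmod z ^ (k + m) * \<bar>K\<bar> ^ k * inverse (fact k)"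
      by (intro mult_left_mono) auto
    then show "norm (cmod (z ^ (k + m) / fact (k + m)) * K ^ k)
        \<le> norm (1 * z) ^ m * (inverse (fact k) * (cmod z * \<bar>K\<bar>) ^ k)"
      by (simp add: norm_mult norm_inverse norm_power abs_mult power_abs power_add power_mult_distrib
          divide_inverse mult_ac)
  qed
qed

text \<open>Formally the \<open>m\<close>-th Taylor tail of e^(zA) divided by A^m. With z = i, the
  cases m = 1 and m = 2 are the functions G and E of the overview.\<close>

definition exp_remainder :: "nat \<Rightarrow> complex \<Rightarrow> ('a::chilbert_space \<Rightarrow>\<^sub>L 'a) \<Rightarrow> 'a \<Rightarrow>\<^sub>L 'a"
  where "exp_remainder m z = op_series (\<lambda>k. z ^ (k + m) / fact (k + m))"

lemma op_exp_scaleC: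
  assumes "clinear_op A"
  shows "op_exp (z *\<^sub>C A) = exp_remainder 0 z A"
proof -
  have "(z ^ n *\<^sub>C op_pow A n) /\<^sub>R fact n = (z ^ n / fact n) *\<^sub>C op_pow A n" for n
    by (rule blinfun_eqI)
      (simp add: op_simps scaleR_scaleC scaleC_scaleC divide_inverse mult.commute)
  then show ?thesis
    unfolding op_exp_def exp_remainder_def op_series_def by (simp add: op_pow_scaleC[OF assms])
qed

lemma exp_remainder_shift:
  assumes "clinear_op A"
  shows "exp_remainder m z A = (z ^ m / fact m) *\<^sub>C id_blinfun + (A o\<^sub>L exp_remainder (Suc m) z A)"
    "exp_remainder m z A = (z ^ m / fact m) *\<^sub>C id_blinfun + (exp_remainder (Suc m) z A o\<^sub>L A)"
  unfolding exp_remainder_def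
  using op_series_shift[OF summable_exp_coeff[of z m "norm A + 1"] _ _ assms]
  by (simp_all add: add_nonneg_pos)

lemma op_exp_first_order: "clinear_op A \<Longrightarrow> op_exp (z *\<^sub>C A) = id_blinfun + (A o\<^sub>L exp_remainder 1 z A)"
  using exp_remainder_shift(1)[of A 0 z] by (simp add: op_exp_scaleC scaleC_blinfun_one)

text \<open>One factor \<open>A\<close> is split off on the left and the second on the right, which
  puts the quadratic remainder into the form A E A.\<close>

lemma op_exp_second_order:
  assumes "clinear_op A"
  shows "op_exp (z *\<^sub>C A) = id_blinfun + z *\<^sub>C A + (A o\<^sub>L exp_remainder 2 z A o\<^sub>L A)"
  using op_exp_first_order[OF assms, of z] exp_remainder_shift(2)[OF assms, of 1 z]
  by (simp add: compose.add_right scaleC_compose_right[OF assms] compose_assoc numeral_2_eq_2)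

lemma adjoint_pair_exp:
  assumes "adjoint_pair A A"
  shows "adjoint_pair (op_exp (z *\<^sub>C A)) (op_exp (cnj z *\<^sub>C A))"
  using adjoint_pair_op_series[OF summable_exp_coeff[of z 0] order_refl assms]
  unfolding op_exp_scaleC[OF adjoint_pair_clinear[OF assms]] exp_remainder_def by simp

lemma op_exp_inverse:
  assumes "clinear_op A"
  shows "op_exp (z *\<^sub>C A) o\<^sub>L op_exp ((- z) *\<^sub>C A) = id_blinfun"
proof -
  \<comment> \<open>By the binomial theorem this Cauchy product coefficient is (z - z)^m /
    m!.\<close>
  have *: "(\<Sum>i\<le>m. z ^ i / fact i * ((- z) ^ (m - i) / fact (m - i))) = (if m = 0 then 1 else 0)" for m
    using exp_series_add_commuting[of z "- z" m]
    by (simp add: scaleR_conv_of_real divide_inverse mult_ac power_0_left split: if_splits)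
  have "op_exp (z *\<^sub>C A) o\<^sub>L op_exp ((- z) *\<^sub>C A) = op_series (\<lambda>m. if m = 0 then 1 else 0) A"
    unfolding op_exp_scaleC[OF assms] exp_remainder_def
    using op_series_mult[OF summable_exp_coeff[of z 0] summable_exp_coeff[of "-z" 0] order_refl assms] *
    by simp
  also have "\<dots> = (\<Sum>m\<in>{0}. (if m = 0 then 1 else 0) *\<^sub>C op_pow A m)"
    unfolding op_series_def by (rule suminf_finite) (auto simp: scaleC_blinfun.zero_left)
  finally show ?thesis
    by (simp add: scaleC_blinfun_one)
qed

lemma unitary_exp:
  assumes "adjoint_pair A A"
  shows "unitary_op (op_exp ((\<i> * complex_of_real s) *\<^sub>C A))"
    "op_inverse (op_exp ((\<i> * complex_of_real s) *\<^sub>C A)) = op_exp ((- (\<i> * complex_of_real s)) *\<^sub>C A)"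
proof -
  let ?z = "\<i> * complex_of_real s"
  have "adjoint_pair (op_exp (?z *\<^sub>C A)) (op_exp ((- ?z) *\<^sub>C A))"
    using adjoint_pair_exp[OF assms, of ?z] by simp
  moreover have "op_exp (?z *\<^sub>C A) o\<^sub>L op_exp ((- ?z) *\<^sub>C A) = id_blinfun"
    by (intro op_exp_inverse adjoint_pair_clinear[OF assms])
  moreover have "op_exp ((- ?z) *\<^sub>C A) o\<^sub>L op_exp (?z *\<^sub>C A) = id_blinfun"
    using op_exp_inverse[OF adjoint_pair_clinear[OF assms], of "- ?z"] by simp
  ultimately show "unitary_op (op_exp (?z *\<^sub>C A))" "op_inverse (op_exp (?z *\<^sub>C A)) = op_exp ((- ?z) *\<^sub>C A)"
    by (fact unitary_opI)+
qed

section \<open>Square roots of positive operators through the Taylor series of sqrt(1 - x)\<close>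

definition sqrt_coeff :: "nat \<Rightarrow> real"
  where "sqrt_coeff k = (1 / 2 gchoose k) * (- 1) ^ k"

text \<open>Partial sums are the coefficients of sqrt(1 - x) / (1 - x) = (1 - x)^(-1/2), which are
  nonnegative. Both the convergence at radius 1 and the positivity of the root rest on this
  sign.\<close>

lemma sqrt_coeff_sum: "(\<Sum>k\<le>n. sqrt_coeff k) \<ge> 0"
proof -
  have "(\<Sum>k\<le>n. sqrt_coeff k) = pochhammer (1 / 2) n / fact n"
    unfolding sqrt_coeff_def gbinomial_sum_lower_neg
    by (simp add: gbinomial_pochhammer flip: power_mult_distrib mult.assoc)
  then show ?thesis
    by (simp add: pochhammer_nonneg)
qed

lemma sqrt_coeff_0 [simp]: "sqrt_coeff 0 = 1"
  by (simp add: sqrt_coeff_def)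

text \<open>The rising factorial of -1/2 contains exactly one negative factor.\<close>

lemma sqrt_coeff_Suc: "sqrt_coeff (Suc k) \<le> 0"
proof -
  have "sqrt_coeff (Suc k) = pochhammer (- 1 / 2) (Suc k) / fact (Suc k)"
    by (simp add: sqrt_coeff_def gbinomial_pochhammer flip: power_mult_distrib)
  also have "\<dots> = - (pochhammer (1 / 2) k / (2 * fact (Suc k)))"
    by (simp add: pochhammer_rec)
  also have "\<dots> \<le> 0"
    using pochhammer_nonneg[of "1 / 2 :: real" k] by simp
  finally show ?thesis .
qed

text \<open>After the leading 1 all coefficients are nonpositive while the partial sums stay
  nonnegative, so the absolute values of these later coefficients add up to at most 1. The boundary
  radius matters: the argument of the series is only known to have norm at most 1.\<close>

lemma sqrt_coeff_summable: "summable (\<lambda>k. \<bar>sqrt_coeff k\<bar>)"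
proof -
  have "summable (\<lambda>k. - sqrt_coeff (Suc k))"
  proof (rule summableI_nonneg_bounded)
    show "0 \<le> - sqrt_coeff (Suc n)" for n
      using sqrt_coeff_Suc[of n] by simp
    show "(\<Sum>k<n. - sqrt_coeff (Suc k)) \<le> 1" for n
    proof -
      have "0 \<le> (\<Sum>k<Suc n. sqrt_coeff k)"
        using sqrt_coeff_sum[of n] by (simp add: lessThan_Suc_atMost)
      also have "\<dots> = 1 + (\<Sum>k<n. sqrt_coeff (Suc k))"
        by (subst sum.lessThan_Suc_shift) simp
      finally show ?thesis
        by (simp add: sum_negf)
    qed
  qed
  moreover have "\<bar>sqrt_coeff (Suc k)\<bar> = - sqrt_coeff (Suc k)" for k
    using sqrt_coeff_Suc[of k] by simp
  ultimately show ?thesis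
    by (subst summable_Suc_iff[symmetric]) simp
qed

text \<open>These are the coefficients of sqrt(1 - x)^2 = 1 - x; Vandermonde's identity reduces the
  sum to 1 choose m, up to sign.\<close>

lemma sqrt_coeff_convolution:
  "(\<Sum>i\<le>m. sqrt_coeff i * sqrt_coeff (m - i)) = (if m = 0 then 1 else if m = 1 then -1 else 0)"
proof -
  have "(\<Sum>i\<le>m. sqrt_coeff i * sqrt_coeff (m - i)) =
      (- 1) ^ m * (\<Sum>i\<le>m. (1 / 2 gchoose i) * (1 / 2 gchoose (m - i)))"
    unfolding sum_distrib_left
  proof (rule sum.cong)
    fix i assume "i \<in> {..m}"
    then have "(- 1 :: real) ^ i * (- 1) ^ (m - i) = (- 1) ^ m"
      by (simp flip: power_add)
    then show "sqrt_coeff i * sqrt_coeff (m - i) = (- 1) ^ m * ((1 / 2 gchoose i) * (1 / 2 gchoose (m - i)))"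
      unfolding sqrt_coeff_def by (simp only: mult_ac) (simp only: mult.assoc[symmetric])
  qed simp
  also have "(\<Sum>i\<le>m. (1 / 2 gchoose i) * (1 / 2 gchoose (m - i))) = (1 gchoose m :: real)"
    using gbinomial_Vandermonde[of "1 / 2 :: real" "1 / 2" m] by (simp add: atLeast0AtMost)
  also have "(1 gchoose m :: real) = of_nat (1 choose m)"
    by (simp add: binomial_gbinomial)
  finally show ?thesis
    by (cases m; cases "m - 1") (auto simp: binomial_eq_0)
qed

text \<open>With S = C (1 - X) the root is sqrt C times the series of sqrt(1 - x) at
  \<open>X\<close>, and the sign pattern of the coefficients makes it positive.\<close>

lemma positive_sqrt_exists:
  fixes S :: "'a::chilbert_space \<Rightarrow>\<^sub>L 'a"
  assumes S: "adjoint_pair S S" and "C > 0" and contr: "norm (id_blinfun - S /\<^sub>R C) \<le> 1"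
  obtains M where "positive_op M" "M o\<^sub>L M = S"
proof -
  define X where "X = id_blinfun - S /\<^sub>R C"
  have X: "adjoint_pair X X"
    unfolding X_def by (intro adjoint_pair_diff adjoint_pair_id adjoint_pair_scaleR S)
  have nX: "norm X \<le> 1"
    using contr by (simp add: X_def)
  let ?c = "\<lambda>k. complex_of_real (sqrt_coeff k)"
  have c: "summable (\<lambda>k. cmod (?c k) * 1 ^ k)"
    by (simp add: sqrt_coeff_summable)
  define R where "R = op_series ?c X"
  have R: "adjoint_pair R R"
    using adjoint_pair_op_series[OF c nX X] by (simp add: R_def)
  have "(\<Sum>i\<le>m. ?c i * ?c (m - i)) = complex_of_real (if m = 0 then 1 else if m = 1 then -1 else 0)" for m
    unfolding sqrt_coeff_convolution[symmetric] by simp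
  then have "R o\<^sub>L R = op_series (\<lambda>m. complex_of_real (if m = 0 then 1 else if m = 1 then -1 else 0)) X"
    unfolding R_def op_series_mult[OF c c nX adjoint_pair_clinear[OF X]] by simp
  also have "\<dots> = (\<Sum>m\<in>{0, 1}. complex_of_real (if m = 0 then 1 else if m = 1 then -1 else 0) *\<^sub>C op_pow X m)"
    unfolding op_series_def by (rule suminf_finite) (auto simp: scaleC_blinfun.zero_left)
  also have "\<dots> = S /\<^sub>R C"
    by (simp add: X_def scaleC_blinfun_one scaleC_blinfun.minus_left)
  finally have RR: "R o\<^sub>L R = S /\<^sub>R C" .
  have "0 \<le> Re (cinner (R v) v)" for v
  proof -
    have "(\<lambda>k. Re (cinner (?c k *\<^sub>C op_pow X k v) v)) sums Re (cinner (R v) v)"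
      unfolding R_def
      by (intro bounded_linear.sums[OF bounded_linear_Re] bounded_linear.sums[OF cinner.bounded_linear_left]
          op_series_apply_sums[OF c nX])
    then have lim: "(\<lambda>n. \<Sum>k<Suc n. sqrt_coeff k * Re (cinner (op_pow X k v) v)) \<longlonglongrightarrow> Re (cinner (R v) v)"
      unfolding sums_def by (subst (asm) filterlim_sequentially_Suc[symmetric]) (simp add: cinner_scaleC_left)
    have "0 \<le> (\<Sum>k<Suc n. sqrt_coeff k * Re (cinner (op_pow X k v) v))" for n
    proof -
      \<comment> \<open>For \<open>k > 0\<close> the coefficient is nonpositive and the pairing is
        at most (norm v)^2; for \<open>k = 0\<close> there is equality. Summing leaves a nonnegative
        partial sum of coefficients times (norm v)^2.\<close>
      have le: "sqrt_coeff k * (norm v)\<^sup>2 \<le> sqrt_coeff k * Re (cinner (op_pow X k v) v)" for k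
      proof (cases k)
        case 0
        then show ?thesis
          by (simp add: cinner_self)
      next
        case (Suc j)
        have "Re (cinner (op_pow X k v) v) \<le> norm (op_pow X k v) * norm v"
          using complex_Re_le_cmod cinner_Cauchy_Schwarz order_trans by blast
        also have "\<dots> \<le> (1 * norm v) * norm v"
          using norm_op_pow_le[OF nX, of k]
          by (intro mult_right_mono order_trans[OF norm_blinfun]) auto
        finally show ?thesis
          unfolding Suc using sqrt_coeff_Suc[of j]
          by (intro mult_left_mono_neg) (simp_all add: power2_eq_square)
      qed
      have "0 \<le> (\<Sum>k<Suc n. sqrt_coeff k) * (norm v)\<^sup>2"
        using sqrt_coeff_sum[of n] by (simp only: lessThan_Suc_atMost mult_nonneg_nonneg zero_le_power2)
      also have "\<dots> \<le> (\<Sum>k<Suc n. sqrt_coeff k * Re (cinner (op_pow X k v) v))"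
        unfolding sum_distrib_right by (intro sum_mono le)
      finally show ?thesis .
    qed
    then show ?thesis
      by (intro LIMSEQ_le_const[OF lim]) blast
  qed
  then have "positive_op (sqrt C *\<^sub>R R)"
    using \<open>C > 0\<close> adjoint_pair_scaleR[OF R, of "sqrt C"]
    by (simp add: positive_op_def self_adjoint_iff op_simps cinner.scaleR_left)
  moreover have "(sqrt C *\<^sub>R R) o\<^sub>L (sqrt C *\<^sub>R R) = S"
  proof -
    have "sqrt C * (sqrt C * inverse C) = 1"
      using \<open>C > 0\<close> by (simp add: field_simps)
    then show ?thesis
      by (simp add: compose.scaleR_left compose.scaleR_right RR)
  qed
  ultimately show ?thesis
    by (rule that)
qed

lemma modulus_exists:
  assumes T: "adjoint_pair T T'"
  obtains M where "is_modulus M T" "M o\<^sub>L M = T' o\<^sub>L T"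
proof -
  \<comment> \<open>Large enough that T' T / C is at most 1, and positive even if
    \<open>T = 0\<close>.\<close>
  define C where "C = (norm T)\<^sup>2 + 1"
  have "C > 0"
    by (simp add: C_def add_nonneg_pos)
  have S: "adjoint_pair (T' o\<^sub>L T) (T' o\<^sub>L T)"
    by (intro adjoint_pair_compose T adjoint_pair_sym[OF T])
  have "norm (id_blinfun - (T' o\<^sub>L T) /\<^sub>R C) \<le> 1"
  proof (rule norm_blinfun_bound)
    fix v
    have "norm (T' (T v)) \<le> norm T * norm (T v)"
      by (rule order_trans[OF norm_blinfun mult_right_mono[OF norm_adjoint_le[OF T]]]) simp
    then have "(norm (T' (T v)))\<^sup>2 \<le> (norm T * norm (T v))\<^sup>2"
      by (intro power_mono) auto
    also have "\<dots> \<le> C * (norm (T v))\<^sup>2"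
      by (simp add: power_mult_distrib C_def mult_right_mono)
    finally have 1: "(norm (T' (T v)))\<^sup>2 / C \<le> (norm (T v))\<^sup>2"
      using \<open>C > 0\<close> by (simp add: field_simps)
    \<comment> \<open>Expanding the square gives (norm v)^2 minus a quantity that the estimate just
      proved makes nonnegative.\<close>
    have "(norm ((id_blinfun - (T' o\<^sub>L T) /\<^sub>R C) v))\<^sup>2
        = (norm v)\<^sup>2 - 2 * Re (cinner v (T' (T v))) / C + (norm (T' (T v)))\<^sup>2 / C\<^sup>2"
      using \<open>C > 0\<close> by (simp add: op_simps norm_diff_square cinner.scaleR_right power_mult_distrib
          divide_inverse power_inverse mult_ac)
    also have "cinner v (T' (T v)) = complex_of_real ((norm (T v))\<^sup>2)"
      by (simp only: adjoint_pairD[OF T, symmetric] cinner_self)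
    also have "(norm v)\<^sup>2 - 2 * Re (complex_of_real ((norm (T v))\<^sup>2)) / C + (norm (T' (T v)))\<^sup>2 / C\<^sup>2
        = (norm v)\<^sup>2 - ((norm (T v))\<^sup>2 + ((norm (T v))\<^sup>2 - (norm (T' (T v)))\<^sup>2 / C)) / C"
      using \<open>C > 0\<close> by (simp add: field_simps power2_eq_square)
    also have "\<dots> \<le> (norm v)\<^sup>2"
    proof -
      have "0 \<le> (norm (T v))\<^sup>2 + ((norm (T v))\<^sup>2 - (norm (T' (T v)))\<^sup>2 / C)"
        using 1 by (intro add_nonneg_nonneg) simp_all
      from divide_nonneg_pos[OF this \<open>C > 0\<close>] show ?thesis
        by linarith
    qed
    finally have "norm ((id_blinfun - (T' o\<^sub>L T) /\<^sub>R C) v) \<le> norm v"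
      by (rule power2_le_imp_le) simp
    then show "norm ((id_blinfun - (T' o\<^sub>L T) /\<^sub>R C) v) \<le> 1 * norm v"
      by simp
  qed simp
  from positive_sqrt_exists[OF S \<open>C > 0\<close> this] obtain M where "positive_op M" "M o\<^sub>L M = T' o\<^sub>L T"
    by blast
  then show ?thesis
    using that[of M] adjoint_pairD[OF T] adjoint_pairD[OF adjoint_pair_sym[OF T]]
    by (simp add: is_modulus_def)
qed

section \<open>Trace class from matrix elements, in a separable space\<close>

lemma separable_dense_sequence:
  assumes "separable_space (euclidean :: 'a::chilbert_space topology)"
  obtains d :: "nat \<Rightarrow> 'a::chilbert_space" where "closure (range d) = UNIV"
proof -
  obtain C :: "'a set" where C: "countable C" "closure C = UNIV"
    using assms by (auto simp: separable_space_def euclidean_closure_of)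
  then have "C \<noteq> {}"
    by auto
  then show ?thesis
    using that[of "from_nat_into C"] C by simp
qed

lemma dense_orthogonal:
  fixes d :: "nat \<Rightarrow> 'a::chilbert_space"
  assumes d: "closure (range d) = UNIV" and v: "\<And>k. cinner v (d k) = 0"
  shows "v = 0"
proof -
  have "closed {w. cinner v w = 0}"
    by (intro closed_Collect_eq continuous_intros cinner.continuous_on)
  then have "closure (range d) \<subseteq> {w. cinner v w = 0}"
    by (intro closure_minimal) (auto simp: v)
  then have "cinner v v = 0"
    using d by blast
  then show ?thesis
    by (simp add: cinner_self)
qed

text \<open>The basis is adapted to \<open>|T|\<close>: on basis vectors \<open>b = |T| c\<close> the vectors \<open>T c\<close> are again
  orthonormal and \<open>\<langle>|T| b, b\<rangle> = \<langle>T b, T c\<rangle>\<close>, which replaces the polar decomposition.\<close>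

lemma nuclear_trace_class:
  fixes T :: "'a::chilbert_space \<Rightarrow>\<^sub>L 'a"
  assumes sep: "separable_space (euclidean :: 'a topology)"
    and T: "adjoint_pair T T'" and nuc: "nuclear_op T"
  shows "trace_class T"
proof -
  obtain d :: "nat \<Rightarrow> 'a" where d: "closure (range d) = UNIV"
    by (rule separable_dense_sequence[OF sep])
  obtain M where M: "is_modulus M T" "M o\<^sub>L M = T' o\<^sub>L T"
    by (rule modulus_exists[OF T])
  have MM: "cinner (M (M x)) y = cinner (T x) (T y)" for x y
    using M(1) by (simp add: is_modulus_def)
  have adjM: "adjoint_pair M M"
    using M(1) by (simp add: is_modulus_def positive_op_def self_adjoint_iff)
  \<comment> \<open>Orthonormalising the vectors M d_k stays inside the range of \<open>M\<close>
    itself, not merely its closure; this is what provides the preimages \<open>c b\<close>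
    below.\<close>
  define E where "E = gs_set (\<lambda>k. M (d k))"
  have E: "orthonormal_family (\<lambda>b. b) E"
    unfolding E_def by (rule gs_set_orthonormal)
  obtain B where B: "orthonormal_basis B" "E \<subseteq> B"
    by (rule orthonormal_basis_extend[OF E])
  \<comment> \<open>Such a \<open>b\<close> is orthogonal to all M d_k, so M b is orthogonal to the
    dense sequence d_k.\<close>
  have outside: "M b = 0" if "b \<in> B - E" for b
  proof (rule dense_orthogonal[OF d])
    fix k
    have "cinner b e = 0" if "e \<in> E" for e
      using orthonormal_familyD[OF orthonormal_basis_family[OF B(1)], of b e] \<open>b \<in> B - E\<close> that B(2)
      by auto
    then have "cinner b (M (d k)) = 0"
      unfolding E_def by (rule gs_set_orthogonal)
    then show "cinner (M b) (d k) = 0"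
      by (simp add: adjoint_pairD[OF adjM])
  qed
  have "E \<subseteq> range (blinfun_apply M)"
  proof -
    have "gs_vec (\<lambda>k. M (d k)) n \<in> range (blinfun_apply M)" for n
    proof (rule gs_range(2))
      show "0 \<in> range (blinfun_apply M)"
        by (rule range_eqI[of _ _ 0]) simp
      show "u + v \<in> range (blinfun_apply M)" if "u \<in> range (blinfun_apply M)" "v \<in> range (blinfun_apply M)" for u v
        using that by (auto simp flip: blinfun.add_right)
      show "c *\<^sub>C u \<in> range (blinfun_apply M)" if "u \<in> range (blinfun_apply M)" for c u
        using that by (auto simp flip: clinear_opD[OF adjoint_pair_clinear[OF adjM]])
    qed simp
    then show ?thesis
      by (auto simp: E_def gs_set_def)
  qed
  then obtain c where c: "\<And>b. b \<in> E \<Longrightarrow> M (c b) = b"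
    by (metis f_inv_into_f subsetD)
  have "orthonormal_family (\<lambda>b. T (c b)) E"
    unfolding orthonormal_family_def
  proof (intro ballI)
    fix b b' assume "b \<in> E" "b' \<in> E"
    then show "cinner (T (c b)) (T (c b')) = (if b = b' then 1 else 0)"
      using orthonormal_familyD[OF E, of b b'] by (simp add: MM[symmetric] c adjoint_pairD[OF adjM])
  qed
  then have "(\<lambda>b. cmod (cinner (T b) (T (c b)))) summable_on E"
    using nuc E by (simp add: nuclear_op_def)
  then have "(\<lambda>b. Re (cinner (T b) (T (c b)))) summable_on E"
    by (intro summable_on_Re) (rule abs_summable_summable)
  moreover have "cinner (T b) (T (c b)) = cinner (M b) b" if "b \<in> E" for b
    unfolding MM[symmetric] adjoint_pairD[OF adjM, of "M b"] by (simp add: c that)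
  ultimately have "(\<lambda>b. Re (cinner (M b) b)) summable_on E"
    by (simp cong: summable_on_cong)
  then have "(\<lambda>b. Re (cinner (M b) b)) summable_on B"
    by (rule summable_on_cong_neutral[THEN iffD1, rotated -1]) (use B(2) outside in auto)
  then show ?thesis
    using M(1) B(1) adjoint_pair_clinear[OF T] unfolding trace_class_def by blast
qed

section \<open>Cayley transforms of compressions\<close>

lemma strong_limit_dense:
  fixes F :: "nat \<Rightarrow> 'a::real_normed_vector \<Rightarrow>\<^sub>L 'b::real_normed_vector" and X :: "'a \<Rightarrow>\<^sub>L 'b"
  assumes K: "\<And>n. norm (F n) \<le> K" and D: "closure D = UNIV"
    and lim: "\<And>d. d \<in> D \<Longrightarrow> (\<lambda>n. F n d) \<longlonglongrightarrow> X d"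
  shows "(\<lambda>n. F n v) \<longlonglongrightarrow> X v"
proof (rule metric_LIMSEQ_I)
  fix \<epsilon> :: real assume "\<epsilon> > 0"
  \<comment> \<open>K + norm X bounds the difference \<open>F n - X\<close>; the \<open>+ 1\<close>
    makes \<open>L\<close> positive, so that the tolerance can be divided by it.\<close>
  define L where "L = K + norm X + 1"
  have "0 \<le> K"
    by (rule order_trans[OF norm_ge_zero K])
  then have "L > 0"
    by (simp add: L_def add_nonneg_pos)
  then have "\<epsilon> / (2 * L) > 0"
    using \<open>\<epsilon> > 0\<close> by simp
  moreover have "v \<in> closure D"
    using D by simp
  ultimately obtain d where d: "d \<in> D" "dist d v < \<epsilon> / (2 * L)"
    unfolding closure_approachable by blast
  have small: "L * norm (v - d) < \<epsilon> / 2"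
    using d(2) \<open>L > 0\<close> by (simp add: dist_norm norm_minus_commute field_simps)
  obtain N where N: "\<And>n. n \<ge> N \<Longrightarrow> dist (F n d) (X d) < \<epsilon> / 2"
    using metric_LIMSEQ_D[OF lim[OF d(1)], of "\<epsilon> / 2"] \<open>\<epsilon> > 0\<close> by auto
  have "dist (F n v) (X v) < \<epsilon>" if "n \<ge> N" for n
  proof -
    have "norm (F n - X) \<le> L"
      using norm_triangle_ineq4[of "F n" X] K[of n] by (simp add: L_def)
    then have "norm ((F n - X) (v - d)) \<le> L * norm (v - d)"
      by (intro order_trans[OF norm_blinfun] mult_right_mono) simp_all
    moreover have "F n v - X v = (F n - X) (v - d) + (F n d - X d)"
      by (simp add: op_simps)
    ultimately show ?thesis
      using small N[OF that] norm_triangle_ineq[of "(F n - X) (v - d)" "F n d - X d"]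
      by (simp add: dist_norm)
  qed
  then show "\<exists>N. \<forall>n\<ge>N. dist (F n v) (X v) < \<epsilon>"
    by blast
qed

text \<open>Isometry turns the error of the inverses at \<open>v\<close> into the error of
  \<open>V n\<close> at the fixed vector \<open>op_inverse W v\<close>; for unitaries, strong
  convergence thus includes that of the adjoints.\<close>

lemma strong_star_unitary:
  assumes V: "\<And>n. unitary_op (V n)" and W: "unitary_op W" and lim: "\<And>v. (\<lambda>n. V n v) \<longlonglongrightarrow> W v"
  shows "strong_star V W"
proof (rule strong_starI)
  show "adjoint_pair (V n) (op_inverse (V n))" "norm (V n) \<le> 1" for n
    by (intro unitary_op_adjoint norm_unitary_le V)+
  show "adjoint_pair W (op_inverse W)"
    by (intro unitary_op_adjoint W)
  show "(\<lambda>n. op_inverse (V n) v) \<longlonglongrightarrow> op_inverse W v" for v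
  proof -
    have eq: "norm (op_inverse (V n) v - op_inverse W v) = norm (V n (op_inverse W v) - v)" for n
      using unitary_op_norm[OF V, of n "op_inverse (V n) v - op_inverse W v"]
      by (simp add: op_simps unitary_op_inverse_apply[OF V] norm_minus_commute)
    have "(\<lambda>n. norm (V n (op_inverse W v) - v)) \<longlonglongrightarrow> 0"
      using lim[of "op_inverse W v"] unitary_op_inverse_apply[OF W]
      by (intro tendsto_norm_zero[OF LIM_zero]) simp
    then show ?thesis
      unfolding eq[symmetric] by (rule LIM_zero_cancel[OF tendsto_norm_zero_cancel])
  qed
qed (rule lim)

lemma cinner_scaleC_unimodular:
  fixes x y :: "'a::chilbert_space"
  assumes "cmod c = 1"
  shows "cinner (c *\<^sub>C x) (c *\<^sub>C y) = cinner x y"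
proof -
  have "cinner (c *\<^sub>C x) (c *\<^sub>C y) = (c * cnj c) * cinner x y"
    by (simp add: cinner_scaleC_left cinner_scaleC_right)
  also have "c * cnj c = 1"
    using complex_norm_square[of c] assms by simp
  finally show ?thesis
    by simp
qed

abbreviation imaginary_shift :: "('a::chilbert_space \<Rightarrow>\<^sub>L 'a) \<Rightarrow> 'a \<Rightarrow>\<^sub>L 'a"
  where "imaginary_shift K \<equiv> \<i> *\<^sub>C id_blinfun + K"

lemma cinner_self_adjoint_real:
  assumes "adjoint_pair K K"
  shows "Im (cinner x (K x)) = 0"
proof -
  have "cinner x (K x) = cnj (cinner x (K x))"
    using adjoint_pairD[OF assms, of x x] cinner_commute[of x "K x"] by argo
  from arg_cong[OF this, of Im] show ?thesis
    by simp
qed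

text \<open>The pairing of \<open>x\<close> with \<open>K x\<close> is real, so \<open>x\<close> and
  i K x are orthogonal for the real inner product and no cross term appears. General coefficients
  serve the contraction estimate, the special case the bound on the inverse of i + K.\<close>

lemma norm_imaginary_shift:
  assumes "adjoint_pair K K"
  shows "(norm (a *\<^sub>R x + b *\<^sub>R \<i> *\<^sub>C K x))\<^sup>2 = a\<^sup>2 * (norm x)\<^sup>2 + b\<^sup>2 * (norm (K x))\<^sup>2"
    "(norm (imaginary_shift K x))\<^sup>2 = (norm x)\<^sup>2 + (norm (K x))\<^sup>2"
proof -
  have "Re (cinner (a *\<^sub>R x) (b *\<^sub>R \<i> *\<^sub>C K x)) = 0"
    using cinner_self_adjoint_real[OF assms, of x]
    by (simp add: cinner_scaleC_right cinner.scaleR_left cinner.scaleR_right)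
  then show "(norm (a *\<^sub>R x + b *\<^sub>R \<i> *\<^sub>C K x))\<^sup>2 = a\<^sup>2 * (norm x)\<^sup>2 + b\<^sup>2 * (norm (K x))\<^sup>2"
    by (simp add: norm_add_square norm_scaleC power_mult_distrib)
  have "Re (cinner (\<i> *\<^sub>C x) (K x)) = 0"
    using cinner_self_adjoint_real[OF assms, of x] by (simp add: cinner_scaleC_left)
  then show "(norm (imaginary_shift K x))\<^sup>2 = (norm x)\<^sup>2 + (norm (K x))\<^sup>2"
    by (simp add: norm_add_square norm_scaleC plus_blinfun.rep_eq)
qed

text \<open>A damped iteration for (i + K) x = y is a contraction, by the orthogonality in
  \<open>norm_imaginary_shift\<close>; its fixed point solves the equation.\<close>

lemma surj_imaginary_shift:
  fixes K :: "'a::chilbert_space \<Rightarrow>\<^sub>L 'a"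
  assumes K: "adjoint_pair K K"
  shows "surj (blinfun_apply (imaginary_shift K))"
  unfolding surj_def
proof (intro allI)
  fix y
  \<comment> \<open>Minimises (1 - t)^2 + t^2 (norm K)^2; the minimum is 1 - t, the square of the
    contraction constant.\<close>
  define t where "t = 1 / (1 + (norm K)\<^sup>2)"
  have t: "t > 0" "t \<le> 1" "t * (1 + (norm K)\<^sup>2) = 1"
    using add_pos_nonneg[of 1 "(norm K)\<^sup>2"] by (auto simp: t_def)
  define f where "f x = x + t *\<^sub>R \<i> *\<^sub>C (imaginary_shift K x - y)" for x
  have "\<exists>!x. f x = x"
  proof (rule banach_fix_type[where c = "sqrt (1 - t)"])
    show "\<forall>x x'. dist (f x) (f x') \<le> sqrt (1 - t) * dist x x'"
    proof (intro allI)
      fix x x' :: 'a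
      let ?u = "x - x'"
      have "f x - f x' = (1 - t) *\<^sub>R ?u + t *\<^sub>R \<i> *\<^sub>C K ?u"
        by (simp add: f_def op_simps scaleC.add_right scaleC.diff_right scaleC_scaleC scaleC.minus_left
            algebra_simps)
      then have "(dist (f x) (f x'))\<^sup>2 = (1 - t)\<^sup>2 * (norm ?u)\<^sup>2 + t\<^sup>2 * (norm (K ?u))\<^sup>2"
        by (simp only: dist_norm norm_imaginary_shift(1)[OF K])
      also have "\<dots> \<le> (1 - t)\<^sup>2 * (norm ?u)\<^sup>2 + t\<^sup>2 * (norm K * norm ?u)\<^sup>2"
        by (intro add_left_mono mult_left_mono power_mono norm_blinfun) simp_all
      also have "\<dots> = (1 - 2 * t + t * (t * (1 + (norm K)\<^sup>2))) * (norm ?u)\<^sup>2"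
        by (simp add: power2_eq_square algebra_simps)
      also have "\<dots> = (sqrt (1 - t) * dist x x')\<^sup>2"
        using t by (simp add: power_mult_distrib dist_norm)
      finally show "dist (f x) (f x') \<le> sqrt (1 - t) * dist x x'"
        by (rule power2_le_imp_le) (use t in simp)
    qed
  qed (use t in auto)
  then obtain x where "f x = x"
    by blast
  then have "norm (t *\<^sub>R \<i> *\<^sub>C (imaginary_shift K x - y)) = 0"
    by (simp only: f_def add_cancel_left_right norm_zero)
  then have "imaginary_shift K x = y"
    using t(1) by (simp only: norm_scaleR norm_scaleC) simp
  then show "\<exists>x. y = imaginary_shift K x"
    by blast
qed

text \<open>Every vector has the form (i + K) x, and there the transform is explicit; linearity and
  isometry are checked in this parametrisation, and surjectivity comes from i - K.\<close>

lemma
  fixes K :: "'a::chilbert_space \<Rightarrow>\<^sub>L 'a"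
  assumes K: "adjoint_pair K K"
  shows cayley_U_apply: "cayley_U \<phi> K (imaginary_shift K x) = cis \<phi> *\<^sub>C (\<i> *\<^sub>C x - K x)"
    and cayley_U_unitary: "unitary_op (cayley_U \<phi> K)"
proof -
  let ?T = "imaginary_shift K"
  have K': "adjoint_pair (- K) (- K)"
    using adjoint_pair_scaleR[OF K, of "-1"] by simp
  have clin: "clinear_op K"
    by (rule adjoint_pair_clinear[OF K])
  have surj: "surj (blinfun_apply ?T)"
    by (rule surj_imaginary_shift[OF K])
  have "norm x \<le> norm (?T x)" for x
    by (rule power2_le_imp_le) (simp_all add: norm_imaginary_shift(2)[OF K])
  note inv = op_inverse_exists(1)[OF surj this]
  then have inv_apply: "op_inverse ?T (?T x) = x" for x
    by (metis blinfun_apply_blinfun_compose blinfun_apply_id_blinfun)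
  show app: "cayley_U \<phi> K (?T x) = cis \<phi> *\<^sub>C (\<i> *\<^sub>C x - K x)" for x
    by (simp add: cayley_U_def inv_apply minus_blinfun.rep_eq del: plus_blinfun.rep_eq)
  have "cayley_U \<phi> K (c *\<^sub>C y) = c *\<^sub>C cayley_U \<phi> K y" for c y
  proof -
    obtain x where x: "y = ?T x"
      using surj by (metis surjD)
    have "c *\<^sub>C ?T x = ?T (c *\<^sub>C x)"
      by (simp add: op_simps clinear_opD[OF clin] scaleC_add_right scaleC_left_commute)
    then show ?thesis
      unfolding x by (simp only: app)
        (simp add: clinear_opD[OF clin] scaleC.diff_right scaleC_scaleC mult_ac)
  qed
  moreover have "surj (blinfun_apply (cayley_U \<phi> K))"
    unfolding surj_def
  proof (intro allI)
    fix y
    \<comment> \<open>\<open>- K\<close> is self-adjoint too, and its shift i - K is the numerator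
      of the transform.\<close>
    obtain x where "cis (- \<phi>) *\<^sub>C y = imaginary_shift (- K) x"
      using surj_imaginary_shift[OF K'] by (metis surjD)
    then have "cis \<phi> *\<^sub>C cis (- \<phi>) *\<^sub>C y = cayley_U \<phi> K (?T x)"
      by (simp only: app) (simp add: op_simps)
    then have "cayley_U \<phi> K (?T x) = y"
      by (simp add: scaleC_scaleC cis_mult)
    then show "\<exists>x. y = cayley_U \<phi> K x"
      by blast
  qed
  moreover have "cinner (cayley_U \<phi> K y) (cayley_U \<phi> K y') = cinner y y'" for y y'
  proof -
    obtain x x' where x: "y = ?T x" "y' = ?T x'"
      using surj by (metis surjD)
    show ?thesis
      unfolding x app cinner_scaleC_unimodular[OF norm_cis]
      by (simp add: plus_blinfun.rep_eq cinner_simps adjoint_pairD[OF K] algebra_simps)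
  qed
  ultimately show "unitary_op (cayley_U \<phi> K)"
    by (simp add: unitary_op_def clinear_op_def)
qed

section \<open>The inverse Cayley transform H0, its domain and its compressions\<close>

locale unitary_phase =
  fixes U0 :: "'a::chilbert_space \<Rightarrow>\<^sub>L 'a" and \<phi> :: real
  assumes unitary: "unitary_op U0" and inj: "inj (blinfun_apply (cis \<phi> *\<^sub>C id_blinfun + U0))"
begin

abbreviation W :: "'a \<Rightarrow>\<^sub>L 'a"
  where "W \<equiv> cis (- \<phi>) *\<^sub>C U0"

abbreviation H0 :: "'a \<Rightarrow> 'a"
  where "H0 \<equiv> cayley_H \<phi> U0"

lemma cinner_W: "cinner (W x) (W y) = cinner x y"
  using unitary unfolding blinfun_scaleC_apply cinner_scaleC_unimodular[OF norm_cis]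
  by (simp add: unitary_op_def)

lemma norm_W: "norm (W x) = norm x"
  by (simp add: norm_scaleC unitary_op_norm[OF unitary])

lemma W_scaleC: "W (c *\<^sub>C x) = c *\<^sub>C W x"
  using unitary by (simp add: unitary_op_def clinear_op_def scaleC_left_commute)

lemma plus_W_inj: "inj (blinfun_apply (id_blinfun + W))"
proof (rule injI)
  fix x y
  have "cis \<phi> *\<^sub>C (id_blinfun + W) v = (cis \<phi> *\<^sub>C id_blinfun + U0) v" for v
    by (simp add: op_simps scaleC_add_right scaleC_scaleC cis_mult)
  moreover assume "(id_blinfun + W) x = (id_blinfun + W) y"
  ultimately show "x = y"
    using inj by (metis injD)
qed

lemma cayley_dom_iff: "x \<in> cayley_dom \<phi> U0 \<longleftrightarrow> (\<exists>u. x = u + W u)"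
  by (auto simp: cayley_dom_def image_def op_simps)

text \<open>Injectivity of 1 + W makes \<open>u\<close> a coordinate on the domain; the properties
  of H0 are read off in it.\<close>

lemma H0_apply: "H0 (u + W u) = \<i> *\<^sub>C (u - W u)"
proof -
  have "inv (blinfun_apply (id_blinfun + W)) ((id_blinfun + W) u) = u"
    by (rule inv_f_f[OF plus_W_inj])
  then show ?thesis
    by (simp add: cayley_H_def op_simps)
qed

lemma dom_0: "0 \<in> cayley_dom \<phi> U0"
  unfolding cayley_dom_iff by (intro exI[of _ 0]) simp

lemma dom_add:
  assumes "x \<in> cayley_dom \<phi> U0" "y \<in> cayley_dom \<phi> U0"
  shows "x + y \<in> cayley_dom \<phi> U0" "H0 (x + y) = H0 x + H0 y"
proof -
  obtain u v where uv: "x = u + W u" "y = v + W v"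
    using assms by (auto simp: cayley_dom_iff)
  have eq: "x + y = (u + v) + W (u + v)"
    by (simp add: uv blinfun.add_right scaleC.add_right)
  then show "x + y \<in> cayley_dom \<phi> U0"
    unfolding cayley_dom_iff by blast
  show "H0 (x + y) = H0 x + H0 y"
    unfolding eq unfolding uv H0_apply by (simp add: blinfun.add_right scaleC.add_right scaleC.diff_right)
qed

lemma dom_scaleC:
  assumes "x \<in> cayley_dom \<phi> U0"
  shows "c *\<^sub>C x \<in> cayley_dom \<phi> U0" "H0 (c *\<^sub>C x) = c *\<^sub>C H0 x"
proof -
  obtain u where u: "x = u + W u"
    using assms by (auto simp: cayley_dom_iff)
  have eq: "c *\<^sub>C x = c *\<^sub>C u + W (c *\<^sub>C u)"
    unfolding u W_scaleC by (rule scaleC_add_right)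
  then show "c *\<^sub>C x \<in> cayley_dom \<phi> U0"
    unfolding cayley_dom_iff by blast
  have "H0 (c *\<^sub>C x) = \<i> *\<^sub>C (c *\<^sub>C u - W (c *\<^sub>C u))"
    unfolding eq by (rule H0_apply)
  also have "\<dots> = c *\<^sub>C H0 x"
    unfolding u H0_apply W_scaleC scaleC.diff_right by (simp only: scaleC_left_commute)
  finally show "H0 (c *\<^sub>C x) = c *\<^sub>C H0 x" .
qed

lemma H0_symmetric:
  assumes "x \<in> cayley_dom \<phi> U0" "y \<in> cayley_dom \<phi> U0"
  shows "cinner (H0 x) y = cinner x (H0 y)"
proof -
  obtain u v where uv: "x = u + W u" "y = v + W v"
    using assms by (auto simp: cayley_dom_iff)
  \<comment> \<open>\<open>u'\<close> and \<open>v'\<close> stand for \<open>W u\<close> and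
    \<open>W v\<close>: the diagonal terms cancel because \<open>W\<close> preserves the pairing,
    and the mixed ones agree.\<close>
  have "cinner (\<i> *\<^sub>C (u - u')) (v + v') = cinner (u + u') (\<i> *\<^sub>C (v - v'))"
    if "cinner u' v' = cinner u v" for u' v'
    using that by (simp add: cinner_simps algebra_simps)
  then show ?thesis
    unfolding uv H0_apply by (simp only: cinner_W)
qed

context
  fixes x :: "nat \<Rightarrow> 'a"
  assumes x_dom: "\<And>k. x k \<in> cayley_dom \<phi> U0"
begin

lemma gs_dom: "gs_proj x n v \<in> cayley_dom \<phi> U0" "gs_vec x n \<in> cayley_dom \<phi> U0"
  using gs_range[of x "cayley_dom \<phi> U0", OF x_dom dom_0 dom_add(1) dom_scaleC(1)] by blast+

text \<open>H0 may be unbounded, but each Gram-Schmidt step adds only one line spanned by a vector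
  of the domain. Boundedness is what gives the \<open>Blinfun\<close> in \<open>compress\<close> its
  intended value.\<close>

lemma bounded_linear_H0_gs: "bounded_linear (\<lambda>v. H0 (gs_proj x n v))"
proof (induction n)
  case 0
  have "H0 0 = 0"
    using H0_apply[of 0] by simp
  then show ?case
    by simp
next
  case (Suc n)
  have "H0 (gs_proj x (Suc n) v) = H0 (gs_proj x n v) + cinner v (gs_vec x n) *\<^sub>C H0 (gs_vec x n)" for v
    unfolding gs_proj_Suc plus_blinfun.rep_eq line_projection.rep_eq
    by (simp only: dom_add dom_scaleC gs_dom)
  then show ?case
    using bounded_linear_add[OF Suc bounded_linear_compose[OF scaleC.bounded_linear_left
          cinner.bounded_linear_left], of "gs_vec x n" "H0 (gs_vec x n)"]
    by simp
qed

abbreviation compressed :: "nat \<Rightarrow> 'a \<Rightarrow>\<^sub>L 'a"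
  where "compressed n \<equiv> compress (gs_proj x n) H0"

lemma compressed_apply: "compressed n v = gs_proj x n (H0 (gs_proj x n v))"
  unfolding compress_def
  by (subst bounded_linear_Blinfun_apply)
    (auto intro: bounded_linear_compose[OF blinfun.bounded_linear_right bounded_linear_H0_gs])

lemma compressed_adjoint: "adjoint_pair (compressed n) (compressed n)"
  unfolding adjoint_pair_def compressed_apply
  by (simp add: adjoint_pairD[OF gs_proj_adjoint] H0_symmetric gs_dom)

text \<open>For x_k = (1 + W) u one has (i + H0) x_k = 2i u and (i - H0) x_k = 2i W u. From stage k
  + 1 on the projection fixes x_k, so \<open>?V n\<close> maps i x_k + P_n H0 x_k to e^(i phi) (i
  x_k - P_n H0 x_k). The argument tends to 2i u and the value to 2i U0 u, and isometry of
  \<open>?V n\<close> lets the moving argument be replaced by its limit.\<close>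

lemma cayley_compressed_tendsto:
  assumes P: "\<And>v. (\<lambda>n. gs_proj x n v) \<longlonglongrightarrow> v" and u: "x k = u + W u"
  shows "(\<lambda>n. cayley_U \<phi> (compressed n) u) \<longlonglongrightarrow> U0 u"
proof -
  let ?V = "\<lambda>n. cayley_U \<phi> (compressed n)"
  note V = cayley_U_unitary[OF compressed_adjoint, of \<phi>]
  have "(\<lambda>n. \<i> *\<^sub>C x k + gs_proj x n (H0 (x k))) \<longlonglongrightarrow> \<i> *\<^sub>C x k + H0 (x k)"
    by (intro tendsto_intros P)
  moreover have "\<i> *\<^sub>C x k + H0 (x k) = (2 * \<i>) *\<^sub>C u"
    unfolding u H0_apply by (simp add: scaleC.add_right scaleC.diff_right flip: scaleC_add_left)
  ultimately have f: "(\<lambda>n. \<i> *\<^sub>C x k + gs_proj x n (H0 (x k))) \<longlonglongrightarrow> (2 * \<i>) *\<^sub>C u"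
    by simp
  have lim: "(\<lambda>n. cis \<phi> *\<^sub>C (\<i> *\<^sub>C x k - gs_proj x n (H0 (x k)))) \<longlonglongrightarrow> cis \<phi> *\<^sub>C (\<i> *\<^sub>C x k - H0 (x k))"
    by (intro tendsto_intros scaleC.tendsto P)
  have lim_eq: "cis \<phi> *\<^sub>C (\<i> *\<^sub>C x k - H0 (x k)) = (2 * \<i>) *\<^sub>C U0 u"
  proof -
    have "\<i> *\<^sub>C x k - H0 (x k) = (2 * \<i>) *\<^sub>C W u"
      unfolding u H0_apply by (simp add: scaleC.add_right scaleC.diff_right flip: scaleC_add_left)
    moreover have "cis \<phi> * (2 * \<i> * cis (- \<phi>)) = 2 * \<i> * (cis \<phi> * cis (- \<phi>))"
      by (simp only: mult_ac)
    then have "cis \<phi> * (2 * \<i> * cis (- \<phi>)) = 2 * \<i>"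
      by (simp only: cis_mult) simp
    ultimately show ?thesis
      by (simp only: scaleC_scaleC blinfun_scaleC_apply)
  qed
  have ev: "\<forall>\<^sub>F n in sequentially. cis \<phi> *\<^sub>C (\<i> *\<^sub>C x k - gs_proj x n (H0 (x k)))
      = ?V n (\<i> *\<^sub>C x k + gs_proj x n (H0 (x k)))"
    using eventually_gt_at_top[of k]
  proof eventually_elim
    case (elim n)
    have "compressed n (x k) = gs_proj x n (H0 (x k))"
      by (simp add: compressed_apply gs_proj_fix[OF elim])
    then show ?case
      using cayley_U_apply[OF compressed_adjoint, of \<phi> n "x k"] by (simp add: op_simps)
  qed
  have g: "(\<lambda>n. ?V n (\<i> *\<^sub>C x k + gs_proj x n (H0 (x k)))) \<longlonglongrightarrow> (2 * \<i>) *\<^sub>C U0 u"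
    by (rule Lim_transform_eventually[OF lim[unfolded lim_eq] ev])
  have "(\<lambda>n. ?V n ((2 * \<i>) *\<^sub>C u - (\<i> *\<^sub>C x k + gs_proj x n (H0 (x k))))) \<longlonglongrightarrow> 0"
  proof (rule tendsto_norm_zero_cancel)
    have "(\<lambda>n. norm ((2 * \<i>) *\<^sub>C u - (\<i> *\<^sub>C x k + gs_proj x n (H0 (x k))))) \<longlonglongrightarrow> norm ((2 * \<i>) *\<^sub>C u - (2 * \<i>) *\<^sub>C u)"
      by (intro tendsto_intros f)
    then show "(\<lambda>n. norm (?V n ((2 * \<i>) *\<^sub>C u - (\<i> *\<^sub>C x k + gs_proj x n (H0 (x k)))))) \<longlonglongrightarrow> 0"
      unfolding unitary_op_norm[OF V] by simp
  qed
  from tendsto_add[OF this g] have "(\<lambda>n. ?V n ((2 * \<i>) *\<^sub>C u)) \<longlonglongrightarrow> (2 * \<i>) *\<^sub>C U0 u"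
    by (simp add: blinfun.diff_right)
  from scaleC.tendsto[OF tendsto_const this, of "1 / (2 * \<i>)"] show ?thesis
    using V by (simp add: unitary_op_def clinear_op_def scaleC_scaleC)
qed

end

lemma approximating_projections:
  assumes sep: "separable_space (euclidean :: 'a topology)"
  obtains P :: "nat \<Rightarrow> 'a \<Rightarrow>\<^sub>L 'a"
  where "\<And>n. orth_projection (P n)" "\<And>n. finite_rank_op (P n)"
    "\<And>n. range (blinfun_apply (P n)) \<subseteq> cayley_dom \<phi> U0" "strong_star P id_blinfun"
    "\<And>n. unitary_op (cayley_U \<phi> (compress (P n) H0))"
    "strong_star (\<lambda>n. cayley_U \<phi> (compress (P n) H0)) U0"
proof -
  obtain d :: "nat \<Rightarrow> 'a" where d: "closure (range d) = UNIV"
    by (rule separable_dense_sequence[OF sep])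
  define x where "x k = d k + W (d k)" for k
  have x_dom: "x k \<in> cayley_dom \<phi> U0" for k
    by (auto simp: cayley_dom_iff x_def)
  have P: "(\<lambda>n. gs_proj x n v) \<longlonglongrightarrow> v" for v
  proof (rule gs_proj_tendsto)
    fix v assume v: "\<And>k. cinner v (x k) = 0"
    have "closed {u. cinner v (u + W u) = 0}"
      by (intro closed_Collect_eq continuous_intros cinner.continuous_on blinfun.continuous_on)
    then have "closure (range d) \<subseteq> {u. cinner v (u + W u) = 0}"
      using v by (intro closure_minimal) (auto simp: x_def)
    then have "cinner v (v + W v) = 0"
      using d by blast
    \<comment> \<open>As \<open>W\<close> is isometric, both squared norms in the expansion
      coincide; so orthogonality of \<open>v\<close> to v + W v forces v + W v = 0, and injectivity
      of 1 + W gives totality.\<close>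
    moreover have "(norm (v + W v))\<^sup>2 = 2 * Re (cinner v (v + W v))"
      by (simp only: norm_add_square norm_W cinner_add_right cinner_self plus_complex.sel Re_complex_of_real) simp
    ultimately have "(id_blinfun + W) v = (id_blinfun + W) 0"
      by (simp add: plus_blinfun.rep_eq del: blinfun_scaleC_apply)
    then show "v = 0"
      by (rule injD[OF plus_W_inj])
  qed
  let ?V = "\<lambda>n. cayley_U \<phi> (compress (gs_proj x n) H0)"
  have V: "unitary_op (?V n)" for n
    by (rule cayley_U_unitary[OF compressed_adjoint[OF x_dom]])
  have "(\<lambda>n. ?V n v) \<longlonglongrightarrow> U0 v" for v
  proof (rule strong_limit_dense[OF norm_unitary_le[OF V] d])
    fix u assume "u \<in> range d"
    then obtain k where "x k = u + W u"
      by (auto simp: x_def)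
    then show "(\<lambda>n. ?V n u) \<longlonglongrightarrow> U0 u"
      by (rule cayley_compressed_tendsto[OF x_dom P])
  qed
  then have "strong_star ?V U0"
    by (rule strong_star_unitary[OF V unitary])
  moreover have "strong_star (gs_proj x) id_blinfun"
    by (rule strong_starI[OF gs_proj_adjoint orth_projection_norm[OF gs_proj_orth] adjoint_pair_id])
      (simp_all add: P)
  ultimately show ?thesis
    using gs_proj_orth[of x] gs_proj_finite_rank[of x] gs_dom(1)[OF x_dom] V
    by (intro that[of "gs_proj x"]) auto
qed

end

section \<open>Taylor remainders of trigonometric polynomials\<close>

text \<open>The noncommutative Leibniz sum of X^j Y X^(n-1-j) over j < n, that is, the derivative of
  the n-th power at \<open>X\<close> in direction \<open>Y\<close>.\<close>

primrec pow_deriv :: "('a::chilbert_space \<Rightarrow>\<^sub>L 'a) \<Rightarrow> ('a \<Rightarrow>\<^sub>L 'a) \<Rightarrow> nat \<Rightarrow> 'a \<Rightarrow>\<^sub>L 'a"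
  where
    "pow_deriv X Y 0 = 0"
  | "pow_deriv X Y (Suc n) = (X o\<^sub>L pow_deriv X Y n) + (Y o\<^sub>L op_pow X n)"

text \<open>Peels off the last factor instead of the first; taking adjoints reverses products and
  turns one recursion into the other.\<close>

lemma pow_deriv_Suc_right: "pow_deriv X Y (Suc n) = (pow_deriv X Y n o\<^sub>L X) + (op_pow X n o\<^sub>L Y)"
proof (induction n)
  case (Suc n)
  have "pow_deriv X Y (Suc (Suc n)) =
      (X o\<^sub>L ((pow_deriv X Y n o\<^sub>L X) + (op_pow X n o\<^sub>L Y))) + (Y o\<^sub>L op_pow X (Suc n))"
    using Suc by (simp only: pow_deriv.simps(2)[of X Y "Suc n"])
  also have "\<dots> = (pow_deriv X Y (Suc n) o\<^sub>L X) + (op_pow X (Suc n) o\<^sub>L Y)"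
    by (simp add: compose.add_left compose.add_right compose_assoc op_pow_commute)
  finally show ?case .
qed simp

lemma adjoint_pair_pow_deriv:
  assumes "adjoint_pair X X'" "adjoint_pair Y Y'"
  shows "adjoint_pair (pow_deriv X Y n) (pow_deriv X' Y' n)"
proof (induction n)
  case (Suc n)
  then show ?case
    unfolding pow_deriv.simps(2)[of X Y] pow_deriv_Suc_right[of X' Y']
    by (intro adjoint_pair_add adjoint_pair_compose adjoint_pair_pow assms)
qed (simp add: adjoint_pair_0)

lemma op_pow_has_vector_derivative:
  assumes "(f has_vector_derivative Y) (at t)"
  shows "((\<lambda>s. op_pow (f s) n) has_vector_derivative pow_deriv (f t) Y n) (at t)"
proof (induction n)
  case 0
  then show ?case
    by simp
next
  case (Suc n)
  show ?case
    using bounded_bilinear.has_vector_derivative[OF bounded_bilinear_blinfun_compose assms Suc]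
    by simp
qed

section \<open>Derivatives along the exponential path\<close>

lemma op_exp_has_vector_derivative_0:
  assumes A: "clinear_op A"
  shows "((\<lambda>s. op_exp ((c * complex_of_real s) *\<^sub>C A)) has_vector_derivative (c *\<^sub>C A)) (at 0)"
  unfolding has_vector_derivative_def
proof (rule has_derivativeI_sandwich[where e = 1])
  \<comment> \<open>Bounds the remainder A E A after its factor s^2 has been taken out; since the
    modulus of s is below 1, the other powers of s are at most 1 and \<open>L\<close> does not
    depend on s.\<close>
  define L where "L = norm A * (\<Sum>k. cmod (c ^ (k + 2) / fact (k + 2)) * norm A ^ k) * norm A"
  show "bounded_linear (\<lambda>h. h *\<^sub>R c *\<^sub>C A)"
    by (rule bounded_linear_scaleR_left)
  show "((\<lambda>s. L * \<bar>s\<bar>) \<longlongrightarrow> 0) (at 0)"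
    by (auto intro!: tendsto_eq_intros)
  fix s :: real assume s: "s \<noteq> 0" "dist s 0 < 1"
  let ?z = "c * complex_of_real s"
  have "op_exp (?z *\<^sub>C A) - op_exp ((c * complex_of_real 0) *\<^sub>C A) - (s - 0) *\<^sub>R c *\<^sub>C A
      = A o\<^sub>L exp_remainder 2 ?z A o\<^sub>L A"
  proof -
    have "(s - 0) *\<^sub>R c *\<^sub>C A = ?z *\<^sub>C A"
      by (rule blinfun_eqI) (simp add: op_simps scaleR_scaleC scaleC_scaleC mult.commute)
    moreover have "op_exp ((c * complex_of_real 0) *\<^sub>C A) = id_blinfun"
    proof -
      have "exp_remainder 1 0 A = 0"
        by (simp add: exp_remainder_def op_series_def scaleC_blinfun.zero_left)
      then show ?thesis
        using op_exp_first_order[OF A, of 0] by simp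
    qed
    ultimately show ?thesis
      using op_exp_second_order[OF A, of ?z] by (simp only:) simp
  qed
  moreover have "norm (A o\<^sub>L exp_remainder 2 ?z A o\<^sub>L A) \<le> L * s\<^sup>2"
  proof -
    have "norm (exp_remainder 2 ?z A) \<le> (\<Sum>k. cmod (?z ^ (k + 2) / fact (k + 2)) * norm A ^ k)"
      unfolding exp_remainder_def by (rule norm_op_series[OF summable_exp_coeff order_refl])
    also have "\<dots> \<le> (\<Sum>k. s\<^sup>2 * (cmod (c ^ (k + 2) / fact (k + 2)) * norm A ^ k))"
    proof (rule suminf_le)
      fix k
      have "\<bar>s\<bar> ^ k \<le> 1"
        using s(2) by (intro power_le_one) auto
      then have "\<bar>s\<bar> ^ k * (s\<^sup>2 * (cmod (c ^ (k + 2) / fact (k + 2)) * norm A ^ k))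
          \<le> 1 * (s\<^sup>2 * (cmod (c ^ (k + 2) / fact (k + 2)) * norm A ^ k))"
        by (intro mult_right_mono) auto
      moreover have "cmod (?z ^ (k + 2) / fact (k + 2)) * norm A ^ k
          = \<bar>s\<bar> ^ k * (s\<^sup>2 * (cmod (c ^ (k + 2) / fact (k + 2)) * norm A ^ k))"
        by (simp add: power_mult_distrib norm_mult norm_divide norm_power power_add power2_eq_square
            abs_mult_self_eq mult_ac)
      ultimately show "cmod (?z ^ (k + 2) / fact (k + 2)) * norm A ^ k
          \<le> s\<^sup>2 * (cmod (c ^ (k + 2) / fact (k + 2)) * norm A ^ k)"
        by (simp only: mult_1)
    qed (intro summable_exp_coeff summable_mult)+
    also have "\<dots> = s\<^sup>2 * (\<Sum>k. cmod (c ^ (k + 2) / fact (k + 2)) * norm A ^ k)"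
      by (intro suminf_mult summable_exp_coeff)
    finally have "norm (A o\<^sub>L exp_remainder 2 ?z A o\<^sub>L A)
        \<le> norm A * (s\<^sup>2 * (\<Sum>k. cmod (c ^ (k + 2) / fact (k + 2)) * norm A ^ k)) * norm A"
      by (intro norm_compose_le order_refl)
    then show ?thesis
      by (simp add: L_def mult_ac)
  qed
  ultimately show "norm (op_exp (?z *\<^sub>C A) - op_exp ((c * complex_of_real 0) *\<^sub>C A)
      - (s - 0) *\<^sub>R c *\<^sub>C A) / norm (s - 0) \<le> L * \<bar>s\<bar>"
    using s(1) by (simp add: divide_le_eq power2_eq_square abs_mult_self_eq mult.assoc)
qed simp

text \<open>The inverse is written with the scalar \<open>(- \<i>) * complex_of_real s\<close>, so
  that the derivative of the exponential with \<open>c = - \<i>\<close> also serves the negative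
  powers.\<close>

lemma exp_path_unitary:
  assumes A: "adjoint_pair A A" and V: "unitary_op V"
  shows "unitary_op (exp_path A V s)"
    "op_inverse (exp_path A V s) = op_inverse V o\<^sub>L op_exp (((- \<i>) * complex_of_real s) *\<^sub>C A)"
proof -
  let ?E = "op_exp ((\<i> * complex_of_real s) *\<^sub>C A)" and ?E' = "op_exp (((- \<i>) * complex_of_real s) *\<^sub>C A)"
  have inv: "op_inverse ?E = ?E'"
    using unitary_exp(2)[OF A, of s] by simp
  note E = unitary_op_inverse[OF unitary_exp(1)[OF A, of s]] and Vi = unitary_op_inverse[OF V]
  have 1: "adjoint_pair (exp_path A V s) (op_inverse V o\<^sub>L op_inverse ?E)"
    unfolding exp_path_def by (intro adjoint_pair_compose unitary_op_adjoint unitary_exp(1) A V)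
  have "V o\<^sub>L (op_inverse V o\<^sub>L op_inverse ?E) = op_inverse ?E"
    using Vi(2) by (simp flip: compose_assoc)
  then have 2: "exp_path A V s o\<^sub>L (op_inverse V o\<^sub>L op_inverse ?E) = id_blinfun"
    unfolding exp_path_def compose_assoc by (simp only: E(2))
  have "op_inverse ?E o\<^sub>L (?E o\<^sub>L V) = V"
    using E(1) by (simp flip: compose_assoc)
  then have 3: "(op_inverse V o\<^sub>L op_inverse ?E) o\<^sub>L exp_path A V s = id_blinfun"
    unfolding exp_path_def compose_assoc by (simp only: Vi(1))
  show "unitary_op (exp_path A V s)" "op_inverse (exp_path A V s) = op_inverse V o\<^sub>L ?E'"
    using unitary_opI[OF 1 2 3] unfolding inv by auto
qed

lemma exp_path_0:
  assumes "clinear_op A"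
  shows "exp_path A V 0 = V"
proof -
  have "op_exp (0 *\<^sub>C A) = id_blinfun"
    unfolding op_exp_first_order[OF assms]
    by (simp add: exp_remainder_def op_series_def scaleC_blinfun.zero_left)
  then show ?thesis
    by (simp add: exp_path_def)
qed

text \<open>For negative \<open>r\<close> the power is a positive power of the inverse path V^(-1)
  e^(-isA), whose velocity at s = 0 is V^(-1) (-iA).\<close>

definition path_deriv :: "('a::chilbert_space \<Rightarrow>\<^sub>L 'a) \<Rightarrow> ('a \<Rightarrow>\<^sub>L 'a) \<Rightarrow> int \<Rightarrow> 'a \<Rightarrow>\<^sub>L 'a"
  where "path_deriv A V r =
    (if 0 \<le> r then pow_deriv V ((\<i> *\<^sub>C A) o\<^sub>L V) (nat r)
     else pow_deriv (op_inverse V) (op_inverse V o\<^sub>L ((- \<i>) *\<^sub>C A)) (nat (- r)))"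

lemma op_powi_path_has_vector_derivative:
  assumes A: "adjoint_pair A A" and V: "unitary_op V"
  shows "((\<lambda>s. op_powi (exp_path A V s) r) has_vector_derivative path_deriv A V r) (at 0)"
proof (cases "0 \<le> r")
  case True
  have "((\<lambda>s. exp_path A V s) has_vector_derivative ((\<i> *\<^sub>C A) o\<^sub>L V)) (at 0)"
    unfolding exp_path_def
    by (rule bounded_linear.has_vector_derivative[OF compose.bounded_linear_left
          op_exp_has_vector_derivative_0[OF adjoint_pair_clinear[OF A]]])
  from op_pow_has_vector_derivative[OF this, of "nat r"] show ?thesis
    using True by (simp add: op_powi_def path_deriv_def exp_path_0[OF adjoint_pair_clinear[OF A]])
next
  case False
  have "((\<lambda>s. op_inverse (exp_path A V s)) has_vector_derivative (op_inverse V o\<^sub>L ((- \<i>) *\<^sub>C A))) (at 0)"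
    unfolding exp_path_unitary(2)[OF A V]
    by (rule bounded_linear.has_vector_derivative[OF compose.bounded_linear_right
          op_exp_has_vector_derivative_0[OF adjoint_pair_clinear[OF A]]])
  from op_pow_has_vector_derivative[OF this, of "nat (- r)"] show ?thesis
    using False by (simp add: op_powi_def path_deriv_def exp_path_0[OF adjoint_pair_clinear[OF A]])
qed

definition trig_poly_deriv ::
    "int set \<Rightarrow> (int \<Rightarrow> complex) \<Rightarrow> ('a::chilbert_space \<Rightarrow>\<^sub>L 'a) \<Rightarrow> ('a \<Rightarrow>\<^sub>L 'a) \<Rightarrow> 'a \<Rightarrow>\<^sub>L 'a"
  where "trig_poly_deriv R a A V = (\<Sum>r\<in>R. a r *\<^sub>C path_deriv A V r)"

lemma trig_poly_path_has_vector_derivative: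
  assumes A: "adjoint_pair A A" and V: "unitary_op V"
  shows "((\<lambda>s. trig_poly R a (exp_path A V s)) has_vector_derivative trig_poly_deriv R a A V) (at 0)"
  unfolding trig_poly_def trig_poly_deriv_def
  by (intro has_vector_derivative_sum
      bounded_linear.has_vector_derivative[OF scaleC_blinfun.bounded_linear_right]
      op_powi_path_has_vector_derivative assms)

section \<open>Taylor remainders R_r for integer r, and their adjoints\<close>

definition taylor_remainder :: "('a::chilbert_space \<Rightarrow>\<^sub>L 'a) \<Rightarrow> ('a \<Rightarrow>\<^sub>L 'a) \<Rightarrow> int \<Rightarrow> 'a \<Rightarrow>\<^sub>L 'a"
  where "taylor_remainder A V r = op_powi (exp_path A V 1) r - op_powi V r - path_deriv A V r"

lemma op_powi_adjoint:
  assumes "unitary_op V"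
  shows "adjoint_pair (op_powi V r) (op_powi V (- r))"
  using adjoint_pair_pow[OF unitary_op_adjoint[OF assms]]
    adjoint_pair_pow[OF adjoint_pair_sym[OF unitary_op_adjoint[OF assms]]]
  by (cases "r = 0") (auto simp: op_powi_def adjoint_pair_id)

text \<open>The inverse of a unitary is its adjoint, so passing to adjoints exchanges the powers r
  and -r, in the derivative as well. The derivatives are compared for \<open>0 \<le> r\<close>; the
  other sign follows by symmetry of the relation.\<close>

lemma taylor_remainder_adjoint:
  assumes A: "adjoint_pair A A" and V: "unitary_op V"
  shows "adjoint_pair (taylor_remainder A V r) (taylor_remainder A V (- r))"
proof -
  have *: "adjoint_pair (path_deriv A V r) (path_deriv A V (- r))" if "0 \<le> r" for r
  proof (cases "r = 0")
    case False
    have "adjoint_pair ((\<i> *\<^sub>C A) o\<^sub>L V) (op_inverse V o\<^sub>L ((- \<i>) *\<^sub>C A))"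
      using adjoint_pair_compose[OF adjoint_pair_scaleC[OF A, of \<i>] unitary_op_adjoint[OF V]] by simp
    from adjoint_pair_pow_deriv[OF unitary_op_adjoint[OF V] this, of "nat r"] show ?thesis
      using that False by (simp add: path_deriv_def)
  qed (simp add: path_deriv_def adjoint_pair_0)
  have "adjoint_pair (path_deriv A V r) (path_deriv A V (- r))"
    using *[of r] adjoint_pair_sym[OF *[of "- r"]] by (cases "0 \<le> r") auto
  then show ?thesis
    unfolding taylor_remainder_def
    by (intro adjoint_pair_diff op_powi_adjoint exp_path_unitary V A)
qed

lemma exp_path_1_first_order:
  assumes "clinear_op T"
  shows "exp_path T W 1 = W + (T o\<^sub>L exp_remainder 1 \<i> T o\<^sub>L W)"
  using op_exp_first_order[OF assms, of \<i>] by (simp add: exp_path_def compose.add_left)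

lemma exp_path_1_second_order:
  assumes "clinear_op T"
  shows "exp_path T W 1 = W + ((\<i> *\<^sub>C T) o\<^sub>L W) + (T o\<^sub>L exp_remainder 2 \<i> T o\<^sub>L T o\<^sub>L W)"
  using op_exp_second_order[OF assms, of \<i>] by (simp add: exp_path_def compose.add_left)

section \<open>The remainders as limits of compressed remainders\<close>

context hilbert_schmidt_self_adjoint
begin

lemma sandwich_adjoint_eq:
  assumes "sandwich F T" "\<And>n. adjoint_pair (F n) (F' n)" "adjoint_pair T T'"
  shows "sandwich F' T'"
proof -
  obtain G S where G: "\<forall>n. adjoint_pair (F n) (G n)" "adjoint_pair T S" "sandwich G S"
    using sandwich_adjoint[OF assms(1)] by blast
  have "G = F'" "S = T'"
    using G assms(2,3) by (auto intro: adjoint_pair_unique)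
  then show ?thesis
    using G(3) by simp
qed

context
  fixes P V :: "nat \<Rightarrow> 'a \<Rightarrow>\<^sub>L 'a" and U0 :: "'a \<Rightarrow>\<^sub>L 'a"
  assumes P: "\<And>n. orth_projection (P n)" "strong_star P id_blinfun"
    and V: "\<And>n. unitary_op (V n)" "strong_star V U0" and U0: "unitary_op U0"
begin

abbreviation An :: "nat \<Rightarrow> 'a \<Rightarrow>\<^sub>L 'a"
  where "An n \<equiv> P n o\<^sub>L A o\<^sub>L P n"

lemma An_adjoint: "adjoint_pair (An n) (An n)"
  using adjoint_pair_compose[OF adjoint_pair_compose[OF _ adj]] P(1)[of n]
  by (simp add: orth_projection_iff compose_assoc)

lemma An_strong_star: "strong_star An A"
  using strong_star_compose[OF strong_star_compose[OF P(2) strong_star_const[OF adj]] P(2)] by simp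

lemma norm_An: "norm (An n) \<le> norm A"
  using norm_compose_le[OF norm_compose_le[OF orth_projection_norm[OF P(1)] order_refl]
      orth_projection_norm[OF P(1)], of n A n] by simp

lemma exp_remainder_strong_star: "strong_star (\<lambda>n. exp_remainder m z (An n)) (exp_remainder m z A)"
  unfolding exp_remainder_def
  by (rule strong_star_op_series[OF An_strong_star norm_An order_refl summable_exp_coeff])

text \<open>The projections of each \<open>An n\<close> go to its neighbours: F P, P G P and P H
  still converge to X, Y and Z because P tends to the identity. What is left between them is the
  fixed operator \<open>A\<close>.\<close>

lemma sandwich_An:
  assumes "strong_star F X" "strong_star G Y" "strong_star H Z"
  shows "sandwich (\<lambda>n. F n o\<^sub>L An n o\<^sub>L G n o\<^sub>L An n o\<^sub>L H n) (X o\<^sub>L A o\<^sub>L Y o\<^sub>L A o\<^sub>L Z)"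
  using sandwich.base[OF strong_star_compose[OF assms(1) P(2)]
      strong_star_compose[OF strong_star_compose[OF P(2) assms(2)] P(2)]
      strong_star_compose[OF P(2) assms(3)]]
  by (simp add: compose_assoc)

abbreviation U_n :: "nat \<Rightarrow> 'a \<Rightarrow>\<^sub>L 'a"
  where "U_n n \<equiv> exp_path (An n) (V n) 1"

lemma U_n_strong_star: "strong_star U_n (exp_path A U0 1)"
  unfolding exp_path_1_first_order[OF adjoint_pair_clinear[OF An_adjoint]]
    exp_path_1_first_order[OF adjoint_pair_clinear[OF adj]]
  by (intro strong_star_add strong_star_compose V An_strong_star exp_remainder_strong_star)

text \<open>The prefix contributes the first factor \<open>A\<close>; the second emerges from U - W
  = T \<open>exp_remainder 1 \<i> T\<close> W at each step of the recursion for differences of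
  powers.\<close>

lemma sandwich_pow_diff:
  assumes "strong_star F X" "strong_star G Y"
  shows "sandwich (\<lambda>n. F n o\<^sub>L An n o\<^sub>L G n o\<^sub>L (op_pow (U_n n) k - op_pow (V n) k))
    (X o\<^sub>L A o\<^sub>L Y o\<^sub>L (op_pow (exp_path A U0 1) k - op_pow U0 k))"
  using assms
\<comment> \<open>\<open>G\<close> and \<open>Y\<close> must vary, since the induction step
  multiplies the middle factor by \<open>U_n n\<close> and its limit.\<close>
proof (induction k arbitrary: F X G Y)
  case 0
  then show ?case
    by (simp add: sandwich_0)
next
  case (Suc k)
  \<comment> \<open>Stated for general \<open>T\<close> and \<open>W\<close>, to rewrite the
    approximants and the limit by the same identity.\<close>
  have step: "F o\<^sub>L T o\<^sub>L G o\<^sub>L (op_pow (exp_path T W 1) (Suc k) - op_pow W (Suc k)) =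
      (F o\<^sub>L T o\<^sub>L (G o\<^sub>L exp_path T W 1) o\<^sub>L (op_pow (exp_path T W 1) k - op_pow W k)) +
      (F o\<^sub>L T o\<^sub>L G o\<^sub>L T o\<^sub>L (exp_remainder 1 \<i> T o\<^sub>L W o\<^sub>L op_pow W k))"
    if "clinear_op T" for F T G W
  proof -
    define U where "U = exp_path T W 1"
    have U: "U = W + (T o\<^sub>L exp_remainder 1 \<i> T o\<^sub>L W)"
      unfolding U_def by (rule exp_path_1_first_order[OF that])
    have "op_pow U (Suc k) - op_pow W (Suc k) =
        (U o\<^sub>L (op_pow U k - op_pow W k)) + ((U - W) o\<^sub>L op_pow W k)"
      by (simp add: compose.diff_left compose.diff_right)
    also have "U - W = T o\<^sub>L exp_remainder 1 \<i> T o\<^sub>L W"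
      by (simp add: U)
    finally show ?thesis
      unfolding U_def[symmetric] by (simp only: compose.add_right compose_assoc)
  qed
  show ?case
    unfolding step[OF adjoint_pair_clinear[OF An_adjoint]] step[OF adjoint_pair_clinear[OF adj]]
    by (intro sandwich.add Suc.IH sandwich_An strong_star_compose Suc.prems U_n_strong_star
        exp_remainder_strong_star V strong_star_pow)
qed

lemma sandwich_taylor_nat:
  "sandwich (\<lambda>n. op_pow (U_n n) k - op_pow (V n) k - pow_deriv (V n) ((\<i> *\<^sub>C An n) o\<^sub>L V n) k)
    (op_pow (exp_path A U0 1) k - op_pow U0 k - pow_deriv U0 ((\<i> *\<^sub>C A) o\<^sub>L U0) k)"
proof (induction k)
  case 0
  then show ?case
    by (simp add: sandwich_0)
next
  case (Suc k)
  \<comment> \<open>The identity factors are inserted so that the last two summands match the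
    patterns of \<open>sandwich_pow_diff\<close> and \<open>sandwich_An\<close>.\<close>
  have step: "op_pow (exp_path T W 1) (Suc k) - op_pow W (Suc k) - pow_deriv W ((\<i> *\<^sub>C T) o\<^sub>L W) (Suc k) =
      ((W o\<^sub>L (op_pow (exp_path T W 1) k - op_pow W k - pow_deriv W ((\<i> *\<^sub>C T) o\<^sub>L W) k)) +
       (id_blinfun o\<^sub>L T o\<^sub>L (exp_remainder 1 \<i> T o\<^sub>L W) o\<^sub>L (op_pow (exp_path T W 1) k - op_pow W k))) +
      (id_blinfun o\<^sub>L T o\<^sub>L exp_remainder 2 \<i> T o\<^sub>L T o\<^sub>L (W o\<^sub>L op_pow W k))"
    if "clinear_op T" for T W
  proof -
    define U where "U = exp_path T W 1"
    have 1: "U - W = T o\<^sub>L exp_remainder 1 \<i> T o\<^sub>L W"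
      unfolding U_def exp_path_1_first_order[OF that] by simp
    have 2: "U - W - ((\<i> *\<^sub>C T) o\<^sub>L W) = T o\<^sub>L exp_remainder 2 \<i> T o\<^sub>L T o\<^sub>L W"
      unfolding U_def exp_path_1_second_order[OF that] by simp
    have "op_pow U (Suc k) - op_pow W (Suc k) - pow_deriv W ((\<i> *\<^sub>C T) o\<^sub>L W) (Suc k) =
        ((W o\<^sub>L (op_pow U k - op_pow W k - pow_deriv W ((\<i> *\<^sub>C T) o\<^sub>L W) k)) +
         ((U - W) o\<^sub>L (op_pow U k - op_pow W k))) + ((U - W - ((\<i> *\<^sub>C T) o\<^sub>L W)) o\<^sub>L op_pow W k)"
      by (simp add: compose.diff_left compose.diff_right)
    then show ?thesis
      unfolding 2 unfolding 1 unfolding U_def by (simp only: compose_assoc compose_id)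
  qed
  show ?case
    unfolding step[OF adjoint_pair_clinear[OF An_adjoint]] step[OF adjoint_pair_clinear[OF adj]]
    by (intro sandwich.add sandwich_left[OF Suc.IH V(2)] sandwich_pow_diff sandwich_An
        strong_star_compose strong_star_id exp_remainder_strong_star V strong_star_pow)
qed

lemma sandwich_taylor: "sandwich (\<lambda>n. taylor_remainder (An n) (V n) r) (taylor_remainder A U0 r)"
proof -
  have nonneg: "sandwich (\<lambda>n. taylor_remainder (An n) (V n) r) (taylor_remainder A U0 r)" if "0 \<le> r" for r
    using sandwich_taylor_nat[of "nat r"] that by (simp add: taylor_remainder_def op_powi_def path_deriv_def)
  show ?thesis
  proof (cases "0 \<le> r")
    case False
    show ?thesis
    proof (rule sandwich_adjoint_eq)
      show "sandwich (\<lambda>n. taylor_remainder (An n) (V n) (- r)) (taylor_remainder A U0 (- r))"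
        using False by (intro nonneg) simp
      show "adjoint_pair (taylor_remainder (An n) (V n) (- r)) (taylor_remainder (An n) (V n) r)" for n
        using taylor_remainder_adjoint[OF An_adjoint V(1), of n n "- r"] by simp
      show "adjoint_pair (taylor_remainder A U0 (- r)) (taylor_remainder A U0 r)"
        using taylor_remainder_adjoint[OF adj U0, of "- r"] by simp
    qed
  qed (rule nonneg)
qed

text \<open>The outer projections are absorbed as well, since they tend to the identity; hence the
  limit is the uncompressed remainder.\<close>

lemma sandwich_trig_poly:
  "sandwich (\<lambda>n. P n o\<^sub>L (trig_poly R a (U_n n) - trig_poly R a (V n) - trig_poly_deriv R a (An n) (V n)) o\<^sub>L P n)
    (trig_poly R a (exp_path A U0 1) - trig_poly R a U0 - trig_poly_deriv R a A U0)"
proof -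
  have eq: "trig_poly R a (exp_path T W 1) - trig_poly R a W - trig_poly_deriv R a T W =
      (\<Sum>r\<in>R. a r *\<^sub>C taylor_remainder T W r)" for T W :: "'a \<Rightarrow>\<^sub>L 'a"
    unfolding trig_poly_def trig_poly_deriv_def taylor_remainder_def
    by (simp only: scaleC_blinfun.diff_right sum_subtractf)
  have "sandwich (\<lambda>n. \<Sum>r\<in>R. a r *\<^sub>C taylor_remainder (An n) (V n) r) (\<Sum>r\<in>R. a r *\<^sub>C taylor_remainder A U0 r)"
    by (intro sandwich_sum sandwich_scaleC sandwich_taylor)
  from sandwich_right[OF sandwich_left[OF this P(2)] P(2)] show ?thesis
    unfolding eq by simp
qed

end

end

section \<open>Assembly of the approximation formula\<close>

lemma hilbert_schmidt_self_adjointI: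
  assumes "self_adjoint_op A" "hilbert_schmidt A"
  obtains B where "hilbert_schmidt_self_adjoint A B"
  using assms unfolding hilbert_schmidt_def hilbert_schmidt_self_adjoint_def self_adjoint_iff by blast

theorem theorem3p7:
  fixes U U0 A :: "'a::chilbert_space \<Rightarrow>\<^sub>L 'a"
    and \<phi> :: real and R :: "int set" and a :: "int \<Rightarrow> complex"
  assumes "separable_space (euclidean :: 'a topology)"
    and "unitary_op U" and "unitary_op U0"
    and "hilbert_schmidt (U - U0)"
    and "self_adjoint_op A" and "hilbert_schmidt A"
    and "U = op_exp (\<i> *\<^sub>C A) o\<^sub>L U0"
    and "finite R"
    and "- pi < \<phi>" and "\<phi> \<le> pi"
    and "inj (blinfun_apply (cis \<phi> *\<^sub>C id_blinfun + U0))"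
  shows "(\<lambda>s. trig_poly R a (exp_path A U0 s)) differentiable (at 0)
    \<and> trace_class (trig_poly R a U - trig_poly R a U0
          - vector_derivative (\<lambda>s. trig_poly R a (exp_path A U0 s)) (at 0))
    \<and> (\<exists>P :: nat \<Rightarrow> 'a \<Rightarrow>\<^sub>L 'a.
        (\<forall>n. orth_projection (P n) \<and> finite_rank_op (P n)
           \<and> range (blinfun_apply (P n)) \<subseteq> cayley_dom \<phi> U0)
      \<and> (\<forall>n. let An = P n o\<^sub>L A o\<^sub>L P n;
                 U0n = cayley_U \<phi> (compress (P n) (cayley_H \<phi> U0))
             in (\<lambda>s. trig_poly R a (exp_path An U0n s)) differentiable (at 0))
      \<and> (\<lambda>n. let An = P n o\<^sub>L A o\<^sub>L P n;
                 U0n = cayley_U \<phi> (compress (P n) (cayley_H \<phi> U0));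
                 U1n = op_exp (\<i> *\<^sub>C An) o\<^sub>L U0n
             in op_trace (P n o\<^sub>L
                  (trig_poly R a U1n - trig_poly R a U0n
                    - vector_derivative (\<lambda>s. trig_poly R a (exp_path An U0n s)) (at 0))
                  o\<^sub>L P n))
        \<longlonglongrightarrow> op_trace (trig_poly R a U - trig_poly R a U0
              - vector_derivative (\<lambda>s. trig_poly R a (exp_path A U0 s)) (at 0)))"
proof -
  obtain B where "hilbert_schmidt_self_adjoint A B"
    by (rule hilbert_schmidt_self_adjointI[OF assms(5,6)])
  then interpret hilbert_schmidt_self_adjoint A B .
  interpret unitary_phase U0 \<phi>
    by unfold_locales (fact assms)+
  obtain P :: "nat \<Rightarrow> 'a \<Rightarrow>\<^sub>L 'a"
    where P: "\<And>n. orth_projection (P n)" "\<And>n. finite_rank_op (P n)"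
      "\<And>n. range (blinfun_apply (P n)) \<subseteq> cayley_dom \<phi> U0" "strong_star P id_blinfun"
      and V: "\<And>n. unitary_op (cayley_U \<phi> (compress (P n) (cayley_H \<phi> U0)))"
        "strong_star (\<lambda>n. cayley_U \<phi> (compress (P n) (cayley_H \<phi> U0))) U0"
    by (rule approximating_projections[OF assms(1)]) (rule that)
  let ?V = "\<lambda>n. cayley_U \<phi> (compress (P n) (cayley_H \<phi> U0))"
  let ?T = "trig_poly R a U - trig_poly R a U0 - trig_poly_deriv R a A U0"
  let ?Tn = "\<lambda>n. P n o\<^sub>L (trig_poly R a (exp_path (P n o\<^sub>L A o\<^sub>L P n) (?V n) 1) - trig_poly R a (?V n)
    - trig_poly_deriv R a (P n o\<^sub>L A o\<^sub>L P n) (?V n)) o\<^sub>L P n"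
  note deriv = trig_poly_path_has_vector_derivative[OF adj unitary, of R a]
  have deriv_n: "((\<lambda>s. trig_poly R a (exp_path (P n o\<^sub>L A o\<^sub>L P n) (?V n) s)) has_vector_derivative
      trig_poly_deriv R a (P n o\<^sub>L A o\<^sub>L P n) (?V n)) (at 0)" for n
    by (rule trig_poly_path_has_vector_derivative[OF An_adjoint[OF P(1,4) V unitary] V(1)])
  have U: "U = exp_path A U0 1"
    by (simp add: assms(7) exp_path_def)
  have sw: "sandwich ?Tn ?T"
    unfolding U by (rule sandwich_trig_poly[OF P(1,4) V unitary])
  \<comment> \<open>The trace class criterion asks for an adjoint of the limit, which its sandwich
    form provides.\<close>
  obtain T' where T': "adjoint_pair ?T T'"
    using sandwich_adjoint[OF sw] by blast
  have "trace_class ?T"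
    using sandwich_trace[OF sw] by (intro nuclear_trace_class[OF assms(1) T']) simp
  moreover have "?Tn n = P n o\<^sub>L
      (trig_poly R a (op_exp (\<i> *\<^sub>C (P n o\<^sub>L A o\<^sub>L P n)) o\<^sub>L ?V n) - trig_poly R a (?V n)
        - vector_derivative (\<lambda>s. trig_poly R a (exp_path (P n o\<^sub>L A o\<^sub>L P n) (?V n) s)) (at 0))
      o\<^sub>L P n" for n
    unfolding vector_derivative_at[OF deriv_n] by (simp add: exp_path_def)
  ultimately show ?thesis
    using P(1-3) differentiableI_vector[OF deriv] differentiableI_vector[OF deriv_n] sandwich_trace[OF sw]
    unfolding Let_def vector_derivative_at[OF deriv] by (intro conjI exI[of _ P]) simp_all
qed

end
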